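(* Let $\mathcal{P}_0$ be a family of distributions $P$ of $(X,Y,Z)$ with $Z\in\mathbb{R}^d$ (where $d$ may depend on $n$ and may exceed $n$), $Y\in\mathbb{R}$, such that for each $P\in\mathcal{P}_0$ there is $\boldsymbol\gamma_P\in\mathbb{R}^d$ with $$Y=\boldsymbol\gamma_P^\top Z+\varepsilon_P,\qquad\mathbb{E}_P(\varepsilon_P\mid X,Z)=0.$$ Let $T$ be computed using Algorithm 1 (see context), where Lasso regressions are used to construct both $\hat m$ and $\hat m_{\hat f}$, and the regressions involved in the construction of $\hat f$ are arbitrary. Suppose that: (a) there exist $\delta\in(0,2]$ and $c,C>0$ such that $\mathbb{E}_P(\varepsilon_P^2\mid X,Z)\ge c$ and $\mathbb{E}_P(|\varepsilon_P|^{2+\delta}\mid X,Z)\le C$ for all $P\in\mathcal{P}_0$; (b) writing $u_{n,i}:=\hat f(X_i,Z_i)-\hat m_{\hat f}(Z_i)$ and $\upsilon_{n,i}:=u_{n,i}/\bigl(\sum_{i'=1}^nu_{n,i'}^2\bigr)^{1/2}$ for $i\in[n]$, we have $\max_{i\in[n]}|\upsilon_{n,i}|=o_{\mathcal{P}_0}(1)$ and $\sum_{i=1}^n\upsilon_{n,i}^2=1+o_{\mathcal{P}_0}(1)$; (c) letting $\hat{\boldsymbol\gamma}$ denote the coefficient vector from the $\hat m$ regression (so $\hat m(z)=\hat{\boldsymbol\gamma}^\top z$), $\max_{i\in[n]}\|Z_i\|_\infty\cdot\|\hat{\boldsymbol\gamma}-\boldsymbol\gamma_P\|_1=o_{\mathcal{P}_0}(1)$;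 (d) $\displaystyle\|\hat{\boldsymbol\gamma}-\boldsymbol\gamma_P\|_1\cdot\Bigl\|\sum_{i=1}^nZ_i\upsilon_{n,i}\Bigr\|_\infty=o_{\mathcal{P}_0}(1)$. Then, as $n\to\infty$, $$\sup_{P\in\mathcal{P}_0}\sup_{t\in\mathbb{R}}\bigl|\mathbb{P}_P(T\le t)-\Phi(t)\bigr|\to0.$$
   Context: Conventions: $0/0:=0$, $\mathrm{sgn}(0):=0$, $\Phi$ is the standard normal distribution function. Families of distributions may depend on $n$. $X_{P,n}=o_{\mathcal P}(1)$ means $\sup_{P\in\mathcal P}\mathbb P_P(|X_{P,n}|>\epsilon)\to0$ for every $\epsilon>0$. Conditional inequalities hold almost surely. A regression method is any procedure which, from response–predictor pairs, returns a fitted function (possibly using extra independent randomness). A Lasso regression of responses $R_i$ on $Z_i$, $i\in[n]$, returns the linear function $z\mapsto\hat{\boldsymbol b}^\top z$ with $\hat{\boldsymbol b}$ a minimiser over $\boldsymbol b\in\mathbb R^d$ of $\frac1{n}\sum_i(R_i-\boldsymbol b^\top Z_i)^2+\lambda\|\boldsymbol b\|_1$, where the tuning parameter $\lambda\ge0$ may depend on the data $(R_i,Z_i)_i$ of that regression; variants such as the square-root Lasso (in which the first term is replaced by its square root) are also allowed. Algorithm 1 (Projected Covariance Measure). Data: $2n$ i.i.d. copies $(X_i,Y_i,Z_i)$ of $(X,Y,Z)$, split into $\mathcal D_1$ (indices $\mathcal I_1=[n]=\{1,\dots,n\}$) and $\mathcal D_2$ (indices $\mathcal I_2=\{n+1,\dots,2n\}$);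 user-chosen regression methods. 1. (i) Regress $Y$ on $(X,Z)$ using $\mathcal D_2$, giving $\hat g$. (ii) If $\hat g$ can be modified so that all components involving only $Z$ are set to $0$, let $\tilde g$ be this modified version; alternatively set $\tilde g:=\hat g$. (iii) Regress $\tilde g(X,Z)$ on $Z$ using $\mathcal D_2$, giving $\tilde m$; set $\tilde h(x,z):=\tilde g(x,z)-\tilde m(z)$. (iv) With $\hat\rho:=\frac1n\sum_{i\in\mathcal I_2}\{Y_i-\hat g(X_i,Z_i)+\tilde g(X_i,Z_i)-\tilde m(Z_i)\}\tilde h(X_i,Z_i)$, set $\hat h:=\mathrm{sgn}(\hat\rho)\tilde h$. 2. Regress $\{Y-\hat g(X,Z)\}^2$ on $(X,Z)$ using $\mathcal D_2$, giving $\tilde v$. Let $a(c):=\frac1n\sum_{i\in\mathcal I_2}\frac{\{Y_i-\hat g(X_i,Z_i)\}^2}{\max\{\tilde v(X_i,Z_i),0\}+c}$; if $a(0)\le1$ set $\hat c:=0$, otherwise let $\hat c$ solve $a(c)=1$. Set $\hat v:=\max\{\tilde v,0\}+\hat c$. 3. Set $\hat f:=\hat h/\hat v$. Regress $\hat f(X,Z)$ on $Z$ using $\mathcal D_1$, giving $\hat m_{\hat f}$; regress $Y$ on $Z$ using $\mathcal D_1$, giving $\hat m$. For $i\in\mathcal I_1$ let $L_i:=\{Y_i-\hat m(Z_i)\}\{\hat f(X_i,Z_i)-\hat m_{\hat f}(Z_i)\}$ and $$T:=\frac{\frac1{\sqrt n}\sum_{i\in\mathcal I_1}L_i}{\sqrt{\frac1n\sum_{i\in\mathcal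 I_1}L_i^2-\bigl(\frac1n\sum_{i\in\mathcal I_1}L_i\bigr)^2}}.$$ *)

theory Defs
  imports "HOL-Probability.Probability"
begin

section \<open>Observations\<close>

text \<open>
  The dimension \<open>d\<close> of \<open>Z\<close> varies with \<open>n\<close>, so vectors are functions \<open>nat \<Rightarrow> real\<close> of which only
  the coordinates below \<open>d\<close> matter.
\<close>

type_synonym rvec = "nat \<Rightarrow> real"

definition vec_space :: "nat \<Rightarrow> rvec measure" where
  "vec_space d = PiM {..<d} (\<lambda>_. borel)"

definition dotp :: "nat \<Rightarrow> rvec \<Rightarrow> rvec \<Rightarrow> real" where
  "dotp d b z = (\<Sum>j<d. b j * z j)"

definition norm_l1 :: "nat \<Rightarrow> rvec \<Rightarrow> real" where
  "norm_l1 d b = (\<Sum>j<d. \<bar>b j\<bar>)"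

definition norm_linf :: "nat \<Rightarrow> rvec \<Rightarrow> real" where
  "norm_linf d z = Max ((\<lambda>j. \<bar>z j\<bar>) ` {..<d})"

type_synonym 'x obs = "'x \<times> real \<times> rvec"

definition obsX :: "'x obs \<Rightarrow> 'x" where "obsX v = fst v"
definition obsY :: "'x obs \<Rightarrow> real" where "obsY v = fst (snd v)"
definition obsZ :: "'x obs \<Rightarrow> rvec" where "obsZ v = snd (snd v)"
definition obsXZ :: "'x obs \<Rightarrow> 'x \<times> rvec" where "obsXZ v = (obsX v, obsZ v)"

definition obs_space :: "'x measure \<Rightarrow> nat \<Rightarrow> 'x obs measure" where
  "obs_space MX d = MX \<Otimes>\<^sub>M (borel \<Otimes>\<^sub>M vec_space d)"

text \<open>The \<open>\<sigma>\<close>-algebra generated by \<open>(X,Z)\<close>.\<close>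

definition sigma_XZ :: "'x measure \<Rightarrow> nat \<Rightarrow> 'x obs measure" where
  "sigma_XZ MX d = vimage_algebra (space (obs_space MX d)) obsXZ (MX \<Otimes>\<^sub>M vec_space d)"

definition noise :: "nat \<Rightarrow> rvec \<Rightarrow> 'x obs \<Rightarrow> real" where
  "noise d \<gamma> v = obsY v - dotp d \<gamma> (obsZ v)"


section \<open>Regression methods\<close>

text \<open>
  A regression method maps a random seed and \<open>n\<close> response-predictor pairs, indexed by \<open>{1..n}\<close>, to a
  fitted function. A method that is not randomised ignores its seed.
\<close>

type_synonym 'p pairs = "nat \<Rightarrow> real \<times> 'p"
type_synonym ('s, 'p, 'q) fitting = "'s \<Rightarrow> 'p pairs \<Rightarrow> 'q \<Rightarrow> real"

definition pairs_space :: "nat \<Rightarrow> 'p measure \<Rightarrow> 'p pairs measure" where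
  "pairs_space n MP = PiM {1..n} (\<lambda>_. borel \<Otimes>\<^sub>M MP)"

definition measurable_fitting ::
  "nat \<Rightarrow> 's measure \<Rightarrow> 'p measure \<Rightarrow> 'q measure \<Rightarrow> ('s, 'p, 'q) fitting \<Rightarrow> bool" where
  "measurable_fitting n S MP MQ r \<longleftrightarrow>
    (\<lambda>(s, D, q). r s D q) \<in> borel_measurable (S \<Otimes>\<^sub>M (pairs_space n MP \<Otimes>\<^sub>M MQ))"

text \<open>\<open>\<psi>\<close> is the identity for the Lasso and the square root for the square-root Lasso.\<close>

definition lasso_objective ::
  "(real \<Rightarrow> real) \<Rightarrow> nat \<Rightarrow> nat \<Rightarrow> real \<Rightarrow> rvec pairs \<Rightarrow> rvec \<Rightarrow> real" where
  "lasso_objective \<psi> n d lam D b =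
    \<psi> ((\<Sum>i\<in>{1..n}. (fst (D i) - dotp d b (snd (D i)))\<^sup>2) / real n) + lam * norm_l1 d b"

text \<open>
  \<open>r\<close> is a Lasso regression with coefficient vector \<open>b s D\<close>. The tuning parameter and, where it is
  not unique, the minimiser may depend on the data of this regression and on its seed
  (as in cross-validation with random folds).
\<close>

definition lasso_regression ::
  "nat \<Rightarrow> nat \<Rightarrow> 's measure \<Rightarrow> ('s, rvec, rvec) fitting \<Rightarrow> ('s \<Rightarrow> rvec pairs \<Rightarrow> rvec) \<Rightarrow> bool" where
  "lasso_regression n d S r b \<longleftrightarrow>
    (\<exists>\<psi> lam. (\<psi> = (\<lambda>t. t) \<or> \<psi> = sqrt) \<and>
      (\<forall>s\<in>space S. \<forall>D\<in>space (pairs_space n (vec_space d)).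
        0 \<le> lam s D \<and>
        (\<forall>b'. lasso_objective \<psi> n d (lam s D) D (b s D) \<le> lasso_objective \<psi> n d (lam s D) D b') \<and>
        (\<forall>z\<in>space (vec_space d). r s D z = dotp d (b s D) z)))"


section \<open>The projected covariance measure\<close>

text \<open>
  \<open>reg_g\<close> fits \<open>g\<close>; \<open>reg_g_Z\<close>, using the same seed and data, is the sum of those components of the
  fitted function that involve only \<open>Z\<close>. The choice of leaving the fitted function unmodified
  corresponds to \<open>reg_g_Z = 0\<close>.
\<close>

record ('s, 'x) pcm_methods =
  reg_g :: "('s, 'x \<times> rvec, 'x \<times> rvec) fitting"
  reg_g_Z :: "('s, 'x \<times> rvec, rvec) fitting"
  reg_mtilde :: "('s, rvec, rvec) fitting"
  reg_v :: "('s, 'x \<times> rvec, 'x \<times> rvec) fitting"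
  reg_mf :: "('s, rvec, rvec) fitting"
  reg_m :: "('s, rvec, rvec) fitting"

datatype step = Step_g | Step_mtilde | Step_v | Step_mf | Step_m

definition measurable_methods ::
  "nat \<Rightarrow> (step \<Rightarrow> 's measure) \<Rightarrow> 'x measure \<Rightarrow> nat \<Rightarrow> ('s, 'x) pcm_methods \<Rightarrow> bool" where
  "measurable_methods n Q MX d A \<longleftrightarrow>
    measurable_fitting n (Q Step_g) (MX \<Otimes>\<^sub>M vec_space d) (MX \<Otimes>\<^sub>M vec_space d) (reg_g A) \<and>
    measurable_fitting n (Q Step_g) (MX \<Otimes>\<^sub>M vec_space d) (vec_space d) (reg_g_Z A) \<and>
    measurable_fitting n (Q Step_mtilde) (vec_space d) (vec_space d) (reg_mtilde A) \<and>
    measurable_fitting n (Q Step_v) (MX \<Otimes>\<^sub>M vec_space d) (MX \<Otimes>\<^sub>M vec_space d) (reg_v A) \<and>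
    measurable_fitting n (Q Step_mf) (vec_space d) (vec_space d) (reg_mf A) \<and>
    measurable_fitting n (Q Step_m) (vec_space d) (vec_space d) (reg_m A)"

text \<open>
  An outcome consists of the \<open>2n\<close> observations and one seed per regression; all of these are
  independent.
\<close>

type_synonym ('s, 'x) outcome = "(nat \<Rightarrow> 'x obs) \<times> (step \<Rightarrow> 's)"

definition outcome_measure ::
  "nat \<Rightarrow> (step \<Rightarrow> 's measure) \<Rightarrow> 'x obs measure \<Rightarrow> ('s, 'x) outcome measure" where
  "outcome_measure n Q P = PiM {1..2*n} (\<lambda>_. P) \<Otimes>\<^sub>M PiM UNIV Q"

context
  fixes A :: "('s, 'x) pcm_methods" and n :: nat and w :: "('s, 'x) outcome"
begin

definition ob :: "nat \<Rightarrow> 'x obs" where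
  "ob i = fst w i"

definition seed :: "step \<Rightarrow> 's" where
  "seed k = snd w k"

text \<open>Response-predictor pairs from \<open>{1..n}\<close>, and from \<open>{n+1..2n}\<close> reindexed by \<open>{1..n}\<close>.\<close>

definition pairs1 :: "('x obs \<Rightarrow> real) \<Rightarrow> ('x obs \<Rightarrow> 'p) \<Rightarrow> 'p pairs" where
  "pairs1 R p = (\<lambda>i\<in>{1..n}. (R (ob i), p (ob i)))"

definition pairs2 :: "('x obs \<Rightarrow> real) \<Rightarrow> ('x obs \<Rightarrow> 'p) \<Rightarrow> 'p pairs" where
  "pairs2 R p = (\<lambda>i\<in>{1..n}. (R (ob (n + i)), p (ob (n + i))))"

definition ghat :: "'x \<times> rvec \<Rightarrow> real" where
  "ghat = reg_g A (seed Step_g) (pairs2 obsY obsXZ)"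

definition gtilde :: "'x \<times> rvec \<Rightarrow> real" where
  "gtilde q = ghat q - reg_g_Z A (seed Step_g) (pairs2 obsY obsXZ) (snd q)"

definition mtilde :: "rvec \<Rightarrow> real" where
  "mtilde = reg_mtilde A (seed Step_mtilde) (pairs2 (\<lambda>v. gtilde (obsXZ v)) obsZ)"

definition htilde :: "'x \<times> rvec \<Rightarrow> real" where
  "htilde q = gtilde q - mtilde (snd q)"

definition rhohat :: real where
  "rhohat = (\<Sum>i\<in>{n+1..2*n}.
      (obsY (ob i) - ghat (obsXZ (ob i)) + gtilde (obsXZ (ob i)) - mtilde (obsZ (ob i)))
        * htilde (obsXZ (ob i))) / real n"

definition hhat :: "'x \<times> rvec \<Rightarrow> real" where
  "hhat q = sgn rhohat * htilde q"

definition sqres :: "'x obs \<Rightarrow> real" where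
  "sqres v = (obsY v - ghat (obsXZ v))\<^sup>2"

definition vtilde :: "'x \<times> rvec \<Rightarrow> real" where
  "vtilde = reg_v A (seed Step_v) (pairs2 sqres obsXZ)"

text \<open>
  In \<open>ennreal\<close>, \<open>0 / 0 = 0\<close> and \<open>r / 0 = \<infinity>\<close> for \<open>r > 0\<close>, so \<open>a(0)\<close> may be infinite. If \<open>a(0) > 1\<close>,
  then \<open>a(c) = 1\<close> has exactly one solution \<open>c \<ge> 0\<close>.
\<close>

definition a_fun :: "real \<Rightarrow> ennreal" where
  "a_fun c = (\<Sum>i\<in>{n+1..2*n}.
      ennreal (sqres (ob i)) / ennreal (max (vtilde (obsXZ (ob i))) 0 + c)) / of_nat n"

definition chat :: real where
  "chat = (if a_fun 0 \<le> 1 then 0 else (THE c. 0 \<le> c \<and> a_fun c = 1))"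

definition vhat :: "'x \<times> rvec \<Rightarrow> real" where
  "vhat q = max (vtilde q) 0 + chat"

definition fhat :: "'x \<times> rvec \<Rightarrow> real" where
  "fhat q = hhat q / vhat q"

definition pairs_mf :: "rvec pairs" where
  "pairs_mf = pairs1 (\<lambda>v. fhat (obsXZ v)) obsZ"

definition pairs_m :: "rvec pairs" where
  "pairs_m = pairs1 obsY obsZ"

definition mfhat :: "rvec \<Rightarrow> real" where
  "mfhat = reg_mf A (seed Step_mf) pairs_mf"

definition mhat :: "rvec \<Rightarrow> real" where
  "mhat = reg_m A (seed Step_m) pairs_m"

definition resid_f :: "nat \<Rightarrow> real" where
  "resid_f i = fhat (obsXZ (ob i)) - mfhat (obsZ (ob i))"

definition L_term :: "nat \<Rightarrow> real" where
  "L_term i = (obsY (ob i) - mhat (obsZ (ob i))) * resid_f i"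

definition pcm_stat :: real where
  "pcm_stat =
    ((\<Sum>i\<in>{1..n}. L_term i) / sqrt (real n)) /
    sqrt ((\<Sum>i\<in>{1..n}. (L_term i)\<^sup>2) / real n - ((\<Sum>i\<in>{1..n}. L_term i) / real n)\<^sup>2)"

definition upsilon :: "nat \<Rightarrow> real" where
  "upsilon i = resid_f i / sqrt (\<Sum>i'\<in>{1..n}. (resid_f i')\<^sup>2)"

end


section \<open>Uniform convergence in probability\<close>

text \<open>
  The measure \<open>\<mu> n P\<close> is the one on which the variable \<open>V n P\<close> lives when the data come from \<open>P\<close>.
  The supremum is taken in \<open>ennreal\<close>, where it is well behaved for an empty family as well.
\<close>

definition uniform_oP ::
  "(nat \<Rightarrow> 'm set) \<Rightarrow> (nat \<Rightarrow> 'm \<Rightarrow> 'w measure) \<Rightarrow> (nat \<Rightarrow> 'm \<Rightarrow> 'w \<Rightarrow> real) \<Rightarrow> bool" where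
  "uniform_oP \<P> \<mu> V \<longleftrightarrow>
    (\<forall>\<epsilon>>0. (\<lambda>n. SUP P\<in>\<P> n. emeasure (\<mu> n P) {w \<in> space (\<mu> n P). \<bar>V n P w\<bar> > \<epsilon>}) \<longlonglongrightarrow> 0)"

end

theory Submission
  imports Defs
begin

text \<open>
  Divided by \<open>(\<Sum>\<^sub>i u\<^sub>i\<^sup>2)\<^sup>1\<^sup>/\<^sup>2\<close>, the numerator of the statistic is \<open>\<Sum> \<upsilon>\<^sub>i \<epsilon>\<^sub>i\<close> minus a bias term, which (d) and
  Hoelder's inequality make negligible; (c) does the same for the error in the empirical variance. The weights
  \<open>\<upsilon>\<^sub>i\<close> do not involve the responses of the first sample, so \<open>\<Sum> \<upsilon>\<^sub>i \<epsilon>\<^sub>i\<close> is a sum of conditionally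
  independent centred variables. With \<open>v\<^sub>i\<close> the conditional variance of \<open>\<epsilon>\<^sub>i\<close> and \<open>w\<^sub>i = \<upsilon>\<^sub>i / (\<Sum> v\<^sub>j \<upsilon>\<^sub>j\<^sup>2)\<^sup>1\<^sup>/\<^sup>2\<close>,
  both the central limit theorem for \<open>\<Sum> w\<^sub>i \<epsilon>\<^sub>i\<close> and the law of large numbers for \<open>\<Sum> w\<^sub>i\<^sup>2 \<epsilon>\<^sub>i\<^sup>2\<close> follow
  from a telescoping estimate of an expected product: each factor has conditional mean 1 up to a Taylor remainder,
  given everything but the response that it contains. Only expectations of the form \<open>E (H \<epsilon>\<^sub>i)\<close>, \<open>E (H \<epsilon>\<^sub>i\<^sup>2)\<close>
  with \<open>H\<close> not involving \<open>Y\<^sub>i\<close> occur, so no regular conditional distributions are needed. Uniformity over the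
  family follows by applying the resulting limit theorem along arbitrary sequences of distributions.
\<close>

section \<open>Conditionally centred arrays\<close>

text \<open>The \<sigma>-algebras \<open>F k\<close> are not increasing in \<open>k\<close>, so no
  filtration is used: each telescoping step has its own conditioning. This is possible because the
  weights are measurable with respect to every \<open>F k\<close> at once, the regression for
  \<open>mfhat\<close> seeing only \<open>fhat\<close> and \<open>Z\<close> on the first sample. The
  fitted \<open>mhat\<close>, by contrast, depends on all first-sample responses, so its error
  enters only through pointwise inequalities on events of high probability. Normalising by the
  conditional variance rather than by the sum of squares makes the total of v_i w_i^2 equal to 1
  unless the denominator vanishes. This keeps the product of the Gaussian compensators exp(t^2 v_i
  w_i^2 / 2) bounded, and costs nothing as the studentised statistic is scale invariant. Smallness
  of the weights is known only in probability; they are set to 0 off an event that itself lies in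
  every \<open>F k\<close>. The exponent \<delta> is lowered to at most 1, since a third-order
  Taylor remainder is dominated by |x|^(2+\<delta>) near 0 only then.\<close>

lemma cmod_iexp_second_order:
  fixes x \<delta> :: real
  assumes "0 \<le> \<delta>" "\<delta> \<le> 1"
  shows "cmod (iexp x - (1 + \<i> * x - x\<^sup>2 / 2)) \<le> \<bar>x\<bar> powr (2 + \<delta>)"
proof -
  have eq: "(\<Sum>k\<le>2. (\<i> * complex_of_real x) ^ k / fact k) = 1 + \<i> * x - x\<^sup>2 / 2"
    by (simp add: numeral_2_eq_2 power2_eq_square field_simps)
  show ?thesis
  \<comment> \<open>For |x| \<le> 1 the third-order remainder suffices because \<delta> \<le> 1; for
    |x| > 1 the cruder bound x^2 suffices because \<delta> \<ge> 0.\<close>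
  proof (cases "\<bar>x\<bar> \<le> 1")
    case True
    have "cmod (iexp x - (1 + \<i> * x - x\<^sup>2 / 2)) \<le> \<bar>x\<bar> ^ Suc 2 / fact (Suc 2)"
      using iexp_approx1[of x 2] unfolding eq .
    also have "\<dots> \<le> \<bar>x\<bar> ^ 3 / 1"
      by (intro frac_le) (auto simp: eval_nat_numeral)
    also have "\<dots> = \<bar>x\<bar> powr 3" by simp
    also have "\<dots> \<le> \<bar>x\<bar> powr (2 + \<delta>)"
      using True assms by (intro powr_mono') auto
    finally show ?thesis .
  next
    case False
    have "cmod (iexp x - (1 + \<i> * x - x\<^sup>2 / 2)) \<le> \<bar>x\<bar> ^ 2"
      using iexp_approx2[of x 2] by (simp add: eq)
    also have "\<dots> = \<bar>x\<bar> powr 2" using False by (simp add: powr_numeral)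
    also have "\<dots> \<le> \<bar>x\<bar> powr (2 + \<delta>)"
      using False assms by (intro powr_mono) auto
    finally show ?thesis .
  qed
qed

text \<open>One order lower than the previous bound: in the law of large numbers the exponent
  contains a squared noise variable, which has moments of order 1 + \<delta>/2 only.\<close>

lemma cmod_iexp_first_order:
  fixes x \<delta> :: real
  assumes "0 \<le> \<delta>" "\<delta> \<le> 1"
  shows "cmod (iexp x - (1 + \<i> * x)) \<le> 2 * \<bar>x\<bar> powr (1 + \<delta>)"
proof (cases "\<bar>x\<bar> \<le> 1")
  case True
  have "cmod (iexp x - (1 + \<i> * x)) \<le> \<bar>x\<bar> ^ 2 / 2"
    using iexp_approx1[of x 1] by (simp add: eval_nat_numeral)
  also have "\<dots> \<le> \<bar>x\<bar> powr 2" by (simp add: powr_numeral)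
  also have "\<dots> \<le> \<bar>x\<bar> powr (1 + \<delta>)"
    using True assms by (intro powr_mono') auto
  finally show ?thesis using powr_ge_zero[of "\<bar>x\<bar>" "1 + \<delta>"] by linarith
next
  case False
  have "cmod (iexp x - (1 + \<i> * x)) \<le> 2 * \<bar>x\<bar>"
    using iexp_approx2[of x 1] by simp
  also have "\<bar>x\<bar> = \<bar>x\<bar> powr 1" using False by simp
  also have "\<dots> \<le> \<bar>x\<bar> powr (1 + \<delta>)"
    using False assms by (intro powr_mono) auto
  finally show ?thesis by simp
qed

lemma abs_exp_minus_taylor:
  fixes y :: real
  assumes "0 \<le> y"
  shows "\<bar>exp (- y) - (1 - y)\<bar> \<le> y\<^sup>2"
proof (cases "y \<le> 1")
  case True
  have 1: "1 - y \<le> exp (- y)" using exp_ge_add_one_self[of "- y"] by simp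
  have "(1 + y) * exp (- y) \<le> exp y * exp (- y)" 
    by (intro mult_right_mono exp_ge_add_one_self) auto
  then have "(1 + y) * exp (- y) \<le> 1" by (simp flip: exp_add)
  then have "exp (-y) \<le> 1 / (1 + y)" using assms by (simp add: field_simps)
  also have "\<dots> \<le> 1 - y + y\<^sup>2"
    using assms by (simp add: divide_le_eq) (simp add: power2_eq_square algebra_simps)
  finally show ?thesis using 1 by (simp add: abs_if)
next
  case False
  have 1: "1 - y \<le> exp (- y)" using exp_ge_add_one_self[of "- y"] by simp
  have "exp (-y) \<le> 1" using assms by simp
  moreover have "y \<le> y\<^sup>2" using False by (simp add: power2_eq_square)
  ultimately show ?thesis using 1 by linarith
qed

lemma powr_two_plus:
  fixes x \<delta> :: real
  shows "\<bar>x\<bar> powr (2 + \<delta>) = x\<^sup>2 * \<bar>x\<bar> powr \<delta>"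
proof (cases "x = 0")
  case False
  then have "\<bar>x\<bar> powr (2 + \<delta>) = \<bar>x\<bar> powr 2 * \<bar>x\<bar> powr \<delta>" by (simp add: powr_add)
  also have "\<bar>x\<bar> powr 2 = x\<^sup>2" using False by (simp add: powr_numeral)
  finally show ?thesis .
qed simp

lemma square_le_one_plus_powr:
  fixes x \<delta> :: real
  assumes "0 \<le> \<delta>"
  shows "x\<^sup>2 \<le> 1 + \<bar>x\<bar> powr (2 + \<delta>)"
proof (cases "\<bar>x\<bar> \<le> 1")
  case True
  then have "x\<^sup>2 \<le> 1" by (simp add: abs_square_le_1)
  then show ?thesis by (simp add: add_increasing2)
next
  case False
  then have "1 \<le> \<bar>x\<bar> powr \<delta>" using assms by (intro ge_one_powr_ge_zero) auto
  then have "x\<^sup>2 * 1 \<le> x\<^sup>2 * \<bar>x\<bar> powr \<delta>" by (intro mult_left_mono) auto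
  then show ?thesis by (simp add: powr_two_plus)
qed

lemma integrable_bounded_mult:
  fixes G :: "'a \<Rightarrow> complex" and f :: "'a \<Rightarrow> real"
  assumes "integrable M f" "G \<in> borel_measurable M" "\<And>x. x \<in> space M \<Longrightarrow> cmod (G x) \<le> B"
  shows "integrable M (\<lambda>x. G x * of_real (f x))"
proof (rule Bochner_Integration.integrable_bound)
  show "integrable M (\<lambda>x. B * f x)" using assms(1) by simp
  show "(\<lambda>x. G x * of_real (f x)) \<in> borel_measurable M"
    using assms(1,2) by (auto dest: borel_measurable_integrable)
  show "AE x in M. norm (G x * of_real (f x)) \<le> norm (B * f x)"
  proof (rule AE_I2)
    fix x assume "x \<in> space M"
    then have "cmod (G x) \<le> \<bar>B\<bar>" using assms(3)[of x] by linarith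
    then show "norm (G x * of_real (f x)) \<le> norm (B * f x)"
      by (simp add: norm_mult abs_mult mult_right_mono)
  qed
qed

lemma norm_triangle_sub_sub:
  fixes a b c :: "'a::real_normed_vector"
  shows "norm (a - c) \<le> norm (a - b) + norm (b - c)"
  using norm_triangle_ineq[of "a - b" "b - c"] by simp

text \<open>The product minus 1 is the sum over k of (p_1 ... p_(k-1)) (p_k - 1). The common bound
  \<open>B\<close> is asked of the partial products and not of single factors, so it does not
  compound with \<open>n\<close>; it serves integrability.\<close>

lemma (in prob_space) telescoping_product_bound:
  fixes p :: "nat \<Rightarrow> 'a \<Rightarrow> complex"
  assumes meas: "\<And>k. k \<in> {1..n} \<Longrightarrow> p k \<in> borel_measurable M"
    and bound: "\<And>k x. k \<le> n \<Longrightarrow> x \<in> space M \<Longrightarrow> cmod (\<Prod>j\<in>{1..k}. p j x) \<le> B"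
    and step: "\<And>k. k \<in> {1..n} \<Longrightarrow>
      cmod (expectation (\<lambda>x. (\<Prod>j\<in>{1..<k}. p j x) * (p k x - 1))) \<le> \<beta> k"
  shows "cmod (expectation (\<lambda>x. \<Prod>j\<in>{1..n}. p j x) - 1) \<le> (\<Sum>k\<in>{1..n}. \<beta> k)"
proof -
  have int: "integrable M (\<lambda>x. \<Prod>j\<in>{1..k}. p j x)" if "k \<le> n" for k
  proof (rule integrable_const_bound)
    show "AE x in M. cmod (\<Prod>j\<in>{1..k}. p j x) \<le> B" using bound that by auto
    show "(\<lambda>x. \<Prod>j\<in>{1..k}. p j x) \<in> borel_measurable M"
      using that by (intro borel_measurable_prod meas) auto
  qed
  have "cmod (expectation (\<lambda>x. \<Prod>j\<in>{1..k}. p j x) - 1) \<le> (\<Sum>j\<in>{1..k}. \<beta> j)" if "k \<le> n" for k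
    using that
  proof (induction k)
    case 0
    then show ?case by (simp add: prob_space)
  next
    case (Suc k)
    have "expectation (\<lambda>x. (\<Prod>j\<in>{1..<Suc k}. p j x) * (p (Suc k) x - 1)) =
        expectation (\<lambda>x. (\<Prod>j\<in>{1..Suc k}. p j x) - (\<Prod>j\<in>{1..k}. p j x))"
      by (simp add: algebra_simps atLeastLessThanSuc_atLeastAtMost)
    also have "\<dots> = expectation (\<lambda>x. \<Prod>j\<in>{1..Suc k}. p j x) - expectation (\<lambda>x. \<Prod>j\<in>{1..k}. p j x)"
      using Suc.prems by (intro Bochner_Integration.integral_diff int) auto
    finally have "cmod (expectation (\<lambda>x. \<Prod>j\<in>{1..Suc k}. p j x) - expectation (\<lambda>x. \<Prod>j\<in>{1..k}. p j x)) \<le> \<beta> (Suc k)"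
      using step[of "Suc k"] Suc.prems by simp
    moreover have "cmod (expectation (\<lambda>x. \<Prod>j\<in>{1..Suc k}. p j x) - 1) \<le>
       cmod (expectation (\<lambda>x. \<Prod>j\<in>{1..Suc k}. p j x) - expectation (\<lambda>x. \<Prod>j\<in>{1..k}. p j x)) +
       cmod (expectation (\<lambda>x. \<Prod>j\<in>{1..k}. p j x) - 1)"
      by (rule norm_triangle_sub_sub)
    ultimately show ?case using Suc by (simp add: algebra_simps)
  qed
  then show ?thesis by simp
qed

text \<open>\<open>F k\<close> carries all information except the \<open>k\<close>-th response; \<open>v k\<close> is the conditional variance
  of the \<open>k\<close>-th noise variable \<open>e k\<close>.\<close>

locale noise_array = prob_space M for M :: "'a measure" +
  fixes n :: nat and F :: "nat \<Rightarrow> 'a measure" and e v :: "nat \<Rightarrow> 'a \<Rightarrow> real" and \<delta> c C :: real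
  assumes sub: "\<And>k. k \<in> {1..n} \<Longrightarrow> subalgebra M (F k)"
    and e_meas: "\<And>k. k \<in> {1..n} \<Longrightarrow> e k \<in> borel_measurable M"
    and e_other: "\<And>j k. j \<in> {1..n} \<Longrightarrow> k \<in> {1..n} \<Longrightarrow> j \<noteq> k \<Longrightarrow> e j \<in> borel_measurable (F k)"
    and v_meas: "\<And>j k. j \<in> {1..n} \<Longrightarrow> k \<in> {1..n} \<Longrightarrow> v j \<in> borel_measurable (F k)"
    and v_lower: "\<And>j x. c \<le> v j x" and v_upper: "\<And>j x. v j x \<le> C"
    and params: "0 < \<delta>" "\<delta> \<le> 1" "0 < c"
    and e_powr_int: "\<And>k. k \<in> {1..n} \<Longrightarrow> integrable M (\<lambda>x. \<bar>e k x\<bar> powr (2 + \<delta>))"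
    and e_mean: "\<And>k H b. k \<in> {1..n} \<Longrightarrow> H \<in> borel_measurable (F k) \<Longrightarrow>
      (\<And>x. x \<in> space M \<Longrightarrow> \<bar>H x\<bar> \<le> b) \<Longrightarrow> expectation (\<lambda>x. H x * e k x) = 0"
    and e_var: "\<And>k H b. k \<in> {1..n} \<Longrightarrow> H \<in> borel_measurable (F k) \<Longrightarrow>
      (\<And>x. x \<in> space M \<Longrightarrow> \<bar>H x\<bar> \<le> b) \<Longrightarrow> expectation (\<lambda>x. H x * (e k x)\<^sup>2) = expectation (\<lambda>x. H x * v k x)"
    and e_moment: "\<And>k H b. k \<in> {1..n} \<Longrightarrow> H \<in> borel_measurable (F k) \<Longrightarrow>
      (\<And>x. x \<in> space M \<Longrightarrow> 0 \<le> H x \<and> H x \<le> b) \<Longrightarrow>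
      expectation (\<lambda>x. H x * \<bar>e k x\<bar> powr (2 + \<delta>)) \<le> C * expectation H"
begin

lemma C_pos: "0 < C"
  using v_lower[of undefined undefined] v_upper[of undefined undefined] params by linarith

lemma v_pos: "0 < v j x"
  using v_lower[of j x] params by linarith

lemma F_meas: "f \<in> borel_measurable (F k) \<Longrightarrow> k \<in> {1..n} \<Longrightarrow> f \<in> borel_measurable M"
  using measurable_from_subalg sub by blast

lemma e_sq_int: "k \<in> {1..n} \<Longrightarrow> integrable M (\<lambda>x. (e k x)\<^sup>2)"
proof (rule Bochner_Integration.integrable_bound)
  assume k: "k \<in> {1..n}"
  show "integrable M (\<lambda>x. 1 + \<bar>e k x\<bar> powr (2 + \<delta>))" using e_powr_int[OF k] by simp
  show "(\<lambda>x. (e k x)\<^sup>2) \<in> borel_measurable M" using e_meas[OF k] by measurable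
  show "AE x in M. norm ((e k x)\<^sup>2) \<le> norm (1 + \<bar>e k x\<bar> powr (2 + \<delta>))"
    using square_le_one_plus_powr params by auto
qed

lemma e_int: "k \<in> {1..n} \<Longrightarrow> integrable M (e k)"
  using square_integrable_imp_integrable e_meas e_sq_int by blast

lemma v_int: "k \<in> {1..n} \<Longrightarrow> integrable M (v k)"
  by (rule integrable_const_bound[where B=C])
    (use v_upper v_pos[THEN less_imp_le] F_meas[OF v_meas] in auto)

text \<open>The telescoped products are complex while the test functions of the array are real; the
  identity passes through real and imaginary parts.\<close>

lemma complex_e_mean:
  fixes G :: "'a \<Rightarrow> complex"
  assumes k: "k \<in> {1..n}" and G: "G \<in> borel_measurable (F k)" and b: "\<And>x. x \<in> space M \<Longrightarrow> cmod (G x) \<le> b"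
  shows "expectation (\<lambda>x. G x * of_real (e k x)) = 0"
proof -
  have int: "integrable M (\<lambda>x. G x * of_real (e k x))"
    using integrable_bounded_mult[OF e_int[OF k] F_meas[OF G k] b] .
  have "expectation (\<lambda>x. Re (G x) * e k x) = 0"
    by (rule e_mean[OF k, of _ b]) (use G b abs_Re_le_cmod order_trans in \<open>auto, blast\<close>)
  moreover have "expectation (\<lambda>x. Im (G x) * e k x) = 0"
    by (rule e_mean[OF k, of _ b]) (use G b abs_Im_le_cmod order_trans in \<open>auto, blast\<close>)
  ultimately show ?thesis
    using int by (intro complex_eqI) (simp_all flip: integral_Re integral_Im)
qed

lemma complex_e_var:
  fixes G :: "'a \<Rightarrow> complex"
  assumes k: "k \<in> {1..n}" and G: "G \<in> borel_measurable (F k)" and b: "\<And>x. x \<in> space M \<Longrightarrow> cmod (G x) \<le> b"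
  shows "expectation (\<lambda>x. G x * of_real ((e k x)\<^sup>2 - v k x)) = 0"
proof -
  have i: "integrable M (\<lambda>x. (e k x)\<^sup>2 - v k x)" using e_sq_int v_int k by auto
  have int: "integrable M (\<lambda>x. G x * of_real ((e k x)\<^sup>2 - v k x))"
    using integrable_bounded_mult[OF i F_meas[OF G k] b] .
  have real: "expectation (\<lambda>x. H x * ((e k x)\<^sup>2 - v k x)) = 0"
    if H: "H \<in> borel_measurable (F k)" "\<And>x. x \<in> space M \<Longrightarrow> \<bar>H x\<bar> \<le> b" for H
  proof -
    have c: "(\<lambda>x. complex_of_real (H x)) \<in> borel_measurable M"
      using F_meas[OF H(1) k] by measurable
    have "integrable M (\<lambda>x. H x * (e k x)\<^sup>2)"
      using integrable_bounded_mult[OF e_sq_int[OF k] c, of b] H(2)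
      by (simp only: of_real_mult[symmetric] complex_of_real_integrable_eq norm_of_real)
    moreover have "integrable M (\<lambda>x. H x * v k x)"
      using integrable_bounded_mult[OF v_int[OF k] c, of b] H(2)
      by (simp only: of_real_mult[symmetric] complex_of_real_integrable_eq norm_of_real)
    ultimately show ?thesis
      using e_var[OF k H] by (simp add: right_diff_distrib)
  qed
  have "expectation (\<lambda>x. Re (G x) * ((e k x)\<^sup>2 - v k x)) = 0"
    by (rule real) (use G b abs_Re_le_cmod order_trans in \<open>auto, blast\<close>)
  moreover have "expectation (\<lambda>x. Im (G x) * ((e k x)\<^sup>2 - v k x)) = 0"
    by (rule real) (use G b abs_Im_le_cmod order_trans in \<open>auto, blast\<close>)
  ultimately show ?thesis
    using int by (intro complex_eqI) (simp_all flip: integral_Re integral_Im)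
qed

text \<open>Both limit arguments leave a remainder of this shape: a power 2+\<delta> from the
  complex exponential, and a squared conditional variance from the compensator. Each is at most
  \<eta>^\<delta> times a multiple of v w^2: |w|^(2+\<delta>) \<le> \<eta>^\<delta> w^2 with w^2
  \<le> v w^2 / c, and (v w^2)^2 \<le> C \<eta>^\<delta> v w^2 since \<eta>^2 \<le>
  \<eta>^\<delta>.\<close>

lemma expectation_weighted_remainder:
  fixes G R :: "'a \<Rightarrow> complex" and w :: "'a \<Rightarrow> real"
  assumes k: "k \<in> {1..n}" and G: "G \<in> borel_measurable M" "\<And>x. x \<in> space M \<Longrightarrow> cmod (G x) \<le> B"
    and w: "w \<in> borel_measurable (F k)" "\<And>x. x \<in> space M \<Longrightarrow> \<bar>w x\<bar> \<le> \<eta>" and \<eta>: "0 < \<eta>" "\<eta> \<le> 1"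
    and R: "R \<in> borel_measurable M"
      "\<And>x. x \<in> space M \<Longrightarrow> cmod (R x) \<le> a * \<bar>w x * e k x\<bar> powr (2 + \<delta>) + b * (v k x * (w x)\<^sup>2)\<^sup>2"
    and ab: "0 \<le> a" "0 \<le> b"
  shows "integrable M (\<lambda>x. G x * R x)"
    and "cmod (expectation (\<lambda>x. G x * R x)) \<le>
      B * (a * C / c + b * C) * \<eta> powr \<delta> * expectation (\<lambda>x. v k x * (w x)\<^sup>2)"
proof -
  define \<tau> where "\<tau> x = v k x * (w x)\<^sup>2" for x
  define W where "W x = \<bar>w x\<bar> powr (2 + \<delta>)" for x
  have wM: "w \<in> borel_measurable M" and vM: "v k \<in> borel_measurable M"
    using F_meas w k v_meas by blast+
  note [measurable] = wM vM e_meas[OF k] G(1) R(1)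
  have B: "0 \<le> B" using G(2) norm_ge_zero order_trans not_empty by blast
  have \<tau>0: "0 \<le> \<tau> x" for x using v_pos[of k x] by (simp add: \<tau>_def)
  have w2: "(w x)\<^sup>2 \<le> \<eta> powr \<delta>" "\<bar>w x\<bar> powr \<delta> \<le> \<eta> powr \<delta>" if "x \<in> space M" for x
  proof -
    show "\<bar>w x\<bar> powr \<delta> \<le> \<eta> powr \<delta>" using w(2)[OF that] params by (intro powr_mono2) auto
    have "(w x)\<^sup>2 \<le> \<eta>\<^sup>2" using w(2)[OF that] by (simp add: abs_le_square_iff[symmetric])
    also have "\<dots> = \<eta> powr 2" using \<eta> by (simp add: powr_numeral)
    also have "\<dots> \<le> \<eta> powr \<delta>" using \<eta> params by (intro powr_mono') auto
    finally show "(w x)\<^sup>2 \<le> \<eta> powr \<delta>" .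
  qed
  have \<tau>sq: "(\<tau> x)\<^sup>2 \<le> C * \<eta> powr \<delta> * \<tau> x" if "x \<in> space M" for x
  proof -
    have "\<tau> x \<le> C * \<eta> powr \<delta>" unfolding \<tau>_def
      using v_upper[of k x] w2[OF that] C_pos by (intro mult_mono) auto
    then show ?thesis using \<tau>0[of x] by (simp add: power2_eq_square mult_right_mono)
  qed
  have W: "W x \<le> \<eta> powr \<delta> / c * \<tau> x" if "x \<in> space M" for x
  proof -
    have "W x = (w x)\<^sup>2 * \<bar>w x\<bar> powr \<delta>" by (simp add: W_def powr_two_plus)
    also have "\<dots> \<le> (w x)\<^sup>2 * \<eta> powr \<delta>" using w2[OF that] by (intro mult_left_mono) auto
    also have "(w x)\<^sup>2 \<le> \<tau> x / c" 
      using mult_right_mono[OF v_lower[of k x], of "(w x)\<^sup>2"] params by (simp add: \<tau>_def field_simps)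
    finally show ?thesis by (simp add: mult_right_mono mult_ac)
  qed
  have W1: "0 \<le> W x \<and> W x \<le> 1" if "x \<in> space M" for x
    using w(2)[OF that] \<eta> params by (auto simp: W_def intro!: powr_le1)
  have \<tau>b: "\<tau> x \<le> C" if "x \<in> space M" for x
  proof -
    have "\<tau> x \<le> C * 1" unfolding \<tau>_def
      using v_upper[of k x] w(2)[OF that] \<eta> C_pos by (intro mult_mono) (auto simp: abs_square_le_1)
    then show ?thesis by simp
  qed
  have i\<tau>: "integrable M \<tau>"
    by (rule integrable_const_bound[where B=C]) (use \<tau>b \<tau>0 in \<open>auto simp: \<tau>_def[abs_def]\<close>)
  have i\<tau>2: "integrable M (\<lambda>x. (\<tau> x)\<^sup>2)"
    by (rule integrable_const_bound[where B="C\<^sup>2"])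
      (use \<tau>b \<tau>0 in \<open>auto simp: \<tau>_def[abs_def] intro!: power_mono\<close>)
  have iWe: "integrable M (\<lambda>x. W x * \<bar>e k x\<bar> powr (2 + \<delta>))"
  proof (rule Bochner_Integration.integrable_bound[OF e_powr_int[OF k]])
    show "(\<lambda>x. W x * \<bar>e k x\<bar> powr (2 + \<delta>)) \<in> borel_measurable M" unfolding W_def by measurable
    show "AE x in M. norm (W x * \<bar>e k x\<bar> powr (2 + \<delta>)) \<le> norm (\<bar>e k x\<bar> powr (2 + \<delta>))"
      using W1 by (intro AE_I2) (auto simp: abs_mult intro!: mult_left_le_one_le)
  qed
  have iW: "integrable M W"
    by (rule integrable_const_bound[where B=1]) (use W1 in \<open>auto simp: W_def[abs_def]\<close>)
  define D where "D x = B * (a * (W x * \<bar>e k x\<bar> powr (2 + \<delta>)) + b * (\<tau> x)\<^sup>2)" for x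
  have iD: "integrable M D" unfolding D_def using iWe i\<tau>2 by auto
  have GR: "cmod (G x * R x) \<le> D x" if "x \<in> space M" for x
    unfolding D_def norm_mult
    using G(2)[OF that] R(2)[OF that] B
    by (intro mult_mono) (auto simp: W_def \<tau>_def abs_mult powr_mult)
  show int: "integrable M (\<lambda>x. G x * R x)"
    by (rule Bochner_Integration.integrable_bound[OF iD]) (use GR in \<open>auto intro: order_trans[OF _ abs_ge_self]\<close>)
  have "cmod (expectation (\<lambda>x. G x * R x)) \<le> expectation (\<lambda>x. cmod (G x * R x))"
    by (rule integral_norm_bound)
  also have "\<dots> \<le> expectation D"
    using int iD GR by (intro integral_mono) auto
  also have "\<dots> = B * (a * expectation (\<lambda>x. W x * \<bar>e k x\<bar> powr (2 + \<delta>)) + b * expectation (\<lambda>x. (\<tau> x)\<^sup>2))"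
    unfolding D_def using iWe i\<tau>2 by simp
  also have "\<dots> \<le> B * (a * (C * (\<eta> powr \<delta> / c * expectation \<tau>)) + b * (C * \<eta> powr \<delta> * expectation \<tau>))"
  proof (intro mult_left_mono add_mono ab B)
    \<comment> \<open>\<open>W\<close> lies between 0 and 1 and does not involve the k-th response,
      so it is an admissible test function for \<open>e_moment\<close>; this removes the noise from
      the expectation.\<close>
    have "W \<in> borel_measurable (F k)" unfolding W_def using w(1) by measurable
    then have "expectation (\<lambda>x. W x * \<bar>e k x\<bar> powr (2 + \<delta>)) \<le> C * expectation W"
      using W1 by (intro e_moment[OF k, of W 1]) auto
    also have "expectation W \<le> expectation (\<lambda>x. \<eta> powr \<delta> / c * \<tau> x)"
      using iW i\<tau> W by (intro integral_mono) auto
    finally show "expectation (\<lambda>x. W x * \<bar>e k x\<bar> powr (2 + \<delta>)) \<le> C * (\<eta> powr \<delta> / c * expectation \<tau>)"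
      using C_pos by (simp add: mult_left_mono)
    have "expectation (\<lambda>x. (\<tau> x)\<^sup>2) \<le> expectation (\<lambda>x. C * \<eta> powr \<delta> * \<tau> x)"
      using i\<tau>2 i\<tau> \<tau>sq by (intro integral_mono) auto
    then show "expectation (\<lambda>x. (\<tau> x)\<^sup>2) \<le> C * \<eta> powr \<delta> * expectation \<tau>" by simp
  qed
  also have "\<dots> = B * (a * C / c + b * C) * \<eta> powr \<delta> * expectation \<tau>"
    by (simp add: field_simps)
  finally show "cmod (expectation (\<lambda>x. G x * R x)) \<le>
      B * (a * C / c + b * C) * \<eta> powr \<delta> * expectation (\<lambda>x. v k x * (w x)\<^sup>2)"
    by (simp add: \<tau>_def[abs_def])
qed

text \<open>This makes the errors of the \<open>n\<close> telescoping steps add up to order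
  \<eta>^\<delta> instead of n \<eta>^\<delta>.\<close>

lemma sum_expectation_weights:
  fixes w :: "nat \<Rightarrow> 'a \<Rightarrow> real"
  assumes w: "\<And>j k. j \<in> {1..n} \<Longrightarrow> k \<in> {1..n} \<Longrightarrow> w j \<in> borel_measurable (F k)"
    and total: "\<And>x. x \<in> space M \<Longrightarrow> (\<Sum>j\<in>{1..n}. v j x * (w j x)\<^sup>2) \<le> 1"
  shows "(\<Sum>k\<in>{1..n}. expectation (\<lambda>x. v k x * (w k x)\<^sup>2)) \<le> 1"
proof -
  have int: "integrable M (\<lambda>x. v k x * (w k x)\<^sup>2)" if k: "k \<in> {1..n}" for k
  proof (rule integrable_const_bound[where B=1])
    note [measurable] = F_meas[OF w[OF k k] k] F_meas[OF v_meas[OF k k] k]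
    show "(\<lambda>x. v k x * (w k x)\<^sup>2) \<in> borel_measurable M" by measurable
    have pos: "0 \<le> v j x * (w j x)\<^sup>2" for j x using v_pos[of j x] by simp
    show "AE x in M. norm (v k x * (w k x)\<^sup>2) \<le> 1"
    proof (rule AE_I2)
      fix x assume x: "x \<in> space M"
      have "v k x * (w k x)\<^sup>2 \<le> (\<Sum>j\<in>{1..n}. v j x * (w j x)\<^sup>2)"
        using k pos by (intro member_le_sum) auto
      then show "norm (v k x * (w k x)\<^sup>2) \<le> 1" using total[OF x] pos by simp
    qed
  qed
  then have "(\<Sum>k\<in>{1..n}. expectation (\<lambda>x. v k x * (w k x)\<^sup>2)) = expectation (\<lambda>x. \<Sum>k\<in>{1..n}. v k x * (w k x)\<^sup>2)"
    by simp
  also have "\<dots> \<le> expectation (\<lambda>_. 1)"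
    using int total by (intro integral_mono) auto
  finally show ?thesis by (simp add: prob_space)
qed

text \<open>The factor exp(t^2 v w^2 / 2) compensates the conditional mean of iexp(t w e), which is
  about 1 - t^2 v w^2 / 2. As the total is at most 1, every partial product has modulus at most
  exp(t^2/2). An inequality is assumed for the total because truncated weights may all
  vanish.\<close>

lemma char_weighted_sum_bound:
  fixes w :: "nat \<Rightarrow> 'a \<Rightarrow> real"
  assumes w: "\<And>j k. j \<in> {1..n} \<Longrightarrow> k \<in> {1..n} \<Longrightarrow> w j \<in> borel_measurable (F k)"
    and w_bound: "\<And>j x. j \<in> {1..n} \<Longrightarrow> x \<in> space M \<Longrightarrow> \<bar>w j x\<bar> \<le> \<eta>" and \<eta>: "0 < \<eta>" "\<eta> \<le> 1"
    and total: "\<And>x. x \<in> space M \<Longrightarrow> (\<Sum>j\<in>{1..n}. v j x * (w j x)\<^sup>2) \<le> 1"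
  shows "cmod (expectation (\<lambda>x. iexp (t * (\<Sum>j\<in>{1..n}. w j x * e j x)) *
      of_real (exp (t\<^sup>2 / 2 * (\<Sum>j\<in>{1..n}. v j x * (w j x)\<^sup>2)))) - 1)
    \<le> exp (t\<^sup>2 / 2) * (\<bar>t\<bar> powr (2 + \<delta>) * C / c + t ^ 4 / 4 * C) * \<eta> powr \<delta>"
proof -
  define \<tau> where "\<tau> j x = v j x * (w j x)\<^sup>2" for j x
  define p where "p j x = iexp (t * (w j x * e j x)) * complex_of_real (exp (t\<^sup>2 / 2 * \<tau> j x))" for j x
  define B where "B = exp (t\<^sup>2 / 2)"
  define K where "K = \<bar>t\<bar> powr (2 + \<delta>) * C / c + t ^ 4 / 4 * C"
  have \<tau>0: "0 \<le> \<tau> j x" for j x using v_pos[of j x] by (simp add: \<tau>_def)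
  have prod: "(\<Prod>j\<in>J. p j x) = iexp (t * (\<Sum>j\<in>J. w j x * e j x)) * of_real (exp (t\<^sup>2 / 2 * (\<Sum>j\<in>J. \<tau> j x)))"
    if "finite J" for J x
    using that by (induction J) (auto simp: p_def algebra_simps exp_add)
  have p_other: "p j \<in> borel_measurable (F k)" if "j \<in> {1..n}" "k \<in> {1..n}" "j \<noteq> k" for j k
  proof -
    note [measurable] = w[OF that(1,2)] e_other[OF that] v_meas[OF that(1,2)]
    show ?thesis unfolding p_def \<tau>_def by measurable
  qed
  have p_meas: "p k \<in> borel_measurable M" if "k \<in> {1..n}" for k
  proof -
    note [measurable] = F_meas[OF w[OF that that] that] F_meas[OF v_meas[OF that that] that] e_meas[OF that]
    show ?thesis unfolding p_def \<tau>_def by measurable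
  qed
  have partial: "cmod (\<Prod>j\<in>{1..k}. p j x) \<le> B" if "k \<le> n" "x \<in> space M" for k x
  proof -
    have "(\<Sum>j\<in>{1..k}. \<tau> j x) \<le> (\<Sum>j\<in>{1..n}. \<tau> j x)"
      using that \<tau>0 by (intro sum_mono2) auto
    also have "\<dots> \<le> 1" using total[OF that(2)] by (simp add: \<tau>_def)
    finally have "t\<^sup>2 / 2 * (\<Sum>j\<in>{1..k}. \<tau> j x) \<le> t\<^sup>2 / 2 * 1" by (intro mult_left_mono) auto
    then show ?thesis unfolding prod[OF finite_atLeastAtMost] norm_mult norm_exp_i_times B_def by simp
  qed
  have "cmod (expectation (\<lambda>x. \<Prod>j\<in>{1..n}. p j x) - 1) \<le> (\<Sum>k\<in>{1..n}. B * K * \<eta> powr \<delta> * expectation (\<tau> k))"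
  proof (rule telescoping_product_bound[OF p_meas partial])
    fix k assume k: "k \<in> {1..n}"
    note [measurable] = F_meas[OF w[OF k k] k] F_meas[OF v_meas[OF k k] k] e_meas[OF k]
    \<comment> \<open>The k-th compensator is moved into \<open>G\<close>, which stays free of the
      k-th response; what remains of \<open>p k x - 1\<close> is iexp(t w e) - exp(-t^2 \<tau> / 2),
      and \<open>R\<close> is the difference of the two Taylor remainders.\<close>
    define G where "G x = (\<Prod>j\<in>{1..<k}. p j x) * complex_of_real (exp (t\<^sup>2 / 2 * \<tau> k x))" for x
    define R where "R x = (iexp (t * (w k x * e k x)) - (1 + \<i> * of_real (t * (w k x * e k x)) - of_real ((t * (w k x * e k x))\<^sup>2 / 2)))
        - of_real (exp (- (t\<^sup>2 / 2 * \<tau> k x)) - (1 - t\<^sup>2 / 2 * \<tau> k x))" for x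
    have GF: "G \<in> borel_measurable (F k)"
    proof -
      have "(\<lambda>x. \<Prod>j\<in>{1..<k}. p j x) \<in> borel_measurable (F k)"
        using k by (intro borel_measurable_prod p_other) auto
      moreover note w[OF k k, measurable] v_meas[OF k k, measurable]
      have "(\<lambda>x. complex_of_real (exp (t\<^sup>2 / 2 * \<tau> k x))) \<in> borel_measurable (F k)"
        unfolding \<tau>_def by measurable
      ultimately show ?thesis unfolding G_def by (rule borel_measurable_times)
    qed
    have GB: "cmod (G x) \<le> B" if "x \<in> space M" for x
    proof -
      \<comment> \<open>\<open>G\<close> differs from the k-th partial product only by a factor of
        modulus 1.\<close>
      have "{1..k} = insert k {1..<k}" using k by auto
      then have "cmod (\<Prod>j\<in>{1..k}. p j x) = cmod (G x)" by (simp add: G_def p_def norm_mult)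
      then show ?thesis using partial[of k x] that k by simp
    qed
    have RM: "R \<in> borel_measurable M" unfolding R_def \<tau>_def by measurable
    have Rb: "cmod (R x) \<le> \<bar>t\<bar> powr (2 + \<delta>) * \<bar>w k x * e k x\<bar> powr (2 + \<delta>) + t ^ 4 / 4 * (v k x * (w k x)\<^sup>2)\<^sup>2"
      for x
    proof -
      have "cmod (R x) \<le> \<bar>t * (w k x * e k x)\<bar> powr (2 + \<delta>) + (t\<^sup>2 / 2 * \<tau> k x)\<^sup>2"
        unfolding R_def
        by (rule order_trans[OF norm_triangle_ineq4 add_mono[OF cmod_iexp_second_order]])
          (use params \<tau>0 abs_exp_minus_taylor[of "t\<^sup>2 / 2 * \<tau> k x"] in \<open>auto simp del: of_real_diff of_real_exp\<close>)
      also have "(t\<^sup>2 / 2 * \<tau> k x)\<^sup>2 = t ^ 4 / 4 * (\<tau> k x)\<^sup>2"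
        by (simp add: power2_eq_square eval_nat_numeral)
      finally show ?thesis by (simp add: abs_mult powr_mult \<tau>_def)
    qed
    have rem: "integrable M (\<lambda>x. G x * R x)"
        "cmod (expectation (\<lambda>x. G x * R x)) \<le> B * K * \<eta> powr \<delta> * expectation (\<tau> k)"
      using expectation_weighted_remainder[OF k F_meas[OF GF k] GB w[OF k k] w_bound[OF k] \<eta> RM Rb]
      by (auto simp: K_def \<tau>_def[abs_def])
    \<comment> \<open>The Taylor polynomials differ by a term linear in \<open>e\<close> and a term
      linear in \<open>e^2 - v\<close>; \<open>G1\<close> and \<open>G2\<close> are their
      coefficients, and both terms have expectation 0.\<close>
    define G1 where "G1 x = G x * (\<i> * of_real (t * w k x))" for x
    define G2 where "G2 x = G x * of_real (t\<^sup>2 / 2 * (w k x)\<^sup>2)" for x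
    have G12: "G1 \<in> borel_measurable (F k)" "G2 \<in> borel_measurable (F k)"
    proof -
      note [measurable] = w[OF k k] GF
      show "G1 \<in> borel_measurable (F k)" "G2 \<in> borel_measurable (F k)" unfolding G1_def G2_def by measurable
    qed
    have w1: "\<bar>w k x\<bar> \<le> 1" if "x \<in> space M" for x using w_bound[OF k that] \<eta> by simp
    have G1b: "cmod (G1 x) \<le> B * (\<bar>t\<bar> * 1)" if "x \<in> space M" for x
      unfolding G1_def norm_mult norm_of_real norm_ii abs_mult mult_1_left
      using GB[OF that] w1[OF that] by (intro mult_mono) (auto simp: B_def)
    have G2b: "cmod (G2 x) \<le> B * (t\<^sup>2 / 2 * 1)" if "x \<in> space M" for x
      unfolding G2_def norm_mult norm_of_real abs_mult
      using GB[OF that] w1[OF that] by (intro mult_mono) (auto simp: B_def abs_square_le_1)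
    have i1: "integrable M (\<lambda>x. G1 x * of_real (e k x))"
      using integrable_bounded_mult[OF e_int[OF k] F_meas[OF G12(1) k] G1b] .
    have i2: "integrable M (\<lambda>x. G2 x * of_real ((e k x)\<^sup>2 - v k x))"
      using e_sq_int[OF k] v_int[OF k] by (intro integrable_bounded_mult[OF _ F_meas[OF G12(2) k] G2b]) auto
    have "(\<Prod>j\<in>{1..<k}. p j x) * (p k x - 1) = G x * R x + G1 x * of_real (e k x) - G2 x * of_real ((e k x)\<^sup>2 - v k x)" for x
    proof -
      have "G x * (iexp (t * (w k x * e k x)) - of_real (exp (- (t\<^sup>2 / 2 * \<tau> k x)))) =
          (\<Prod>j\<in>{1..<k}. p j x) * (p k x - of_real (exp (t\<^sup>2 / 2 * \<tau> k x) * exp (- (t\<^sup>2 / 2 * \<tau> k x))))"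
        unfolding G_def p_def of_real_mult by (simp only: algebra_simps)
      also have "exp (t\<^sup>2 / 2 * \<tau> k x) * exp (- (t\<^sup>2 / 2 * \<tau> k x)) = 1"
        by (simp flip: exp_add)
      finally have "(\<Prod>j\<in>{1..<k}. p j x) * (p k x - 1) = G x * (iexp (t * (w k x * e k x)) - of_real (exp (- (t\<^sup>2 / 2 * \<tau> k x))))"
        by simp
      also have "iexp (t * (w k x * e k x)) - of_real (exp (- (t\<^sup>2 / 2 * \<tau> k x))) =
          R x + \<i> * of_real (t * (w k x * e k x)) - of_real ((t * (w k x * e k x))\<^sup>2 / 2 - t\<^sup>2 / 2 * \<tau> k x)"
        unfolding R_def by (simp add: algebra_simps)
      also have "(t * (w k x * e k x))\<^sup>2 / 2 - t\<^sup>2 / 2 * \<tau> k x = t\<^sup>2 / 2 * (w k x)\<^sup>2 * ((e k x)\<^sup>2 - v k x)"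
        by (simp add: \<tau>_def power2_eq_square algebra_simps)
      finally show ?thesis unfolding G1_def G2_def by (simp add: algebra_simps)
    qed
    then have "expectation (\<lambda>x. (\<Prod>j\<in>{1..<k}. p j x) * (p k x - 1)) =
        expectation (\<lambda>x. G x * R x) + expectation (\<lambda>x. G1 x * of_real (e k x)) - expectation (\<lambda>x. G2 x * of_real ((e k x)\<^sup>2 - v k x))"
      using rem(1) i1 i2 by simp
    then show "cmod (expectation (\<lambda>x. (\<Prod>j\<in>{1..<k}. p j x) * (p k x - 1))) \<le> B * K * \<eta> powr \<delta> * expectation (\<tau> k)"
      using rem(2) complex_e_mean[OF k G12(1) G1b] complex_e_var[OF k G12(2) G2b] by simp
  qed
  also have "\<dots> = B * K * \<eta> powr \<delta> * (\<Sum>k\<in>{1..n}. expectation (\<tau> k))"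
    by (simp add: sum_distrib_left)
  also have "\<dots> \<le> B * K * \<eta> powr \<delta> * 1"
  proof (rule mult_left_mono)
    show "(\<Sum>k\<in>{1..n}. expectation (\<tau> k)) \<le> 1"
      unfolding \<tau>_def by (rule sum_expectation_weights[OF w total])
    show "0 \<le> B * K * \<eta> powr \<delta>" using C_pos params by (simp add: B_def K_def)
  qed
  finally show ?thesis by (simp add: prod B_def K_def \<tau>_def)
qed

text \<open>Only moments of order 2+\<delta> of the noise are available, so the squares may have
  infinite variance and Chebyshev's inequality is out of reach; characteristic functions get by with
  the 1+\<delta>/2 moments of the squares. All partial products have modulus 1 here.\<close>

lemma char_weighted_squares_bound:
  fixes w :: "nat \<Rightarrow> 'a \<Rightarrow> real"
  assumes w: "\<And>j k. j \<in> {1..n} \<Longrightarrow> k \<in> {1..n} \<Longrightarrow> w j \<in> borel_measurable (F k)"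
    and w_bound: "\<And>j x. j \<in> {1..n} \<Longrightarrow> x \<in> space M \<Longrightarrow> \<bar>w j x\<bar> \<le> \<eta>" and \<eta>: "0 < \<eta>" "\<eta> \<le> 1"
    and total: "\<And>x. x \<in> space M \<Longrightarrow> (\<Sum>j\<in>{1..n}. v j x * (w j x)\<^sup>2) \<le> 1"
  shows "cmod (expectation (\<lambda>x. iexp (t * (\<Sum>j\<in>{1..n}. (w j x)\<^sup>2 * ((e j x)\<^sup>2 - v j x)))) - 1)
    \<le> (2 * \<bar>t\<bar> powr (1 + \<delta> / 2) * C / c + 2 * t\<^sup>2 * C) * \<eta> powr \<delta>"
proof -
  define \<tau> where "\<tau> j x = v j x * (w j x)\<^sup>2" for j x
  define p where "p j x = iexp (t * ((w j x)\<^sup>2 * ((e j x)\<^sup>2 - v j x)))" for j x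
  define K where "K = 2 * \<bar>t\<bar> powr (1 + \<delta> / 2) * C / c + 2 * t\<^sup>2 * C"
  have \<tau>0: "0 \<le> \<tau> j x" for j x using v_pos[of j x] by (simp add: \<tau>_def)
  have prod: "(\<Prod>j\<in>J. p j x) = iexp (t * (\<Sum>j\<in>J. (w j x)\<^sup>2 * ((e j x)\<^sup>2 - v j x)))"
    if "finite J" for J x
    using that by (induction J) (auto simp: p_def algebra_simps exp_add exp_diff)
  have p_other: "p j \<in> borel_measurable (F k)" if "j \<in> {1..n}" "k \<in> {1..n}" "j \<noteq> k" for j k
  proof -
    note [measurable] = w[OF that(1,2)] e_other[OF that] v_meas[OF that(1,2)]
    show ?thesis unfolding p_def by measurable
  qed
  have p_meas: "p k \<in> borel_measurable M" if "k \<in> {1..n}" for k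
  proof -
    note [measurable] = F_meas[OF w[OF that that] that] F_meas[OF v_meas[OF that that] that] e_meas[OF that]
    show ?thesis unfolding p_def by measurable
  qed
  have "cmod (expectation (\<lambda>x. \<Prod>j\<in>{1..n}. p j x) - 1) \<le> (\<Sum>k\<in>{1..n}. 1 * K * \<eta> powr \<delta> * expectation (\<tau> k))"
  proof (rule telescoping_product_bound[OF p_meas, where B=1])
    show "cmod (\<Prod>j\<in>{1..k}. p j x) \<le> 1" for k x by (simp add: prod)
    fix k assume k: "k \<in> {1..n}"
    note [measurable] = F_meas[OF w[OF k k] k] F_meas[OF v_meas[OF k k] k] e_meas[OF k]
    \<comment> \<open>With the centring iexp(-t \<tau>) moved into \<open>G\<close>, the bracket is
      iexp(t (w e)^2) - iexp(t \<tau>), whose first-order part is i t w^2 (e^2 - v) and has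
      conditional mean 0.\<close>
    define G where "G x = (\<Prod>j\<in>{1..<k}. p j x) * iexp (- (t * \<tau> k x))" for x
    define R where "R x = (iexp (t * (w k x * e k x)\<^sup>2) - (1 + \<i> * of_real (t * (w k x * e k x)\<^sup>2)))
        - (iexp (t * \<tau> k x) - (1 + \<i> * of_real (t * \<tau> k x)))" for x
    have GF: "G \<in> borel_measurable (F k)"
    proof -
      have "(\<lambda>x. \<Prod>j\<in>{1..<k}. p j x) \<in> borel_measurable (F k)"
        using k by (intro borel_measurable_prod p_other) auto
      moreover note w[OF k k, measurable] v_meas[OF k k, measurable]
      have "(\<lambda>x. iexp (- (t * \<tau> k x))) \<in> borel_measurable (F k)"
        unfolding \<tau>_def by measurable
      ultimately show ?thesis unfolding G_def by (rule borel_measurable_times)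
    qed
    have GB: "cmod (G x) \<le> 1" for x
      unfolding G_def norm_mult norm_exp_i_times prod[OF finite_atLeastLessThan] by simp
    have RM: "R \<in> borel_measurable M" unfolding R_def \<tau>_def by measurable
    have Rb: "cmod (R x) \<le> (2 * \<bar>t\<bar> powr (1 + \<delta> / 2)) * \<bar>w k x * e k x\<bar> powr (2 + \<delta>) + 2 * t\<^sup>2 * (v k x * (w k x)\<^sup>2)\<^sup>2"
      for x
    proof -
      \<comment> \<open>The first-order bound is used with exponent \<delta>/2 for the squared noise
        and with exponent 1 for the bounded \<tau>.\<close>
      have "cmod (R x) \<le> 2 * \<bar>t * (w k x * e k x)\<^sup>2\<bar> powr (1 + \<delta> / 2) + 2 * \<bar>t * \<tau> k x\<bar> powr (1 + 1)"
        unfolding R_def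
        by (rule order_trans[OF norm_triangle_ineq4 add_mono[OF cmod_iexp_first_order cmod_iexp_first_order]])
          (use params in auto)
      also have "\<bar>t * \<tau> k x\<bar> powr (1 + 1) = t\<^sup>2 * (\<tau> k x)\<^sup>2"
        by (simp add: power_mult_distrib)
      also have "\<bar>t * (w k x * e k x)\<^sup>2\<bar> powr (1 + \<delta> / 2) = \<bar>t\<bar> powr (1 + \<delta> / 2) * (\<bar>w k x * e k x\<bar> powr 2) powr (1 + \<delta> / 2)"
      proof -
        have "\<bar>t * (w k x * e k x)\<^sup>2\<bar> = \<bar>t\<bar> * \<bar>w k x * e k x\<bar> powr 2"
          by (simp add: abs_mult power_mult_distrib)
        then show ?thesis by (simp only: powr_mult abs_ge_zero powr_ge_zero)
      qed
      also have "(\<bar>w k x * e k x\<bar> powr 2) powr (1 + \<delta> / 2) = \<bar>w k x * e k x\<bar> powr (2 + \<delta>)"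
        unfolding powr_powr by (simp add: distrib_left)
      finally show ?thesis by (simp add: \<tau>_def)
    qed
    have rem: "integrable M (\<lambda>x. G x * R x)"
        "cmod (expectation (\<lambda>x. G x * R x)) \<le> 1 * K * \<eta> powr \<delta> * expectation (\<tau> k)"
      using expectation_weighted_remainder[OF k F_meas[OF GF k] GB w[OF k k] w_bound[OF k] \<eta> RM Rb]
      by (auto simp: K_def \<tau>_def[abs_def])
    define G2 where "G2 x = G x * (\<i> * of_real (t * (w k x)\<^sup>2))" for x
    have G2: "G2 \<in> borel_measurable (F k)"
    proof -
      note [measurable] = w[OF k k] GF
      show "G2 \<in> borel_measurable (F k)" unfolding G2_def by measurable
    qed
    have G2b: "cmod (G2 x) \<le> 1 * (\<bar>t\<bar> * 1)" if "x \<in> space M" for x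
    proof -
      have "(w k x)\<^sup>2 \<le> 1" using w_bound[OF k that] \<eta> by (simp add: abs_square_le_1)
      then have "cmod (G x) * (\<bar>t\<bar> * (w k x)\<^sup>2) \<le> 1 * (\<bar>t\<bar> * 1)"
        by (intro mult_mono[OF GB] mult_left_mono) auto
      then show ?thesis by (simp add: G2_def norm_mult norm_power)
    qed
    have i2: "integrable M (\<lambda>x. G2 x * of_real ((e k x)\<^sup>2 - v k x))"
      using e_sq_int[OF k] v_int[OF k] by (intro integrable_bounded_mult[OF _ F_meas[OF G2 k] G2b]) auto
    have "(\<Prod>j\<in>{1..<k}. p j x) * (p k x - 1) = G x * R x + G2 x * of_real ((e k x)\<^sup>2 - v k x)" for x
    proof -
      have "G x * (iexp (t * (w k x * e k x)\<^sup>2) - iexp (t * \<tau> k x)) =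
          (\<Prod>j\<in>{1..<k}. p j x) * (iexp (t * (w k x * e k x)\<^sup>2) * iexp (- (t * \<tau> k x)) - iexp (- (t * \<tau> k x)) * iexp (t * \<tau> k x))"
        unfolding G_def by (simp only: algebra_simps)
      also have "iexp (- (t * \<tau> k x)) * iexp (t * \<tau> k x) = 1"
        by (simp flip: exp_add)
      also have "iexp (t * (w k x * e k x)\<^sup>2) * iexp (- (t * \<tau> k x)) = p k x"
        unfolding p_def \<tau>_def by (simp add: algebra_simps power_mult_distrib flip: exp_add)
      finally have "(\<Prod>j\<in>{1..<k}. p j x) * (p k x - 1) = G x * (iexp (t * (w k x * e k x)\<^sup>2) - iexp (t * \<tau> k x))"
        by simp
      also have "iexp (t * (w k x * e k x)\<^sup>2) - iexp (t * \<tau> k x) =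
          R x + \<i> * of_real (t * (w k x)\<^sup>2) * of_real ((e k x)\<^sup>2 - v k x)"
        unfolding R_def \<tau>_def by (simp add: algebra_simps power_mult_distrib)
      finally show ?thesis unfolding G2_def by (simp add: algebra_simps)
    qed
    then have "expectation (\<lambda>x. (\<Prod>j\<in>{1..<k}. p j x) * (p k x - 1)) =
        expectation (\<lambda>x. G x * R x) + expectation (\<lambda>x. G2 x * of_real ((e k x)\<^sup>2 - v k x))"
      using rem(1) i2 by simp
    then show "cmod (expectation (\<lambda>x. (\<Prod>j\<in>{1..<k}. p j x) * (p k x - 1))) \<le> 1 * K * \<eta> powr \<delta> * expectation (\<tau> k)"
      using rem(2) complex_e_var[OF k G2 G2b] by simp
  qed
  also have "\<dots> = K * \<eta> powr \<delta> * (\<Sum>k\<in>{1..n}. expectation (\<tau> k))"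
    by (simp add: sum_distrib_left)
  also have "\<dots> \<le> K * \<eta> powr \<delta> * 1"
  proof (rule mult_left_mono)
    show "(\<Sum>k\<in>{1..n}. expectation (\<tau> k)) \<le> 1"
      unfolding \<tau>_def by (rule sum_expectation_weights[OF w total])
    show "0 \<le> K * \<eta> powr \<delta>" using C_pos params by (simp add: K_def)
  qed
  finally show ?thesis by (simp add: prod K_def)
qed

end

section \<open>Self-normalised weights, truncated to the event where they are small\<close>

lemma (in prob_space) expectation_diff_coincide_bound:
  fixes f g :: "'a \<Rightarrow> complex"
  assumes "f \<in> borel_measurable M" "g \<in> borel_measurable M" "A \<in> sets M"
    and "\<And>x. x \<in> space M \<Longrightarrow> cmod (f x) \<le> 1" "\<And>x. x \<in> space M \<Longrightarrow> cmod (g x) \<le> 1"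
    and "\<And>x. x \<in> A \<Longrightarrow> f x = g x"
  shows "cmod (expectation f - expectation g) \<le> 2 * prob (space M - A)"
proof -
  have int: "integrable M f" "integrable M g"
    using assms by (auto intro!: integrable_const_bound[where B=1])
  have "cmod (expectation f - expectation g) = cmod (expectation (\<lambda>x. f x - g x))"
    using int by simp
  also have "\<dots> \<le> expectation (\<lambda>x. cmod (f x - g x))"
    by (rule integral_norm_bound)
  also have "\<dots> \<le> expectation (\<lambda>x. 2 * indicator (space M - A) x)"
  proof (rule integral_mono)
    fix x assume x: "x \<in> space M"
    show "cmod (f x - g x) \<le> 2 * indicator (space M - A) x"
      using norm_triangle_ineq4[of "f x" "g x"] assms(4,5)[OF x] assms(6)[of x] x
      by (cases "x \<in> A") auto
  qed (use int assms(3) in \<open>auto simp: less_top[symmetric]\<close>)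
  also have "\<dots> = 2 * prob (space M - A)"
    using assms(3) by simp
  finally show ?thesis .
qed

text \<open>A zero denominator gives zero weights under the division convention; hence the two cases
  in \<open>self_norm_total\<close>.\<close>

definition self_norm :: "nat \<Rightarrow> (nat \<Rightarrow> 'a \<Rightarrow> real) \<Rightarrow> (nat \<Rightarrow> 'a \<Rightarrow> real) \<Rightarrow> nat \<Rightarrow> 'a \<Rightarrow> real" where
  "self_norm n v u j x = u j x / sqrt (\<Sum>i\<in>{1..n}. v i x * (u i x)\<^sup>2)"

lemma self_norm_total:
  assumes "\<And>i. 0 \<le> v i x"
  shows "(\<Sum>j\<in>{1..n}. v j x * (self_norm n v u j x)\<^sup>2) =
    (if (\<Sum>i\<in>{1..n}. v i x * (u i x)\<^sup>2) = 0 then 0 else 1)"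
proof -
  define S where "S = (\<Sum>i\<in>{1..n}. v i x * (u i x)\<^sup>2)"
  have "0 \<le> S" unfolding S_def using assms by (intro sum_nonneg) auto
  then have "(\<Sum>j\<in>{1..n}. v j x * (self_norm n v u j x)\<^sup>2) = (\<Sum>j\<in>{1..n}. v j x * (u j x)\<^sup>2 / S)"
    by (simp add: self_norm_def S_def power_divide)
  also have "\<dots> = S / S" by (simp only: S_def sum_divide_distrib)
  finally show ?thesis by (auto simp: S_def)
qed

context noise_array
begin

lemma self_norm_measurable:
  assumes u: "\<And>j k. j \<in> {1..n} \<Longrightarrow> k \<in> {1..n} \<Longrightarrow> u j \<in> borel_measurable (F k)"
    and "j \<in> {1..n}" "k \<in> {1..n}"
  shows "self_norm n v u j \<in> borel_measurable (F k)"
proof -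
  have [measurable]: "(\<lambda>x. \<Sum>i\<in>{1..n}. v i x * (u i x)\<^sup>2) \<in> borel_measurable (F k)"
    using assms(2,3) u v_meas by (intro borel_measurable_sum borel_measurable_times borel_measurable_power) auto
  note [measurable] = u[OF assms(2,3)]
  show ?thesis unfolding self_norm_def by measurable
qed

context
  fixes u :: "nat \<Rightarrow> 'a \<Rightarrow> real" and \<eta> :: real and good :: "'a set"
  assumes u: "\<And>j k. j \<in> {1..n} \<Longrightarrow> k \<in> {1..n} \<Longrightarrow> u j \<in> borel_measurable (F k)"
    and n: "1 \<le> n" and \<eta>: "0 < \<eta>" "\<eta> \<le> 1"
  defines "good \<equiv> {x \<in> space M. (\<Sum>i\<in>{1..n}. v i x * (u i x)\<^sup>2) \<noteq> 0 \<and>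
      (\<forall>j\<in>{1..n}. \<bar>self_norm n v u j x\<bar> \<le> \<eta>)}"
begin

text \<open>The event lies in every \<open>F k\<close> because its definition involves weights and
  conditional variances only; multiplying by its indicator therefore keeps the weights free of each
  response.\<close>

lemma good_sets:
  assumes "k \<in> {1..n}"
  shows "good \<in> sets (F k)"
proof -
  have [measurable]: "(\<lambda>x. \<Sum>i\<in>{1..n}. v i x * (u i x)\<^sup>2) \<in> borel_measurable (F k)"
    using assms u v_meas by (intro borel_measurable_sum borel_measurable_times borel_measurable_power) auto
  have "{x \<in> space (F k). \<bar>self_norm n v u j x\<bar> \<le> \<eta>} \<in> sets (F k)" if "j \<in> {1..n}" for j
  proof -
    note [measurable] = self_norm_measurable[of u, OF u that assms]
    show ?thesis by measurable
  qed
  then have "{x \<in> space (F k). \<forall>j\<in>{1..n}. \<bar>self_norm n v u j x\<bar> \<le> \<eta>} \<in> sets (F k)"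
    by (intro sets.sets_Collect_finite_All) auto
  moreover have "{x \<in> space (F k). (\<Sum>i\<in>{1..n}. v i x * (u i x)\<^sup>2) \<noteq> 0} \<in> sets (F k)"
    by measurable
  moreover have "space (F k) = space M" using sub[OF assms] by (simp add: subalgebra_def)
  moreover have "good = {x \<in> space M. (\<Sum>i\<in>{1..n}. v i x * (u i x)\<^sup>2) \<noteq> 0} \<inter>
      {x \<in> space M. \<forall>j\<in>{1..n}. \<bar>self_norm n v u j x\<bar> \<le> \<eta>}"
    unfolding good_def by auto
  ultimately show ?thesis by (simp only: sets.Int)
qed

lemma good_sets_M: "good \<in> sets M"
  using good_sets[of 1] n sub[of 1] by (auto simp: subalgebra_def)

text \<open>The characteristic function bounds ask for weights that are small at every point,
  whereas the original ones are small with high probability only.\<close>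

definition trunc_weight :: "nat \<Rightarrow> 'a \<Rightarrow> real" where
  "trunc_weight j x = self_norm n v u j x * indicator good x"

lemma trunc_weight_measurable:
  assumes "j \<in> {1..n}" "k \<in> {1..n}"
  shows "trunc_weight j \<in> borel_measurable (F k)"
proof -
  note [measurable] = self_norm_measurable[of u, OF u assms] good_sets[OF assms(2)]
  show ?thesis unfolding trunc_weight_def by measurable
qed

lemma trunc_weight_bound: "j \<in> {1..n} \<Longrightarrow> \<bar>trunc_weight j x\<bar> \<le> \<eta>"
  using \<eta> by (auto simp: trunc_weight_def good_def indicator_def)

lemma trunc_weight_total: "(\<Sum>j\<in>{1..n}. v j x * (trunc_weight j x)\<^sup>2) = indicator good x"
proof (cases "x \<in> good")
  case True
  then show ?thesis
    using self_norm_total[of v x n u] v_pos[THEN less_imp_le] by (auto simp: trunc_weight_def good_def)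
qed (simp add: trunc_weight_def)

lemma trunc_weight_measurable_M:
  assumes "j \<in> {1..n}"
  shows "trunc_weight j \<in> borel_measurable M" "self_norm n v u j \<in> borel_measurable M" "v j \<in> borel_measurable M"
  by (intro F_meas[OF _ assms] trunc_weight_measurable self_norm_measurable u v_meas assms; assumption)+

text \<open>The truncated weights have total \<open>indicator good x\<close>, so the compensator is
  deterministic on \<open>good\<close>; replacing the truncated sum by the original one costs twice
  the probability of the complement.\<close>

lemma char_self_norm_sum_bound:
  "cmod (expectation (\<lambda>x. iexp (t * (\<Sum>j\<in>{1..n}. self_norm n v u j x * e j x))) - of_real (exp (- (t\<^sup>2) / 2)))
    \<le> (\<bar>t\<bar> powr (2 + \<delta>) * C / c + t ^ 4 / 4 * C) * \<eta> powr \<delta> + 2 * prob (space M - good)"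
proof -
  define W where "W x = (\<Sum>j\<in>{1..n}. self_norm n v u j x * e j x)" for x
  define W' where "W' x = (\<Sum>j\<in>{1..n}. trunc_weight j x * e j x)" for x
  \<comment> \<open>\<open>g\<close> is the compensated exponential divided by exp(t^2/2). It has
    modulus at most 1, equals iexp(t W) on \<open>good\<close>, and the division cancels the factor
    exp(t^2/2) of \<open>char_weighted_sum_bound\<close>.\<close>
  define g where "g x = iexp (t * W' x) * complex_of_real (exp (t\<^sup>2 / 2 * (indicator good x - 1)))" for x
  define E where "E = exp (t\<^sup>2 / 2)"
  define K where "K = \<bar>t\<bar> powr (2 + \<delta>) * C / c + t ^ 4 / 4 * C"
  have [measurable]: "W \<in> borel_measurable M" "W' \<in> borel_measurable M" "good \<in> sets M"
    unfolding W_def W'_def using trunc_weight_measurable_M e_meas good_sets_M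
    by (auto intro!: borel_measurable_sum borel_measurable_times)
  have gb: "cmod (g x) \<le> 1" for x
    unfolding g_def norm_mult norm_exp_i_times norm_of_real by (auto simp: indicator_def)
  have gM: "g \<in> borel_measurable M" unfolding g_def by measurable
  have "cmod (expectation (\<lambda>x. iexp (t * W' x) * of_real (exp (t\<^sup>2 / 2 * indicator good x))) - 1) \<le> E * K * \<eta> powr \<delta>"
    unfolding E_def K_def W'_def trunc_weight_total[symmetric]
    by (rule char_weighted_sum_bound[OF trunc_weight_measurable trunc_weight_bound \<eta>])
      (auto simp only: trunc_weight_total indicator_le_1)
  also have "(\<lambda>x. iexp (t * W' x) * of_real (exp (t\<^sup>2 / 2 * indicator good x))) = (\<lambda>x. of_real E * g x)"
    by (rule ext) (simp add: g_def E_def right_diff_distrib exp_diff)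
  also have "expectation (\<lambda>x. of_real E * g x) - 1 = of_real E * (expectation g - of_real (exp (- (t\<^sup>2) / 2)))"
    by (simp add: E_def right_diff_distrib exp_minus)
  also have "cmod \<dots> = E * cmod (expectation g - of_real (exp (- (t\<^sup>2) / 2)))"
    by (simp add: norm_mult E_def)
  finally have 1: "cmod (expectation g - of_real (exp (- (t\<^sup>2) / 2))) \<le> K * \<eta> powr \<delta>"
    by (simp add: E_def mult.assoc)
  have 2: "cmod (expectation (\<lambda>x. iexp (t * W x)) - expectation g) \<le> 2 * prob (space M - good)"
  proof (rule expectation_diff_coincide_bound[OF _ gM good_sets_M _ gb])
    show "(\<lambda>x. iexp (t * W x)) \<in> borel_measurable M" by measurable
  qed (simp_all add: g_def W_def W'_def trunc_weight_def)
  show ?thesis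
    using norm_triangle_sub_sub[of "expectation (\<lambda>x. iexp (t * W x))" "of_real (exp (- (t\<^sup>2) / 2))" "expectation g"] 1 2
    unfolding W_def K_def by linarith
qed

lemma char_self_norm_squares_bound:
  "cmod (expectation (\<lambda>x. iexp (t * (\<Sum>j\<in>{1..n}. (self_norm n v u j x)\<^sup>2 * ((e j x)\<^sup>2 - v j x)))) - 1)
    \<le> (2 * \<bar>t\<bar> powr (1 + \<delta> / 2) * C / c + 2 * t\<^sup>2 * C) * \<eta> powr \<delta> + 2 * prob (space M - good)"
proof -
  define W where "W x = (\<Sum>j\<in>{1..n}. (self_norm n v u j x)\<^sup>2 * ((e j x)\<^sup>2 - v j x))" for x
  define W' where "W' x = (\<Sum>j\<in>{1..n}. (trunc_weight j x)\<^sup>2 * ((e j x)\<^sup>2 - v j x))" for x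
  have [measurable]: "W \<in> borel_measurable M" "W' \<in> borel_measurable M" "good \<in> sets M"
    unfolding W_def W'_def using trunc_weight_measurable_M e_meas good_sets_M
    by (auto intro!: borel_measurable_sum borel_measurable_times borel_measurable_diff borel_measurable_power)
  have 1: "cmod (expectation (\<lambda>x. iexp (t * W' x)) - 1) \<le> (2 * \<bar>t\<bar> powr (1 + \<delta> / 2) * C / c + 2 * t\<^sup>2 * C) * \<eta> powr \<delta>"
    unfolding W'_def
    by (rule char_weighted_squares_bound[OF trunc_weight_measurable trunc_weight_bound \<eta>])
      (auto simp only: trunc_weight_total indicator_le_1)
  have 2: "cmod (expectation (\<lambda>x. iexp (t * W x)) - expectation (\<lambda>x. iexp (t * W' x))) \<le> 2 * prob (space M - good)"
  proof (rule expectation_diff_coincide_bound[OF _ _ good_sets_M])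
    show "(\<lambda>x. iexp (t * W x)) \<in> borel_measurable M" by measurable
    show "(\<lambda>x. iexp (t * W' x)) \<in> borel_measurable M" by measurable
  qed (simp_all add: W_def W'_def trunc_weight_def)
  show ?thesis
    using norm_triangle_sub_sub[of "expectation (\<lambda>x. iexp (t * W x))" 1 "expectation (\<lambda>x. iexp (t * W' x))"] 1 2
    unfolding W_def by linarith
qed

end

end

section \<open>Convergence in distribution\<close>

lemma (in real_distribution) cdf_attains:
  assumes "\<And>x. isCont (cdf M) x" "0 < p" "p < 1"
  obtains x where "cdf M x = p"
proof -
  obtain a where a: "cdf M a < p"
    using order_tendstoD(2)[OF cdf_lim_at_bot assms(2)] eventually_at_bot_linorder by (metis order_refl)
  obtain b where b: "p < cdf M b"
    using order_tendstoD(1)[OF cdf_lim_at_top_prob assms(3)] eventually_at_top_linorder by (metis order_refl)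
  have "a \<le> b" using a b cdf_nondecreasing[of b a] by (rule_tac ccontr) auto
  then show ?thesis
    using IVT[of "cdf M" a p b] a b assms(1) that by auto
qed

text \<open>Polya's theorem; the grid \<open>X\<close> in the proof consists of the quantiles of level \<open>i / q\<close>.\<close>

lemma (in real_distribution) uniform_cdf_convergence:
  fixes G :: "nat \<Rightarrow> real \<Rightarrow> real"
  assumes cont: "\<And>x. isCont (cdf M) x"
    and mono: "\<And>m x y. x \<le> y \<Longrightarrow> G m x \<le> G m y" and range: "\<And>m x. 0 \<le> G m x" "\<And>m x. G m x \<le> 1"
    and lim: "\<And>x. (\<lambda>m. G m x) \<longlonglongrightarrow> cdf M x" and \<epsilon>: "0 < \<epsilon>"
  shows "\<forall>\<^sub>F m in sequentially. \<forall>t. \<bar>G m t - cdf M t\<bar> < \<epsilon>"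
proof -
  \<comment> \<open>The error is below 3/q: the grid points used have levels within 2/q of the value
    at \<open>t\<close>, and the approximation at a grid point is within 1/q.\<close>
  obtain q :: nat where q: "3 / \<epsilon> < real q" using reals_Archimedean2 by blast
  then have q0: "0 < real q" using \<epsilon> by (meson divide_pos_pos less_trans zero_less_numeral)
  have q\<epsilon>: "3 / real q < \<epsilon>" using q q0 \<epsilon> by (simp add: field_simps)
  have "\<exists>x. cdf M x = real i / real q" if "i \<in> {1..<q}" for i
  proof -
    have "0 < real i / real q" "real i / real q < 1" using that q0 by auto
    then show ?thesis using cdf_attains[OF cont] by metis
  qed
  then obtain X where X: "\<And>i. i \<in> {1..<q} \<Longrightarrow> cdf M (X i) = real i / real q" by metis
  have "\<forall>\<^sub>F m in sequentially. \<forall>i\<in>{1..<q}. \<bar>G m (X i) - cdf M (X i)\<bar> < 1 / real q"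
  proof (intro eventually_ball_finite ballI)
    fix i show "\<forall>\<^sub>F m in sequentially. \<bar>G m (X i) - cdf M (X i)\<bar> < 1 / real q"
      using tendstoD[OF lim[of "X i"], of "1 / real q"] q0 by (simp add: dist_real_def)
  qed simp
  then show ?thesis
  proof (rule eventually_mono, intro allI)
    fix m t assume ev: "\<forall>i\<in>{1..<q}. \<bar>G m (X i) - cdf M (X i)\<bar> < 1 / real q"
    define i where "i = nat \<lfloor>real q * cdf M t\<rfloor>"
    have i1: "real i \<le> real q * cdf M t"
      unfolding i_def using q0 cdf_nonneg[of t] by (simp add: mult_nonneg_nonneg)
    have i2: "real q * cdf M t < real i + 1"
      unfolding i_def using q0 cdf_nonneg[of t] by (simp add: mult_nonneg_nonneg) 
    have i1': "real i / real q \<le> cdf M t" and i2': "cdf M t < real i / real q + 1 / real q"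
      using i1 i2 q0 by (simp_all add: field_simps)
    have low: "cdf M t - 3 / real q \<le> G m t"
    \<comment> \<open>There is no quantile of level (i-1)/q for i \<le> 1, but then the cdf at
      \<open>t\<close> is below 2/q and the bound is trivial. The case \<open>q \<le> i + 2\<close>
      is the counterpart at the upper end.\<close>
    proof (cases "i \<le> 1")
      case True
      then have "real i / real q \<le> 1 / real q" using q0 by (intro divide_right_mono) auto
      then have "cdf M t \<le> 3 / real q" using i2' q0 by (simp add: add_divide_distrib[symmetric] field_simps)
      then show ?thesis using range(1)[of m t] by linarith
    next
      case False
      have iq: "real i \<le> real q" using i1 cdf_bounded_prob[of t] q0 by (meson mult_left_le less_imp_le order_trans)
      have mem: "i - 1 \<in> {1..<q}" using False iq by auto
      \<comment> \<open>Level (i-1)/q and not i/q: strictness between the cdf values is what places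
        the quantile to the left of \<open>t\<close>.\<close>
      have "cdf M (X (i - 1)) < cdf M t"
        unfolding X[OF mem] using False q0
        by (intro less_le_trans[OF divide_strict_right_mono i1']) auto
      then have "X (i - 1) \<le> t" using cdf_nondecreasing[of t "X (i - 1)"] by (rule_tac ccontr) auto
      then have "G m (X (i - 1)) \<le> G m t" by (rule mono)
      moreover have "\<bar>G m (X (i - 1)) - real (i - 1) / real q\<bar> < 1 / real q" using bspec[OF ev mem] X[OF mem] by simp
      moreover have "real (i - 1) / real q = real i / real q - 1 / real q"
        using False by (simp add: of_nat_diff diff_divide_distrib)
      moreover have "3 / real q = 1 / real q + 1 / real q + 1 / real q" by simp
      ultimately show ?thesis using i2' by linarith
    qed
    have up: "G m t \<le> cdf M t + 3 / real q"
    proof (cases "q \<le> i + 2")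
      case True
      then have "real q / real q \<le> (real i + 2) / real q" using q0 by (intro divide_right_mono) auto
      then have "1 \<le> real i / real q + 2 / real q" using q0 by (simp add: add_divide_distrib)
      moreover have "2 / real q \<le> 3 / real q" using q0 by (simp add: divide_right_mono)
      ultimately have "1 \<le> cdf M t + 3 / real q" using i1' by linarith
      then show ?thesis using range(2)[of m t] by linarith
    next
      case False
      then have mem: "i + 2 \<in> {1..<q}" by auto
      have eq: "real (i + 2) / real q = real i / real q + 1 / real q + 1 / real q" by (simp add: add_divide_distrib)
      have "cdf M t < cdf M (X (i + 2))"
        unfolding X[OF mem] eq using i2' zero_less_divide_1_iff[of "real q"] q0 by linarith
      then have "t \<le> X (i + 2)" using cdf_nondecreasing[of "X (i + 2)" t] by (rule_tac ccontr) auto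
      then have "G m t \<le> G m (X (i + 2))" by (rule mono)
      moreover have "\<bar>G m (X (i + 2)) - real (i + 2) / real q\<bar> < 1 / real q" using bspec[OF ev mem] X[OF mem] by simp
      moreover have "3 / real q = 1 / real q + 1 / real q + 1 / real q" by simp
      ultimately show ?thesis using i1' eq by linarith
    qed
    show "\<bar>G m t - cdf M t\<bar> < \<epsilon>" using low up q\<epsilon> by linarith
  qed
qed

lemma isCont_cdf_std_normal: "isCont (cdf std_normal_distribution) x"
proof -
  interpret real_distribution std_normal_distribution by (rule real_dist_normal_dist)
  have "emeasure std_normal_distribution {x} = 0"
    by (subst emeasure_density) (auto intro!: nn_integral_null_set)
  then show ?thesis by (simp add: isCont_cdf measure_def)
qed

lemma real_distribution_return: "real_distribution (return borel (0::real))"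
  by (auto simp: real_distribution_def real_distribution_axioms_def prob_space_return)

text \<open>The constant 1 is the characteristic function of the point mass at 0, so Levy's theorem
  gives weak convergence to it; both -\<epsilon> and \<epsilon> are continuity points of its
  cdf.\<close>

lemma tendsto_in_prob_zero_of_char:
  fixes R :: "nat \<Rightarrow> 'a \<Rightarrow> real"
  assumes M: "\<And>m. prob_space (M m)" and R: "\<And>m. R m \<in> borel_measurable (M m)"
    and char: "\<And>t. (\<lambda>m. integral\<^sup>L (M m) (\<lambda>x. iexp (t * R m x))) \<longlonglongrightarrow> 1" and \<epsilon>: "0 < \<epsilon>"
  shows "(\<lambda>m. measure (M m) {x \<in> space (M m). \<epsilon> < \<bar>R m x\<bar>}) \<longlonglongrightarrow> 0"
proof -
  define D where "D m = distr (M m) borel (R m)" for m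
  interpret Z: real_distribution "return borel (0::real)" by (rule real_distribution_return)
  have "weak_conv_m D (return borel 0)"
  proof (rule levy_continuity)
    show "real_distribution (D m)" for m
      unfolding D_def using prob_space.real_distribution_distr[OF M R] .
    show "(\<lambda>m. char (D m) t) \<longlonglongrightarrow> char (return borel 0) t" for t
      using char[of t] R by (simp add: char_def D_def integral_distr integral_return)
  qed (rule real_distribution_return)
  then have lim: "(\<lambda>m. cdf (D m) x) \<longlonglongrightarrow> cdf (return borel 0) x" if "x \<noteq> 0" for x
    using that by (auto simp: weak_conv_m_def weak_conv_def Z.isCont_cdf measure_return)
  have "(\<lambda>m. cdf (D m) (- \<epsilon>) + (1 - cdf (D m) \<epsilon>)) \<longlonglongrightarrow> 0 + (1 - 1)"
    using lim[of "- \<epsilon>"] lim[of \<epsilon>] \<epsilon>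
    by (intro tendsto_add tendsto_diff tendsto_const) (auto simp: cdf_def measure_return)
  then have *: "(\<lambda>m. cdf (D m) (- \<epsilon>) + (1 - cdf (D m) \<epsilon>)) \<longlonglongrightarrow> 0" by simp
  have le: "measure (M m) {x \<in> space (M m). \<epsilon> < \<bar>R m x\<bar>} \<le> cdf (D m) (- \<epsilon>) + (1 - cdf (D m) \<epsilon>)" for m
  proof -
    interpret prob_space "M m" by (rule M)
    note [measurable] = R[of m]
    have c: "cdf (D m) y = prob {x \<in> space (M m). R m x \<le> y}" for y
      unfolding cdf_def D_def by (subst measure_distr) (auto intro!: arg_cong[where f=prob])
    have "prob {x \<in> space (M m). \<epsilon> < \<bar>R m x\<bar>} \<le>
        prob ({x \<in> space (M m). R m x \<le> - \<epsilon>} \<union> {x \<in> space (M m). \<not> R m x \<le> \<epsilon>})"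
      by (intro finite_measure_mono) auto
    also have "\<dots> \<le> prob {x \<in> space (M m). R m x \<le> - \<epsilon>} + prob {x \<in> space (M m). \<not> R m x \<le> \<epsilon>}"
      by (intro measure_Un_le) auto
    also have "prob {x \<in> space (M m). \<not> R m x \<le> \<epsilon>} = 1 - prob {x \<in> space (M m). R m x \<le> \<epsilon>}"
      by (intro prob_neg) auto
    finally show ?thesis by (simp add: c)
  qed
  show ?thesis
    by (rule tendsto_sandwich[OF _ _ tendsto_const *]) (use le in auto)
qed

lemma tendsto_prob_union:
  assumes "\<And>m. prob_space (M m)" "\<And>m. A m \<in> sets (M m)" "\<And>m. B m \<in> sets (M m)"
    and "\<forall>\<^sub>F m in sequentially. D m \<subseteq> A m \<union> B m"
    and "(\<lambda>m. measure (M m) (A m)) \<longlonglongrightarrow> 0" "(\<lambda>m. measure (M m) (B m)) \<longlonglongrightarrow> 0"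
  shows "(\<lambda>m. measure (M m) (D m)) \<longlonglongrightarrow> 0"
proof (rule tendsto_sandwich[OF _ _ tendsto_const])
  show "(\<lambda>m. measure (M m) (A m) + measure (M m) (B m)) \<longlonglongrightarrow> 0"
    using tendsto_add[OF assms(5,6)] by simp
  show "\<forall>\<^sub>F m in sequentially. measure (M m) (D m) \<le> measure (M m) (A m) + measure (M m) (B m)"
  proof (rule eventually_mono[OF assms(4)])
    fix m assume D: "D m \<subseteq> A m \<union> B m"
    interpret prob_space "M m" by (rule assms(1))
    have "prob (D m) \<le> prob (A m \<union> B m)" using assms(2,3) by (intro finite_measure_mono D) auto
    also have "\<dots> \<le> prob (A m) + prob (B m)" using assms(2,3) by (intro measure_Un_le)
    finally show "prob (D m) \<le> prob (A m) + prob (B m)" .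
  qed
qed simp

text \<open>The perturbations \<open>r\<close> and \<open>s\<close> are chosen pointwise off
  \<open>B\<close>; they serve only to include events in one another, so measurability is asked of
  \<open>B\<close> alone.\<close>

lemma slutsky_cdf:
  fixes W T :: "nat \<Rightarrow> 'a \<Rightarrow> real"
  assumes M: "\<And>m. prob_space (M m)" and WT: "\<And>m. W m \<in> borel_measurable (M m)" "\<And>m. T m \<in> borel_measurable (M m)"
    and lim: "\<And>t. (\<lambda>m. measure (M m) {x \<in> space (M m). W m x \<le> t}) \<longlonglongrightarrow> \<Phi> t"
    and cont: "\<And>t. isCont \<Phi> t"
    and approx: "\<And>\<eta>. 0 < \<eta> \<Longrightarrow> \<eta> < 1 \<Longrightarrow> \<exists>B. (\<forall>m. B m \<in> sets (M m)) \<and> (\<lambda>m. measure (M m) (B m)) \<longlonglongrightarrow> 0 \<and>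
      (\<forall>m. \<forall>x\<in>space (M m) - B m. \<exists>r s. \<bar>r\<bar> \<le> \<eta> \<and> \<bar>s - 1\<bar> \<le> \<eta> \<and> T m x = (W m x - r) / s)"
  shows "(\<lambda>m. measure (M m) {x \<in> space (M m). T m x \<le> t}) \<longlonglongrightarrow> \<Phi> t"
proof (rule tendstoI)
  fix \<epsilon> :: real assume \<epsilon>: "0 < \<epsilon>"
  obtain d where d: "0 < d" "\<And>y. dist y t < d \<Longrightarrow> dist (\<Phi> y) (\<Phi> t) < \<epsilon> / 3"
    using cont[of t] \<epsilon> unfolding continuous_at_eps_delta by (metis divide_pos_pos zero_less_numeral)
  \<comment> \<open>For s > 0, T \<le> t means W \<le> r + t s, which shifts the threshold by at
    most \<eta> (1 + |t|). The choice keeps this shift below \<open>d\<close>, and the bound 1/2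
    keeps \<open>s\<close> positive.\<close>
  define \<eta> where "\<eta> = min (1 / 2) (d / (2 * (1 + \<bar>t\<bar>)))"
  have \<eta>: "0 < \<eta>" "\<eta> < 1" using d(1) by (auto simp: \<eta>_def)
  define h where "h = \<eta> * (1 + \<bar>t\<bar>)"
  have "h \<le> d / (2 * (1 + \<bar>t\<bar>)) * (1 + \<bar>t\<bar>)" unfolding h_def \<eta>_def by (intro mult_right_mono) auto
  also have "\<dots> = d / 2" using abs_ge_zero[of t] by (simp add: field_simps add_nonneg_eq_0_iff)
  finally have h: "h < d" "0 < h" using d(1) \<eta> by (auto simp: h_def intro!: mult_pos_pos)
  obtain B where B: "\<And>m. B m \<in> sets (M m)" "(\<lambda>m. measure (M m) (B m)) \<longlonglongrightarrow> 0"
    "\<And>m x. x \<in> space (M m) - B m \<Longrightarrow> \<exists>r s. \<bar>r\<bar> \<le> \<eta> \<and> \<bar>s - 1\<bar> \<le> \<eta> \<and> T m x = (W m x - r) / s"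
    using approx[OF \<eta>] by blast
  have \<Phi>h: "\<bar>\<Phi> (t - h) - \<Phi> t\<bar> < \<epsilon> / 3" "\<bar>\<Phi> (t + h) - \<Phi> t\<bar> < \<epsilon> / 3"
    using d(2)[of "t - h"] d(2)[of "t + h"] h by (auto simp: dist_real_def)
  have iff: "(T m x \<le> t \<longrightarrow> W m x \<le> t + h) \<and> (W m x \<le> t - h \<longrightarrow> T m x \<le> t)"
    if x: "x \<in> space (M m) - B m" for m x
  proof -
    obtain r s where rs: "\<bar>r\<bar> \<le> \<eta>" "\<bar>s - 1\<bar> \<le> \<eta>" "T m x = (W m x - r) / s" using B(3)[OF x] by blast
    have s: "0 < s" using rs(2) \<eta> by linarith
    have "\<bar>t * (s - 1)\<bar> \<le> \<bar>t\<bar> * \<eta>" using rs(2) by (simp add: abs_mult mult_left_mono)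
    then have "\<bar>t * s - t\<bar> \<le> \<bar>t\<bar> * \<eta>" by (simp add: algebra_simps)
    moreover have "T m x \<le> t \<longleftrightarrow> W m x \<le> r + t * s" using s rs(3) by (simp add: divide_le_eq algebra_simps)
    moreover have "h = \<eta> + \<bar>t\<bar> * \<eta>" by (simp add: h_def algebra_simps)
    ultimately show ?thesis using rs(1) by linarith
  qed
  have "\<forall>\<^sub>F m in sequentially. dist (measure (M m) {x \<in> space (M m). W m x \<le> t - h}) (\<Phi> (t - h)) < \<epsilon> / 3"
    "\<forall>\<^sub>F m in sequentially. dist (measure (M m) {x \<in> space (M m). W m x \<le> t + h}) (\<Phi> (t + h)) < \<epsilon> / 3"
    "\<forall>\<^sub>F m in sequentially. dist (measure (M m) (B m)) 0 < \<epsilon> / 3"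
    using tendstoD[OF lim, of "\<epsilon> / 3"] tendstoD[OF B(2), of "\<epsilon> / 3"] \<epsilon> by auto
  then show "\<forall>\<^sub>F m in sequentially. dist (measure (M m) {x \<in> space (M m). T m x \<le> t}) (\<Phi> t) < \<epsilon>"
  proof eventually_elim
    case (elim m)
    interpret prob_space "M m" by (rule M)
    note [measurable] = WT[of m] B(1)[of m]
    have "prob {x \<in> space (M m). T m x \<le> t} \<le> prob ({x \<in> space (M m). W m x \<le> t + h} \<union> B m)"
      using iff by (intro finite_measure_mono) auto
    also have "\<dots> \<le> prob {x \<in> space (M m). W m x \<le> t + h} + prob (B m)" by (intro measure_Un_le) auto
    finally have 1: "prob {x \<in> space (M m). T m x \<le> t} \<le> prob {x \<in> space (M m). W m x \<le> t + h} + prob (B m)" .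
    have "prob {x \<in> space (M m). W m x \<le> t - h} \<le> prob ({x \<in> space (M m). T m x \<le> t} \<union> B m)"
      using iff by (intro finite_measure_mono) auto
    also have "\<dots> \<le> prob {x \<in> space (M m). T m x \<le> t} + prob (B m)" by (intro measure_Un_le) auto
    finally have 2: "prob {x \<in> space (M m). W m x \<le> t - h} \<le> prob {x \<in> space (M m). T m x \<le> t} + prob (B m)" .
    show ?case using 1 2 elim \<Phi>h unfolding dist_real_def by linarith
  qed
qed

section \<open>Studentised sums and their denominator\<close>

definition studentized :: "nat \<Rightarrow> (nat \<Rightarrow> real) \<Rightarrow> real" where
  "studentized n L = ((\<Sum>i\<in>{1..n}. L i) / sqrt (real n)) /
    sqrt ((\<Sum>i\<in>{1..n}. (L i)\<^sup>2) / real n - ((\<Sum>i\<in>{1..n}. L i) / real n)\<^sup>2)"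

text \<open>Scale invariance allows the residual weights to be replaced by the self-normalised ones,
  although the normalising factor is random.\<close>

lemma studentized_scale:
  assumes "0 < n" "0 < a"
  shows "studentized n (\<lambda>i. a * L i) =
    (\<Sum>i\<in>{1..n}. L i) / sqrt ((\<Sum>i\<in>{1..n}. (L i)\<^sup>2) - (\<Sum>i\<in>{1..n}. L i)\<^sup>2 / real n)"
proof -
  define S where "S = (\<Sum>i\<in>{1..n}. L i)"
  define V where "V = (\<Sum>i\<in>{1..n}. (L i)\<^sup>2)"
  have 1: "(\<Sum>i\<in>{1..n}. a * L i) = a * S" "(\<Sum>i\<in>{1..n}. (a * L i)\<^sup>2) = a\<^sup>2 * V"
    unfolding S_def V_def by (simp_all only: sum_distrib_left power_mult_distrib)
  have "a\<^sup>2 * V / real n - (a * S / real n)\<^sup>2 = a\<^sup>2 * (1 / real n) * (V - S\<^sup>2 / real n)"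
    using assms by (simp add: field_simps power2_eq_square)
  then have 2: "sqrt (a\<^sup>2 * V / real n - (a * S / real n)\<^sup>2) = a / sqrt (real n) * sqrt (V - S\<^sup>2 / real n)"
    using assms by (simp add: real_sqrt_mult real_sqrt_divide)
  have "studentized n (\<lambda>i. a * L i) = (a * S / sqrt (real n)) / (a / sqrt (real n) * sqrt (V - S\<^sup>2 / real n))"
    unfolding studentized_def 1 2 ..
  also have "\<dots> = S / sqrt (V - S\<^sup>2 / real n)"
    using assms by simp
  finally show ?thesis by (simp add: S_def V_def)
qed

lemma sqrt_near_one:
  fixes x :: real
  assumes "\<bar>x - 1\<bar> \<le> \<eta>" "\<eta> < 1"
  shows "\<bar>sqrt x - 1\<bar> \<le> \<eta>"
proof -
  have x: "0 \<le> x" using assms by linarith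
  have "\<bar>sqrt x - 1\<bar> * 1 \<le> \<bar>sqrt x - 1\<bar> * \<bar>sqrt x + 1\<bar>" using x by (intro mult_left_mono) auto
  also have "\<dots> = \<bar>x - 1\<bar>" using x by (simp only: abs_mult[symmetric]) (simp add: algebra_simps)
  finally have "\<bar>sqrt x - 1\<bar> \<le> \<bar>x - 1\<bar>" by simp
  then show ?thesis using assms(1) by (rule order_trans)
qed

text \<open>Expanding (e - b)^2, the four errors are \<eta> from the law of large numbers, \<eta> (2
  + 1/c) from the cross term, \<eta>/c from b^2 and 4 \<eta> from the squared mean; they sum to
  \<eta> (7 + 2/c). The squared mean is divided by n, so \<open>W\<close> need only be small
  compared with sqrt(n).\<close>

lemma variance_near_one:
  fixes w e v b :: "nat \<Rightarrow> real"
  assumes tot: "(\<Sum>j\<in>{1..n}. v j * (w j)\<^sup>2) = 1" and c: "0 < c" "\<And>j. c \<le> v j" and \<eta>: "0 < \<eta>" "\<eta> \<le> 1" and n: "0 < n"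
    and R: "\<bar>\<Sum>j\<in>{1..n}. (w j)\<^sup>2 * ((e j)\<^sup>2 - v j)\<bar> \<le> \<eta>"
    and b: "\<And>j. j \<in> {1..n} \<Longrightarrow> \<bar>b j\<bar> \<le> \<eta>"
    and \<rho>: "\<bar>\<Sum>j\<in>{1..n}. w j * b j\<bar> \<le> \<eta>"
    and W: "\<bar>\<Sum>j\<in>{1..n}. w j * e j\<bar> \<le> \<eta> * sqrt (real n)"
  shows "\<bar>(\<Sum>j\<in>{1..n}. (w j * (e j - b j))\<^sup>2) - (\<Sum>j\<in>{1..n}. w j * (e j - b j))\<^sup>2 / real n - 1\<bar> \<le> \<eta> * (7 + 2 / c)"
proof -
  define w2 where "w2 = (\<Sum>j\<in>{1..n}. (w j)\<^sup>2)"
  define R' where "R' = (\<Sum>j\<in>{1..n}. (w j)\<^sup>2 * ((e j)\<^sup>2 - v j))"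
  define X where "X = (\<Sum>j\<in>{1..n}. (w j)\<^sup>2 * (2 * e j * b j))"
  define Y where "Y = (\<Sum>j\<in>{1..n}. (w j)\<^sup>2 * (b j)\<^sup>2)"
  have e2: "(\<Sum>j\<in>{1..n}. (w j)\<^sup>2 * (e j)\<^sup>2) = 1 + R'"
    unfolding R'_def tot[symmetric] by (simp add: algebra_simps flip: sum.distrib)
  have "c * w2 \<le> (\<Sum>j\<in>{1..n}. v j * (w j)\<^sup>2)"
    unfolding w2_def sum_distrib_left using c by (intro sum_mono mult_right_mono) auto
  then have w2: "w2 \<le> 1 / c" using tot c by (simp add: field_simps)
  have w20: "0 \<le> w2" unfolding w2_def by (intro sum_nonneg) auto
  have "\<bar>X\<bar> \<le> (\<Sum>j\<in>{1..n}. \<eta> * ((w j)\<^sup>2 + (w j)\<^sup>2 * (e j)\<^sup>2))"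
    unfolding X_def
  proof (rule order_trans[OF sum_abs sum_mono])
    fix j assume j: "j \<in> {1..n}"
    \<comment> \<open>This bounds the cross term by the sums of w^2 and w^2 e^2, which are already
      controlled; w^2 has sum at most 1/c by the lower variance bound.\<close>
    have "2 * \<bar>e j\<bar> \<le> 1 + (e j)\<^sup>2" using sum_squares_bound[of 1 "\<bar>e j\<bar>"] by simp
    then have "2 * \<bar>e j\<bar> * \<bar>b j\<bar> \<le> (1 + (e j)\<^sup>2) * \<eta>" using b[OF j] by (intro mult_mono) auto
    then have "(w j)\<^sup>2 * (2 * \<bar>e j\<bar> * \<bar>b j\<bar>) \<le> (w j)\<^sup>2 * ((1 + (e j)\<^sup>2) * \<eta>)" by (intro mult_left_mono) auto
    then show "\<bar>(w j)\<^sup>2 * (2 * e j * b j)\<bar> \<le> \<eta> * ((w j)\<^sup>2 + (w j)\<^sup>2 * (e j)\<^sup>2)"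
      by (simp add: abs_mult algebra_simps)
  qed
  also have "\<dots> = \<eta> * (w2 + (1 + R'))"
    unfolding e2[symmetric] w2_def by (simp only: sum_distrib_left[symmetric] sum.distrib)
  also have "\<dots> \<le> \<eta> * (1 / c + 2)"
    using w2 R \<eta> by (intro mult_left_mono) (auto simp: R'_def)
  finally have X: "\<bar>X\<bar> \<le> \<eta> * (1 / c + 2)" .
  have "Y \<le> (\<Sum>j\<in>{1..n}. (w j)\<^sup>2 * \<eta>)"
    unfolding Y_def
  proof (intro sum_mono mult_left_mono)
    fix j assume j: "j \<in> {1..n}"
    have "(b j)\<^sup>2 \<le> \<eta>\<^sup>2" using b[OF j] by (simp add: abs_le_square_iff[symmetric])
    also have "\<dots> \<le> \<eta>" using \<eta> by (simp add: power2_eq_square mult_left_le)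
    finally show "(b j)\<^sup>2 \<le> \<eta>" .
  qed auto
  also have "\<dots> = w2 * \<eta>" unfolding w2_def by (simp only: sum_distrib_right)
  also have "\<dots> \<le> 1 / c * \<eta>" using w2 \<eta> by (intro mult_right_mono) auto
  finally have Y: "Y \<le> \<eta> * (1 / c)" by simp
  have Y0: "0 \<le> Y" unfolding Y_def by (intro sum_nonneg) auto
  define Z where "Z = (\<Sum>j\<in>{1..n}. w j * (e j - b j))"
  have sn: "1 \<le> sqrt (real n)" using n by simp
  have "Z = (\<Sum>j\<in>{1..n}. w j * e j) - (\<Sum>j\<in>{1..n}. w j * b j)"
    unfolding Z_def by (simp add: right_diff_distrib sum_subtractf)
  then have "\<bar>Z\<bar> \<le> \<eta> * sqrt (real n) + \<eta> * 1" using W \<rho> by linarith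
  also have "\<dots> \<le> \<eta> * sqrt (real n) + \<eta> * sqrt (real n)" using sn \<eta> by (intro add_left_mono mult_left_mono) auto
  finally have "\<bar>Z\<bar> \<le> \<bar>2 * \<eta> * sqrt (real n)\<bar>" using \<eta> by simp
  then have "Z\<^sup>2 \<le> (2 * \<eta> * sqrt (real n))\<^sup>2" by (simp only: abs_le_square_iff)
  also have "\<dots> = 4 * \<eta>\<^sup>2 * real n" by (simp add: power_mult_distrib)
  finally have "Z\<^sup>2 / real n \<le> 4 * \<eta>\<^sup>2" using n by (simp add: divide_le_eq)
  also have "\<dots> \<le> 4 * \<eta>" using \<eta> by (simp add: power2_eq_square mult_left_le)
  finally have Z: "Z\<^sup>2 / real n \<le> 4 * \<eta>" .
  have V: "(\<Sum>j\<in>{1..n}. (w j * (e j - b j))\<^sup>2) = (\<Sum>j\<in>{1..n}. (w j)\<^sup>2 * (e j)\<^sup>2) - X + Y"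
    unfolding X_def Y_def sum_subtractf[symmetric] sum.distrib[symmetric]
    by (intro sum.cong refl) (simp add: power2_eq_square algebra_simps)
  have "(\<Sum>j\<in>{1..n}. (w j * (e j - b j))\<^sup>2) - Z\<^sup>2 / real n - 1 = R' - X + Y - Z\<^sup>2 / real n"
    unfolding V e2 by simp
  moreover have "0 \<le> Z\<^sup>2 / real n" by simp
  moreover have "\<eta> * (7 + 2 / c) = \<eta> + \<eta> * (1 / c + 2) + \<eta> * (1 / c) + 4 * \<eta>"
    by (simp add: algebra_simps)
  moreover have "\<bar>R'\<bar> \<le> \<eta>" using R by (simp add: R'_def)
  ultimately show ?thesis unfolding Z_def[symmetric] using X Y Y0 Z by linarith
qed

text \<open>\<open>u\<close> are the residual weights, \<open>b\<close> the errors of the fitted conditional mean of the response.\<close>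

locale noise_array_sequence =
  fixes M :: "nat \<Rightarrow> 'a measure" and N :: "nat \<Rightarrow> nat" and F :: "nat \<Rightarrow> nat \<Rightarrow> 'a measure"
    and e v u b :: "nat \<Rightarrow> nat \<Rightarrow> 'a \<Rightarrow> real" and \<delta> c C :: real
  assumes arrays: "\<And>m. noise_array (M m) (N m) (F m) (e m) (v m) \<delta> c C"
    and N_pos: "\<And>m. 1 \<le> N m" and N_lim: "filterlim N at_top sequentially"
    and u_meas: "\<And>m j k. j \<in> {1..N m} \<Longrightarrow> k \<in> {1..N m} \<Longrightarrow> u m j \<in> borel_measurable (F m k)"
    and b_meas: "\<And>m j. j \<in> {1..N m} \<Longrightarrow> b m j \<in> borel_measurable (M m)"
    and u_nonzero: "(\<lambda>m. measure (M m) {x \<in> space (M m). (\<Sum>i\<in>{1..N m}. (u m i x)\<^sup>2) = 0}) \<longlonglongrightarrow> 0"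
    and u_small: "\<And>\<eta>. 0 < \<eta> \<Longrightarrow> (\<lambda>m. measure (M m) {x \<in> space (M m).
      \<not> (\<forall>j\<in>{1..N m}. \<bar>u m j x\<bar> \<le> \<eta> * sqrt (\<Sum>i\<in>{1..N m}. (u m i x)\<^sup>2))}) \<longlonglongrightarrow> 0"
    and b_small: "\<And>\<eta>. 0 < \<eta> \<Longrightarrow> (\<lambda>m. measure (M m) {x \<in> space (M m).
      \<not> (\<forall>j\<in>{1..N m}. \<bar>b m j x\<bar> \<le> \<eta>)}) \<longlonglongrightarrow> 0"
    and bias_small: "\<And>\<eta>. 0 < \<eta> \<Longrightarrow> (\<lambda>m. measure (M m) {x \<in> space (M m).
      \<not> \<bar>\<Sum>j\<in>{1..N m}. u m j x * b m j x\<bar> \<le> \<eta> * sqrt (\<Sum>i\<in>{1..N m}. (u m i x)\<^sup>2)}) \<longlonglongrightarrow> 0"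
begin

section \<open>Limit theorem along a sequence of arrays\<close>

sublocale arr: noise_array "M m" "N m" "F m" "e m" "v m" \<delta> c C for m
  by (rule arrays)

definition w :: "nat \<Rightarrow> nat \<Rightarrow> 'a \<Rightarrow> real" where
  "w m j x = self_norm (N m) (v m) (u m) j x"

definition W :: "nat \<Rightarrow> 'a \<Rightarrow> real" where
  "W m x = (\<Sum>j\<in>{1..N m}. w m j x * e m j x)"

definition R :: "nat \<Rightarrow> 'a \<Rightarrow> real" where
  "R m x = (\<Sum>j\<in>{1..N m}. (w m j x)\<^sup>2 * ((e m j x)\<^sup>2 - v m j x))"

definition good :: "real \<Rightarrow> nat \<Rightarrow> 'a set" where
  "good \<eta> m = {x \<in> space (M m). (\<Sum>i\<in>{1..N m}. v m i x * (u m i x)\<^sup>2) \<noteq> 0 \<and> (\<forall>j\<in>{1..N m}. \<bar>w m j x\<bar> \<le> \<eta>)}"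

lemma M_meas:
  assumes "j \<in> {1..N m}"
  shows "u m j \<in> borel_measurable (M m)" "v m j \<in> borel_measurable (M m)"
    "e m j \<in> borel_measurable (M m)" "w m j \<in> borel_measurable (M m)"
proof -
  show u: "u m j \<in> borel_measurable (M m)" using arr.F_meas[OF u_meas[OF assms assms] assms] .
  show "v m j \<in> borel_measurable (M m)" using arr.F_meas[OF arr.v_meas[OF assms assms] assms] .
  show "e m j \<in> borel_measurable (M m)" using arr.e_meas[OF assms] .
  show "w m j \<in> borel_measurable (M m)"
    unfolding w_def by (rule arr.F_meas[OF arr.self_norm_measurable[of _ "u m", OF u_meas assms assms] assms])
qed

lemma sums_meas [measurable]:
  "W m \<in> borel_measurable (M m)" "R m \<in> borel_measurable (M m)"
  "(\<lambda>x. \<Sum>i\<in>{1..N m}. (u m i x)\<^sup>2) \<in> borel_measurable (M m)"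
  "(\<lambda>x. \<Sum>i\<in>{1..N m}. v m i x * (u m i x)\<^sup>2) \<in> borel_measurable (M m)"
  "(\<lambda>x. \<Sum>i\<in>{1..N m}. u m i x * b m i x) \<in> borel_measurable (M m)"
  unfolding W_def R_def using M_meas b_meas
  by (auto intro!: borel_measurable_sum borel_measurable_times borel_measurable_diff borel_measurable_power)

lemma all_le_sets:
  fixes f :: "nat \<Rightarrow> 'a \<Rightarrow> real" and g :: "'a \<Rightarrow> real"
  assumes "\<And>j. j \<in> {1..N m} \<Longrightarrow> f j \<in> borel_measurable (M m)" "g \<in> borel_measurable (M m)"
  shows "{x \<in> space (M m). \<not> (\<forall>j\<in>{1..N m}. \<bar>f j x\<bar> \<le> g x)} \<in> sets (M m)"
proof (intro sets.sets_Collect_neg sets.sets_Collect_finite_All)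
  fix j assume "j \<in> {1..N m}"
  note [measurable] = assms(1)[OF this] assms(2)
  show "{x \<in> space (M m). \<bar>f j x\<bar> \<le> g x} \<in> sets (M m)" by measurable
qed simp

lemma weighted_sum_bounds:
  "0 \<le> (\<Sum>i\<in>{1..N m}. (u m i x)\<^sup>2)"
  "c * (\<Sum>i\<in>{1..N m}. (u m i x)\<^sup>2) \<le> (\<Sum>i\<in>{1..N m}. v m i x * (u m i x)\<^sup>2)"
  unfolding sum_distrib_left
  by (intro sum_nonneg zero_le_power2) (intro sum_mono mult_right_mono arr.v_lower zero_le_power2)

lemma weighted_sum_zero:
  "(\<Sum>i\<in>{1..N m}. v m i x * (u m i x)\<^sup>2) = 0 \<Longrightarrow> (\<Sum>i\<in>{1..N m}. (u m i x)\<^sup>2) = 0"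
  using weighted_sum_bounds[of m x] arr.params(3) by (simp add: mult_le_0_iff)

text \<open>The hypotheses are relative to the sum of u^2, the weights to the sum of v u^2, which is
  at least c times the former; the factor sqrt c accounts for the change. A zero denominator makes
  the quotient 0.\<close>

lemma self_norm_le:
  assumes "\<bar>y\<bar> \<le> (\<eta> * sqrt c) * sqrt (\<Sum>i\<in>{1..N m}. (u m i x)\<^sup>2)" "0 \<le> \<eta>"
  shows "\<bar>y / sqrt (\<Sum>i\<in>{1..N m}. v m i x * (u m i x)\<^sup>2)\<bar> \<le> \<eta>"
proof -
  define S where "S = (\<Sum>i\<in>{1..N m}. v m i x * (u m i x)\<^sup>2)"
  have "0 \<le> c * (\<Sum>i\<in>{1..N m}. (u m i x)\<^sup>2)" using weighted_sum_bounds(1)[of m x] arr.params(3) by simp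
  then have S: "0 \<le> S" using weighted_sum_bounds(2)[of m x] unfolding S_def by linarith
  have "\<bar>y\<bar> \<le> \<eta> * sqrt (c * (\<Sum>i\<in>{1..N m}. (u m i x)\<^sup>2))" using assms(1) by (simp add: real_sqrt_mult)
  also have "\<dots> \<le> \<eta> * sqrt S" unfolding S_def
    using assms(2) weighted_sum_bounds(2)[of m x] by (intro mult_left_mono real_sqrt_le_mono)
  finally show ?thesis
    using S assms(2) unfolding S_def[symmetric] by (cases "S = 0") (auto simp: divide_le_eq)
qed

lemma good_lim:
  assumes "0 < \<eta>"
  shows "(\<lambda>m. measure (M m) (space (M m) - good \<eta> m)) \<longlonglongrightarrow> 0"
proof (rule tendsto_prob_union[OF _ _ _ _ u_nonzero u_small[of "\<eta> * sqrt c"]])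
  show "prob_space (M m)" for m by (rule arr.prob_space_axioms)
  show "0 < \<eta> * sqrt c" using assms arr.params by simp
  show "{x \<in> space (M m). (\<Sum>i\<in>{1..N m}. (u m i x)\<^sup>2) = 0} \<in> sets (M m)" for m by measurable
  show "{x \<in> space (M m). \<not> (\<forall>j\<in>{1..N m}. \<bar>u m j x\<bar> \<le> \<eta> * sqrt c * sqrt (\<Sum>i\<in>{1..N m}. (u m i x)\<^sup>2))} \<in> sets (M m)" for m
    by (intro all_le_sets M_meas) measurable
  show "\<forall>\<^sub>F m in sequentially. space (M m) - good \<eta> m \<subseteq> {x \<in> space (M m). (\<Sum>i\<in>{1..N m}. (u m i x)\<^sup>2) = 0} \<union>
      {x \<in> space (M m). \<not> (\<forall>j\<in>{1..N m}. \<bar>u m j x\<bar> \<le> \<eta> * sqrt c * sqrt (\<Sum>i\<in>{1..N m}. (u m i x)\<^sup>2))}"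
  proof (intro always_eventually allI subsetI, rule ccontr)
    fix m x
    assume x: "x \<in> space (M m) - good \<eta> m"
      and n: "x \<notin> {x \<in> space (M m). (\<Sum>i\<in>{1..N m}. (u m i x)\<^sup>2) = 0} \<union>
      {x \<in> space (M m). \<not> (\<forall>j\<in>{1..N m}. \<bar>u m j x\<bar> \<le> \<eta> * sqrt c * sqrt (\<Sum>i\<in>{1..N m}. (u m i x)\<^sup>2))}"
    have "(\<Sum>i\<in>{1..N m}. v m i x * (u m i x)\<^sup>2) \<noteq> 0" using n x weighted_sum_zero[where m=m and x=x] by blast
    moreover have "\<bar>w m j x\<bar> \<le> \<eta>" if "j \<in> {1..N m}" for j
      unfolding w_def self_norm_def using n x that assms by (intro self_norm_le) auto
    ultimately show False using x by (auto simp: good_def)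
  qed
qed

text \<open>The level \<eta> is fixed first, making the bias term below \<epsilon>/2; only then does
  \<open>m\<close> grow, making the exceptional probability small at that level.\<close>

lemma tendsto_of_bounds:
  fixes X :: "nat \<Rightarrow> complex"
  assumes "\<And>m \<eta>. 0 < \<eta> \<Longrightarrow> \<eta> \<le> 1 \<Longrightarrow> cmod (X m - l) \<le> K * \<eta> powr \<delta> + 2 * measure (M m) (space (M m) - good \<eta> m)"
    and K: "0 \<le> K"
  shows "X \<longlonglongrightarrow> l"
proof (rule tendstoI)
  fix \<epsilon> :: real assume \<epsilon>: "0 < \<epsilon>"
  \<comment> \<open>Dividing by \<open>K + 1\<close> rather than \<open>K\<close> covers K = 0 and
    makes K y < \<epsilon>/2 strict.\<close>
  define y where "y = \<epsilon> / (2 * (K + 1))"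
  define \<eta> where "\<eta> = min 1 (y powr (1 / \<delta>))"
  have y: "0 < y" using \<epsilon> K by (simp add: y_def)
  have \<eta>: "0 < \<eta>" "\<eta> \<le> 1" using y by (auto simp: \<eta>_def)
  have "\<eta> powr \<delta> \<le> (y powr (1 / \<delta>)) powr \<delta>" using \<eta>(1) arr.params(1) unfolding \<eta>_def by (intro powr_mono2) auto
  also have "\<dots> = y" using y arr.params(1) by (simp add: powr_powr)
  finally have "K * \<eta> powr \<delta> \<le> K * y" using K by (rule mult_left_mono)
  also have "\<dots> < \<epsilon> / 2" using K \<epsilon> by (simp add: y_def field_simps)
  finally have 1: "K * \<eta> powr \<delta> < \<epsilon> / 2" .
  have "\<forall>\<^sub>F m in sequentially. measure (M m) (space (M m) - good \<eta> m) < \<epsilon> / 4"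
    using order_tendstoD(2)[OF good_lim[OF \<eta>(1)], of "\<epsilon> / 4"] \<epsilon> by simp
  then show "\<forall>\<^sub>F m in sequentially. dist (X m) l < \<epsilon>"
  proof eventually_elim
    case (elim m)
    then show ?case using assms(1)[OF \<eta>, of m] 1 by (simp add: dist_norm)
  qed
qed

lemma R_small:
  assumes "0 < \<epsilon>"
  shows "(\<lambda>m. measure (M m) {x \<in> space (M m). \<epsilon> < \<bar>R m x\<bar>}) \<longlonglongrightarrow> 0"
proof (rule tendsto_in_prob_zero_of_char[OF arr.prob_space_axioms sums_meas(2) _ assms])
  fix t
  show "(\<lambda>m. integral\<^sup>L (M m) (\<lambda>x. iexp (t * R m x))) \<longlonglongrightarrow> 1"
  proof (rule tendsto_of_bounds)
    show "cmod (integral\<^sup>L (M m) (\<lambda>x. iexp (t * R m x)) - 1)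
      \<le> (2 * \<bar>t\<bar> powr (1 + \<delta> / 2) * C / c + 2 * t\<^sup>2 * C) * \<eta> powr \<delta> + 2 * measure (M m) (space (M m) - good \<eta> m)"
      if "0 < \<eta>" "\<eta> \<le> 1" for m \<eta>
      unfolding R_def w_def good_def
      by (rule arr.char_self_norm_squares_bound[OF u_meas N_pos that])
    show "0 \<le> 2 * \<bar>t\<bar> powr (1 + \<delta> / 2) * C / c + 2 * t\<^sup>2 * C"
      using arr.C_pos arr.params by simp
  qed
qed

lemma W_cdf_lim: "(\<lambda>m. measure (M m) {x \<in> space (M m). W m x \<le> t}) \<longlonglongrightarrow> cdf std_normal_distribution t"
proof -
  have "weak_conv_m (\<lambda>m. distr (M m) borel (W m)) std_normal_distribution"
  proof (rule levy_continuity)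
    show "real_distribution (distr (M m) borel (W m))" for m
      by (rule arr.real_distribution_distr[OF sums_meas(1)])
    show "(\<lambda>m. char (distr (M m) borel (W m)) t) \<longlonglongrightarrow> char std_normal_distribution t" for t
      unfolding char_std_normal_distribution
    proof (rule tendsto_of_bounds)
      show "cmod (char (distr (M m) borel (W m)) t - of_real (exp (- (t\<^sup>2) / 2)))
        \<le> (\<bar>t\<bar> powr (2 + \<delta>) * C / c + t ^ 4 / 4 * C) * \<eta> powr \<delta> + 2 * measure (M m) (space (M m) - good \<eta> m)"
        if "0 < \<eta>" "\<eta> \<le> 1" for m \<eta>
      proof -
        have "char (distr (M m) borel (W m)) t = arr.expectation m (\<lambda>x. iexp (t * W m x))"
          unfolding char_def by (intro integral_distr sums_meas(1)) measurable
        then show ?thesis unfolding W_def w_def good_def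
          by (simp only: arr.char_self_norm_sum_bound[OF u_meas N_pos that])
      qed
      show "0 \<le> \<bar>t\<bar> powr (2 + \<delta>) * C / c + t ^ 4 / 4 * C"
        using arr.C_pos arr.params by simp
    qed
  qed (rule real_dist_normal_dist)
  then have "(\<lambda>m. cdf (distr (M m) borel (W m)) t) \<longlonglongrightarrow> cdf std_normal_distribution t"
    by (simp add: weak_conv_m_def weak_conv_def isCont_cdf_std_normal)
  moreover have "cdf (distr (M m) borel (W m)) t = measure (M m) {x \<in> space (M m). W m x \<le> t}" for m
    unfolding cdf_def by (subst measure_distr) (auto intro!: arg_cong[where f="measure (M m)"])
  ultimately show ?thesis by simp
qed

text \<open>Tightness, read off from the limit law: any fixed level \<open>K\<close> is eventually
  below a sqrt(N). It disposes of the squared mean inside the studentising denominator.\<close>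

lemma W_small:
  assumes a: "0 < a"
  shows "(\<lambda>m. measure (M m) {x \<in> space (M m). a * sqrt (real (N m)) < \<bar>W m x\<bar>}) \<longlonglongrightarrow> 0"
proof (rule tendstoI)
  fix \<epsilon> :: real assume \<epsilon>: "0 < \<epsilon>"
  interpret \<Phi>: real_distribution std_normal_distribution by (rule real_dist_normal_dist)
  let ?p = "\<lambda>m t. measure (M m) {x \<in> space (M m). W m x \<le> t}"
  have "\<forall>\<^sub>F x in at_top. 1 - \<epsilon> / 4 < cdf std_normal_distribution x"
    using \<epsilon> by (intro order_tendstoD(1)[OF \<Phi>.cdf_lim_at_top_prob]) simp
  then obtain K1 where K1: "\<And>x. K1 \<le> x \<Longrightarrow> 1 - \<epsilon> / 4 < cdf std_normal_distribution x"
    unfolding eventually_at_top_linorder by blast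
  have "\<forall>\<^sub>F x in at_bot. cdf std_normal_distribution x < \<epsilon> / 4"
    using \<epsilon> by (intro order_tendstoD(2)[OF \<Phi>.cdf_lim_at_bot]) simp
  then obtain K2 where K2: "\<And>x. x \<le> K2 \<Longrightarrow> cdf std_normal_distribution x < \<epsilon> / 4"
    unfolding eventually_at_bot_linorder by blast
  define K where "K = max K1 (- K2)"
  have K: "1 - \<epsilon> / 4 < cdf std_normal_distribution K" "cdf std_normal_distribution (- K) < \<epsilon> / 4"
    using K1[of K] K2[of "- K"] by (auto simp: K_def)
  have "filterlim (\<lambda>m. a * sqrt (real (N m))) at_top sequentially"
    by (rule filterlim_tendsto_pos_mult_at_top[OF tendsto_const a
      filterlim_compose[OF sqrt_at_top filterlim_compose[OF filterlim_real_sequentially N_lim]]])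
  then have "\<forall>\<^sub>F m in sequentially. K \<le> a * sqrt (real (N m))"
    by (simp add: filterlim_at_top)
  moreover have "\<forall>\<^sub>F m in sequentially. dist (?p m K) (cdf std_normal_distribution K) < \<epsilon> / 4"
    "\<forall>\<^sub>F m in sequentially. dist (?p m (- K)) (cdf std_normal_distribution (- K)) < \<epsilon> / 4"
    using tendstoD[OF W_cdf_lim, of "\<epsilon> / 4"] \<epsilon> by auto
  ultimately show "\<forall>\<^sub>F m in sequentially. dist (measure (M m) {x \<in> space (M m). a * sqrt (real (N m)) < \<bar>W m x\<bar>}) 0 < \<epsilon>"
  proof eventually_elim
    case (elim m)
    have "measure (M m) {x \<in> space (M m). a * sqrt (real (N m)) < \<bar>W m x\<bar>} \<le>
        measure (M m) ({x \<in> space (M m). W m x \<le> - K} \<union> {x \<in> space (M m). \<not> W m x \<le> K})"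
    proof (rule arr.finite_measure_mono)
      show "{x \<in> space (M m). a * sqrt (real (N m)) < \<bar>W m x\<bar>} \<subseteq>
          {x \<in> space (M m). W m x \<le> - K} \<union> {x \<in> space (M m). \<not> W m x \<le> K}"
      proof
        fix x assume x: "x \<in> {x \<in> space (M m). a * sqrt (real (N m)) < \<bar>W m x\<bar>}"
        then have "K < \<bar>W m x\<bar>" using elim(1) by simp
        then have "W m x \<le> - K \<or> \<not> W m x \<le> K" by linarith
        then show "x \<in> {x \<in> space (M m). W m x \<le> - K} \<union> {x \<in> space (M m). \<not> W m x \<le> K}"
          using x by blast
      qed
    qed measurable
    also have "\<dots> \<le> ?p m (- K) + measure (M m) {x \<in> space (M m). \<not> W m x \<le> K}"
      by (intro measure_Un_le) auto
    also have "measure (M m) {x \<in> space (M m). \<not> W m x \<le> K} = 1 - ?p m K"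
      by (intro arr.prob_neg) auto
    finally have "measure (M m) {x \<in> space (M m). a * sqrt (real (N m)) < \<bar>W m x\<bar>} < \<epsilon>"
      using elim(2,3) K unfolding dist_real_def abs_less_iff by linarith
    then show ?case by (simp only: dist_real_def diff_0_right abs_of_nonneg measure_nonneg)
  qed
qed

definition T :: "nat \<Rightarrow> 'a \<Rightarrow> real" where
  "T m x = studentized (N m) (\<lambda>j. (e m j x - b m j x) * u m j x)"

lemma T_meas: "T m \<in> borel_measurable (M m)"
proof -
  have [measurable]: "(\<lambda>x. \<Sum>j\<in>{1..N m}. (e m j x - b m j x) * u m j x) \<in> borel_measurable (M m)"
    "(\<lambda>x. \<Sum>j\<in>{1..N m}. ((e m j x - b m j x) * u m j x)\<^sup>2) \<in> borel_measurable (M m)"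
    by (intro borel_measurable_sum borel_measurable_times borel_measurable_diff borel_measurable_power M_meas b_meas; assumption)+
  show ?thesis unfolding T_def studentized_def by measurable
qed

text \<open>By scale invariance \<open>u\<close> may be replaced by \<open>w\<close>; then the
  numerator is \<open>W\<close> minus the bias \<open>r\<close>, and the denominator is near 1 by
  \<open>variance_near_one\<close>. The argument is pointwise because \<open>b\<close> may depend on
  all responses.\<close>

lemma T_near_W:
  assumes x: "x \<in> space (M m)" "(\<Sum>i\<in>{1..N m}. (u m i x)\<^sup>2) \<noteq> 0" and \<eta>: "0 < \<eta>" "\<eta> \<le> 1" "\<eta> * (7 + 2 / c) < 1"
    and R: "\<bar>R m x\<bar> \<le> \<eta>" and b: "\<And>j. j \<in> {1..N m} \<Longrightarrow> \<bar>b m j x\<bar> \<le> \<eta>"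
    and W: "\<bar>W m x\<bar> \<le> \<eta> * sqrt (real (N m))"
    and \<rho>: "\<bar>\<Sum>j\<in>{1..N m}. u m j x * b m j x\<bar> \<le> (\<eta> * sqrt c) * sqrt (\<Sum>i\<in>{1..N m}. (u m i x)\<^sup>2)"
  shows "\<exists>r s. \<bar>r\<bar> \<le> \<eta> \<and> \<bar>s - 1\<bar> \<le> \<eta> * (7 + 2 / c) \<and> T m x = (W m x - r) / s"
proof -
  define S where "S = (\<Sum>i\<in>{1..N m}. v m i x * (u m i x)\<^sup>2)"
  have S: "0 < S"
  proof -
    have "0 < c * (\<Sum>i\<in>{1..N m}. (u m i x)\<^sup>2)"
      using x(2) weighted_sum_bounds(1)[of m x] arr.params(3) by (intro mult_pos_pos) linarith+
    then show ?thesis unfolding S_def using weighted_sum_bounds(2)[of m x] by (rule less_le_trans)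
  qed
  have u: "u m j x = sqrt S * w m j x" for j unfolding w_def self_norm_def S_def[symmetric] using S by simp
  define r where "r = (\<Sum>j\<in>{1..N m}. w m j x * b m j x)"
  have "r = (\<Sum>j\<in>{1..N m}. u m j x * b m j x) / sqrt S"
    unfolding r_def w_def self_norm_def S_def by (simp add: sum_divide_distrib)
  then have r: "\<bar>r\<bar> \<le> \<eta>" using self_norm_le[OF \<rho>] \<eta> by (simp add: S_def)
  have tot: "(\<Sum>j\<in>{1..N m}. v m j x * (w m j x)\<^sup>2) = 1"
    unfolding w_def self_norm_total[of "v m" x "N m" "u m", OF arr.v_pos[THEN less_imp_le]] S_def[symmetric] using S by simp
  have "\<bar>(\<Sum>j\<in>{1..N m}. (w m j x * (e m j x - b m j x))\<^sup>2) - (\<Sum>j\<in>{1..N m}. w m j x * (e m j x - b m j x))\<^sup>2 / real (N m) - 1\<bar>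
      \<le> \<eta> * (7 + 2 / c)" (is "\<bar>?V - 1\<bar> \<le> _")
    by (rule variance_near_one[OF tot arr.params(3) arr.v_lower \<eta>(1,2)])
      (use N_pos[of m] R b W r in \<open>auto simp: R_def W_def r_def\<close>)
  then have s: "\<bar>sqrt ?V - 1\<bar> \<le> \<eta> * (7 + 2 / c)"
    using \<eta>(3) by (rule sqrt_near_one)
  define V where "V = ?V"
  have "T m x = studentized (N m) (\<lambda>j. sqrt S * (w m j x * (e m j x - b m j x)))"
    unfolding T_def u by (simp add: mult_ac)
  also have "\<dots> = (\<Sum>j\<in>{1..N m}. w m j x * (e m j x - b m j x)) / sqrt V"
    unfolding V_def using N_pos[of m] S by (intro studentized_scale) auto
  also have "(\<Sum>j\<in>{1..N m}. w m j x * (e m j x - b m j x)) = W m x - r"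
    unfolding W_def r_def by (simp add: right_diff_distrib sum_subtractf)
  finally show ?thesis using r s unfolding V_def[symmetric] by blast
qed

theorem T_cdf_lim: "(\<lambda>m. measure (M m) {x \<in> space (M m). T m x \<le> t}) \<longlonglongrightarrow> cdf std_normal_distribution t"
proof (rule slutsky_cdf[OF arr.prob_space_axioms sums_meas(1) T_meas W_cdf_lim isCont_cdf_std_normal])
  fix \<eta>' :: real assume \<eta>': "0 < \<eta>'" "\<eta>' < 1"
  \<comment> \<open>The factor by which \<open>variance_near_one\<close> enlarges the tolerance; the
    exceptional sets are therefore taken at level \<eta>' / K.\<close>
  define K where "K = 7 + 2 / c"
  have K: "1 \<le> K" using arr.params by (simp add: K_def)
  define \<eta> where "\<eta> = \<eta>' / K"
  have \<eta>K: "\<eta> * (7 + 2 / c) = \<eta>'" using K by (simp add: \<eta>_def K_def[symmetric])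
  have "\<eta>' * 1 \<le> \<eta>' * K" using K \<eta>' by (intro mult_left_mono) auto
  then have \<eta>: "0 < \<eta>" "\<eta> \<le> \<eta>'" using \<eta>' K by (auto simp: \<eta>_def divide_le_eq)
  then have \<eta>1: "\<eta> \<le> 1" using \<eta>' by simp
  have \<eta>c: "0 < \<eta> * sqrt c" using \<eta> arr.params by simp
  define B1 where "B1 m = {x \<in> space (M m). (\<Sum>i\<in>{1..N m}. (u m i x)\<^sup>2) = 0}" for m
  define B2 where "B2 m = {x \<in> space (M m). \<eta> < \<bar>R m x\<bar>}" for m
  define B3 where "B3 m = {x \<in> space (M m). \<not> (\<forall>j\<in>{1..N m}. \<bar>b m j x\<bar> \<le> \<eta>)}" for m
  define B4 where "B4 m = {x \<in> space (M m). \<eta> * sqrt (real (N m)) < \<bar>W m x\<bar>}" for m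
  define B5 where "B5 m = {x \<in> space (M m). \<not> \<bar>\<Sum>j\<in>{1..N m}. u m j x * b m j x\<bar> \<le>
      (\<eta> * sqrt c) * sqrt (\<Sum>i\<in>{1..N m}. (u m i x)\<^sup>2)}" for m
  have sets: "B1 m \<in> sets (M m)" "B2 m \<in> sets (M m)" "B3 m \<in> sets (M m)" "B4 m \<in> sets (M m)" "B5 m \<in> sets (M m)" for m
  proof -
    show "B1 m \<in> sets (M m)" unfolding B1_def by measurable
    show "B2 m \<in> sets (M m)" unfolding B2_def by measurable
    show "B3 m \<in> sets (M m)" unfolding B3_def by (intro all_le_sets b_meas) auto
    show "B4 m \<in> sets (M m)" unfolding B4_def by measurable
    show "B5 m \<in> sets (M m)" unfolding B5_def by measurable
  qed
  define B where "B m = B1 m \<union> (B2 m \<union> (B3 m \<union> (B4 m \<union> B5 m)))" for m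
  have un: "(\<lambda>m. measure (M m) (D m \<union> E m)) \<longlonglongrightarrow> 0"
    if "\<And>m. D m \<in> sets (M m)" "\<And>m. E m \<in> sets (M m)"
      "(\<lambda>m. measure (M m) (D m)) \<longlonglongrightarrow> 0" "(\<lambda>m. measure (M m) (E m)) \<longlonglongrightarrow> 0" for D E
    by (rule tendsto_prob_union[OF arr.prob_space_axioms that(1,2) always_eventually that(3,4)]) simp
  have "(\<lambda>m. measure (M m) (B4 m \<union> B5 m)) \<longlonglongrightarrow> 0"
    by (rule un[OF sets(4,5) W_small[OF \<eta>(1), folded B4_def] bias_small[OF \<eta>c, folded B5_def]])
  from un[OF sets(3) sets.Un[OF sets(4,5)] b_small[OF \<eta>(1), folded B3_def] this]
  have "(\<lambda>m. measure (M m) (B3 m \<union> (B4 m \<union> B5 m))) \<longlonglongrightarrow> 0" .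
  from un[OF sets(2) sets.Un[OF sets(3) sets.Un[OF sets(4,5)]] R_small[OF \<eta>(1), folded B2_def] this]
  have "(\<lambda>m. measure (M m) (B2 m \<union> (B3 m \<union> (B4 m \<union> B5 m)))) \<longlonglongrightarrow> 0" .
  from un[OF sets(1) sets.Un[OF sets(2) sets.Un[OF sets(3) sets.Un[OF sets(4,5)]]] u_nonzero[folded B1_def] this]
  have "(\<lambda>m. measure (M m) (B m)) \<longlonglongrightarrow> 0" unfolding B_def .
  moreover have "\<exists>r s. \<bar>r\<bar> \<le> \<eta>' \<and> \<bar>s - 1\<bar> \<le> \<eta>' \<and> T m x = (W m x - r) / s"
    if x: "x \<in> space (M m) - B m" for m x
  proof -
    have xM: "x \<in> space (M m)" and nB: "x \<notin> B1 m" "x \<notin> B2 m" "x \<notin> B3 m" "x \<notin> B4 m" "x \<notin> B5 m"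
      using x by (auto simp: B_def)
    have "\<exists>r s. \<bar>r\<bar> \<le> \<eta> \<and> \<bar>s - 1\<bar> \<le> \<eta> * (7 + 2 / c) \<and> T m x = (W m x - r) / s"
    proof (rule T_near_W[OF xM _ \<eta>(1) \<eta>1])
      show "\<eta> * (7 + 2 / c) < 1" using \<eta>'(2) by (simp only: \<eta>K)
      show "(\<Sum>i\<in>{1..N m}. (u m i x)\<^sup>2) \<noteq> 0" using nB(1) xM unfolding B1_def by blast
      show "\<bar>R m x\<bar> \<le> \<eta>" using nB(2) xM unfolding B2_def by (simp add: not_less)
      show "\<bar>b m j x\<bar> \<le> \<eta>" if "j \<in> {1..N m}" for j using nB(3) xM that unfolding B3_def by blast
      show "\<bar>W m x\<bar> \<le> \<eta> * sqrt (real (N m))" using nB(4) xM unfolding B4_def by (simp add: not_less)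
      show "\<bar>\<Sum>j\<in>{1..N m}. u m j x * b m j x\<bar> \<le> (\<eta> * sqrt c) * sqrt (\<Sum>i\<in>{1..N m}. (u m i x)\<^sup>2)"
        using nB(5) xM unfolding B5_def by blast
    qed
    then show ?thesis unfolding \<eta>K using order_trans[OF _ \<eta>(2)] by blast
  qed
  ultimately show "\<exists>B. (\<forall>m. B m \<in> sets (M m)) \<and> (\<lambda>m. measure (M m) (B m)) \<longlonglongrightarrow> 0 \<and>
      (\<forall>m. \<forall>x\<in>space (M m) - B m. \<exists>r s. \<bar>r\<bar> \<le> \<eta>' \<and> \<bar>s - 1\<bar> \<le> \<eta>' \<and> T m x = (W m x - r) / s)"
    using sets by (intro exI[of _ B] conjI allI ballI) (simp_all only: B_def sets.Un)
qed

text \<open>The threshold may vary with \<open>m\<close>, as it does along a sequence of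
  distributions and thresholds violating the uniform statement. Polya's theorem absorbs the
  variation.\<close>

corollary T_cdf_uniform_lim:
  "(\<lambda>m. measure (M m) {x \<in> space (M m). T m x \<le> t m} - cdf std_normal_distribution (t m)) \<longlonglongrightarrow> 0"
proof (rule tendstoI)
  fix \<epsilon> :: real assume \<epsilon>: "0 < \<epsilon>"
  interpret \<Phi>: real_distribution std_normal_distribution by (rule real_dist_normal_dist)
  note [measurable] = T_meas
  have "\<forall>\<^sub>F m in sequentially. \<forall>t. \<bar>measure (M m) {x \<in> space (M m). T m x \<le> t} - cdf std_normal_distribution t\<bar> < \<epsilon>"
    by (rule \<Phi>.uniform_cdf_convergence[OF isCont_cdf_std_normal _ _ _ T_cdf_lim \<epsilon>])
      (auto intro!: arr.finite_measure_mono)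
  then show "\<forall>\<^sub>F m in sequentially. dist (measure (M m) {x \<in> space (M m). T m x \<le> t m} - cdf std_normal_distribution (t m)) 0 < \<epsilon>"
    by eventually_elim simp
qed

end

section \<open>Responses and residuals of the algorithm\<close>

text \<open>Existence is the intermediate value theorem on [0, K], applied in \<open>ennreal\<close>
  because the value at 0 may be infinite; uniqueness is strict decrease. This is what makes the
  definite description in \<open>chat\<close> meaningful.\<close>

lemma reciprocal_sum_calibration:
  fixes s t :: "'i \<Rightarrow> real" and n :: nat
  assumes I: "finite I" and s: "\<And>i. i \<in> I \<Longrightarrow> 0 \<le> s i" and t: "\<And>i. i \<in> I \<Longrightarrow> 0 \<le> t i" and n: "1 \<le> n"
  defines "a \<equiv> \<lambda>c::real. (\<Sum>i\<in>I. ennreal (s i) / ennreal (t i + c)) / of_nat n"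
  assumes a0: "\<not> a 0 \<le> 1"
  shows "\<exists>!c. 0 \<le> c \<and> a c = 1"
proof (rule ex_ex1I)
  \<comment> \<open>Each quotient s/(t + K) is at most s/K, and the sum of the s is at most n K; the
    summand 1 keeps \<open>K\<close> positive.\<close>
  define K where "K = (\<Sum>i\<in>I. s i) / real n + 1"
  have n0: "(0::real) < real n" using n by simp
  have K: "0 < K" unfolding K_def using s n0 by (intro add_nonneg_pos divide_nonneg_pos sum_nonneg) auto
  have fin: "a c = ennreal ((\<Sum>i\<in>I. s i / (t i + c)) / real n)" if c: "0 < c" for c
  proof -
    have "(\<Sum>i\<in>I. ennreal (s i) / ennreal (t i + c)) = (\<Sum>i\<in>I. ennreal (s i / (t i + c)))"
      using s t c by (intro sum.cong divide_ennreal) (auto intro: add_nonneg_pos)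
    also have "\<dots> = ennreal (\<Sum>i\<in>I. s i / (t i + c))"
      using s t c by (intro sum_ennreal divide_nonneg_nonneg) (auto intro: add_nonneg_nonneg)
    finally have "a c = ennreal (\<Sum>i\<in>I. s i / (t i + c)) / ennreal (real n)"
      by (simp add: a_def ennreal_of_nat_eq_real_of_nat)
    also have "\<dots> = ennreal ((\<Sum>i\<in>I. s i / (t i + c)) / real n)"
      using s t c n0 by (intro divide_ennreal sum_nonneg divide_nonneg_nonneg) (auto intro: add_nonneg_nonneg)
    finally show ?thesis .
  qed
  have "a K \<le> 1"
  proof -
    have "(\<Sum>i\<in>I. s i / (t i + K)) \<le> (\<Sum>i\<in>I. s i / K)"
      using s t K by (intro sum_mono divide_left_mono) (auto intro!: mult_pos_pos add_nonneg_pos)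
    also have "\<dots> = (\<Sum>i\<in>I. s i) / K" by (simp add: sum_divide_distrib)
    also have "\<dots> \<le> real n"
      using K n0 by (simp add: divide_le_eq) (simp add: K_def algebra_simps)
    finally have "(\<Sum>i\<in>I. s i / (t i + K)) / real n \<le> 1" using n0 by simp
    then show ?thesis using ennreal_leI unfolding fin[OF K] by fastforce
  qed
  moreover have "1 \<le> a 0" using a0 by simp
  \<comment> \<open>This includes c = 0 with infinite terms: each quotient is a finite constant
    times an inverse, and inversion is continuous on all of \<open>ennreal\<close>.\<close>
  moreover have "continuous_on {0..K} a"
  proof -
    have "continuous_on {0..K} (\<lambda>c. ennreal (s i) * inverse (ennreal (t i + c)))" for i
      by (intro ennreal_continuous_on_cmult continuous_on_inverse_ennreal continuous_on_ennreal continuous_intros) auto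
    then have "continuous_on {0..K} (\<lambda>c. \<Sum>i\<in>I. ennreal (s i) * inverse (ennreal (t i + c)))"
      by (rule continuous_on_sum)
    moreover have "inverse (of_nat n :: ennreal) < top"
      using n by (simp add: less_top[symmetric] ennreal_inverse_eq_top_iff)
    ultimately have "continuous_on {0..K} (\<lambda>c. inverse (of_nat n) * (\<Sum>i\<in>I. ennreal (s i) * inverse (ennreal (t i + c))))"
      by (intro ennreal_continuous_on_cmult)
    then show ?thesis by (simp add: a_def divide_ennreal_def mult.commute)
  qed
  ultimately show "\<exists>c. 0 \<le> c \<and> a c = 1"
    using IVT2'[of a K 1 0] K by fastforce
  \<comment> \<open>Since a(0) > 1, a solution is positive, so both values are ordinary real sums.
    These sums equal n > 0, hence some \<open>s j\<close> is positive and the comparison is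
    strict.\<close>
  have less: False if c: "0 \<le> c" "a c = 1" and c': "a c' = 1" "c < c'" for c c'
  proof -
    have pos: "0 < c" using a0 c by (cases "c = 0") auto
    have g: "(\<Sum>i\<in>I. s i / (t i + c)) / real n = 1" if "0 < c" "a c = 1" for c
      using that(2) unfolding fin[OF that(1)] by (simp add: ennreal_eq_1)
    have "(\<Sum>i\<in>I. s i / (t i + c)) = real n" "(\<Sum>i\<in>I. s i / (t i + c')) = real n"
      using g[OF pos c(2)] g[OF _ c'(1)] pos c'(2) n0 by (auto simp: field_simps)
    note eqs = this
    obtain j where j: "j \<in> I" "0 < s j"
    proof -
      have "\<exists>i\<in>I. s i \<noteq> 0"
      proof (rule ccontr)
        assume "\<not> (\<exists>i\<in>I. s i \<noteq> 0)"
        then show False using eqs(1) n0 by simp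
      qed
      then show thesis using s that by (metis order_le_less)
    qed
    have "(\<Sum>i\<in>I. s i / (t i + c')) < (\<Sum>i\<in>I. s i / (t i + c))"
    proof (rule sum_strict_mono_ex1[OF I])
      show "\<forall>i\<in>I. s i / (t i + c') \<le> s i / (t i + c)"
        using s t pos c'(2) by (intro ballI divide_left_mono mult_pos_pos) (auto intro!: add_nonneg_pos)
      show "\<exists>i\<in>I. s i / (t i + c') < s i / (t i + c)"
        using j t pos c'(2)
        by (intro bexI[OF _ j(1)] divide_strict_left_mono mult_pos_pos) (auto intro!: add_nonneg_pos)
    qed
    then show False using eqs by simp
  qed
  show "c = c'" if "0 \<le> c \<and> a c = 1" "0 \<le> c' \<and> a c' = 1" for c c'
    using less[of c c'] less[of c' c] that by (meson linorder_neqE_linordered_idom)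
qed

lemma ennreal_inverse_antimono: "a \<le> b \<Longrightarrow> inverse b \<le> inverse (a :: ennreal)"
  by (cases a rule: ennreal_cases; cases b rule: ennreal_cases; cases "a = 0")
    (auto simp: inverse_ennreal less_le top_unique intro!: ennreal_leI le_imp_inverse_le)

lemma a_fun_antimono:
  assumes "0 \<le> c" "c \<le> c'"
  shows "a_fun A n w c' \<le> a_fun A n w c"
  unfolding a_fun_def
  unfolding divide_ennreal_def
  by (intro mult_right_mono sum_mono mult_left_mono ennreal_inverse_antimono ennreal_leI) (use assms in auto)

lemma a_fun_calibration:
  assumes "1 \<le> n" "\<not> a_fun A n w 0 \<le> 1"
  shows "\<exists>!c. 0 \<le> c \<and> a_fun A n w c = 1"
  unfolding a_fun_def
  by (rule reciprocal_sum_calibration) (use assms in \<open>auto simp: a_fun_def sqres_def\<close>)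

lemma chat_nonneg:
  assumes "1 \<le> n"
  shows "0 \<le> chat A n w"
  using theI'[OF a_fun_calibration[OF assms, of A w]] by (auto simp: chat_def)

text \<open>By monotonicity a definite description becomes a sublevel condition on
  \<open>a_fun\<close>, from which measurability of \<open>chat\<close> can be read off.\<close>

lemma chat_le_iff:
  assumes n: "1 \<le> n" and r: "0 \<le> r"
  shows "chat A n w \<le> r \<longleftrightarrow> a_fun A n w r \<le> 1"
proof (cases "a_fun A n w 0 \<le> 1")
  case True
  then show ?thesis using r a_fun_antimono[of 0 r A n w] by (auto simp: chat_def)
next
  case False
  have c: "0 \<le> chat A n w" "a_fun A n w (chat A n w) = 1"
    using theI'[OF a_fun_calibration[OF n False]] False by (simp_all add: chat_def)
  show ?thesis
  proof
    assume "chat A n w \<le> r"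
    then show "a_fun A n w r \<le> 1" using a_fun_antimono[OF c(1), of r A n w] c(2) by simp
  next
    assume le: "a_fun A n w r \<le> 1"
    show "chat A n w \<le> r"
    proof (rule ccontr)
      assume "\<not> chat A n w \<le> r"
      then have "1 \<le> a_fun A n w r" using a_fun_antimono[OF r, of "chat A n w" A n w] c(2) by simp
      then have "a_fun A n w r = 1" using le by simp
      then have "r = chat A n w" using a_fun_calibration[OF n False] c r by blast
      then show False using \<open>\<not> chat A n w \<le> r\<close> by simp
    qed
  qed
qed

section \<open>Outcomes with one response erased\<close>

definition erase_Y :: "nat \<Rightarrow> ('s, 'x) outcome \<Rightarrow> ('s, 'x) outcome" where
  "erase_Y k w = ((fst w)(k := (obsX (ob w k), 0, obsZ (ob w k))), snd w)"

lemma ob_erase_Y_other: "j \<noteq> k \<Longrightarrow> ob (erase_Y k w) j = ob w j"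
  by (simp add: ob_def erase_Y_def)

lemma obsXZ_erase_Y [simp]: "obsXZ (ob (erase_Y k w) j) = obsXZ (ob w j)"
  by (simp add: ob_def erase_Y_def obsXZ_def obsX_def obsZ_def)

lemma obsZ_erase_Y [simp]: "obsZ (ob (erase_Y k w) j) = obsZ (ob w j)"
  by (simp add: ob_def erase_Y_def obsX_def obsZ_def)

lemma seed_erase_Y [simp]: "seed (erase_Y k w) = seed w"
  by (simp add: seed_def erase_Y_def fun_eq_iff)

text \<open>Idempotence puts \<open>w\<close> and \<open>erase_Y k w\<close> in the same fibre of
  \<open>erase_Y k\<close>, so functions measurable with respect to the generated \<sigma>-algebra
  cannot distinguish them.\<close>

lemma erase_Y_idem: "erase_Y k (erase_Y k w) = erase_Y k w"
  by (simp add: ob_def erase_Y_def obsX_def obsZ_def)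

text \<open>Everything entering \<open>fhat\<close> is fitted on indices above \<open>n\<close>, and
  the regression for \<open>mfhat\<close> on the first sample has responses \<open>fhat\<close> and
  predictors \<open>Z\<close>; a first-sample response never enters.\<close>

lemma resid_f_erase_Y:
  assumes k: "k \<in> {1..n}"
  shows "resid_f A n (erase_Y k w) i = resid_f A n w i"
proof -
  let ?w = "erase_Y k w"
  have ob2: "ob ?w j = ob w j" if "n < j" for j using k that by (intro ob_erase_Y_other) auto
  have pairs2: "pairs2 n ?w R p = pairs2 n w R p" for R and p :: "'b obs \<Rightarrow> 'p"
    by (auto simp: pairs2_def ob2 fun_eq_iff restrict_def)
  have ghat: "ghat A n ?w = ghat A n w" by (simp add: ghat_def pairs2)
  have gtilde: "gtilde A n ?w = gtilde A n w" by (simp add: gtilde_def ghat pairs2 fun_eq_iff)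
  have mtilde: "mtilde A n ?w = mtilde A n w" by (simp add: mtilde_def gtilde pairs2)
  have htilde: "htilde A n ?w = htilde A n w" by (simp add: htilde_def gtilde mtilde fun_eq_iff)
  have rhohat: "rhohat A n ?w = rhohat A n w"
    unfolding rhohat_def ghat gtilde mtilde htilde by (intro arg_cong[where f="\<lambda>x. x / real n"] sum.cong) (auto simp: ob2)
  have sqres: "sqres A n ?w = sqres A n w" by (simp add: sqres_def ghat fun_eq_iff)
  have vtilde: "vtilde A n ?w = vtilde A n w" by (simp add: vtilde_def sqres pairs2)
  have "a_fun A n ?w c = a_fun A n w c" for c
    unfolding a_fun_def sqres vtilde by (intro arg_cong[where f="\<lambda>x. x / of_nat n"] sum.cong) (auto simp: ob2)
  then have chat: "chat A n ?w = chat A n w" by (simp add: chat_def)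
  have fhat: "fhat A n ?w = fhat A n w"
    by (simp add: fhat_def hhat_def vhat_def rhohat htilde vtilde chat fun_eq_iff)
  have "pairs_mf A n ?w = pairs_mf A n w"
    by (simp add: pairs_mf_def pairs1_def fhat cong: restrict_cong)
  then show ?thesis by (simp add: resid_f_def fhat mfhat_def)
qed

section \<open>Measurability of the fitted quantities\<close>

lemma measurable_fitting_app:
  assumes "measurable_fitting n S MP MQ r" "s \<in> N \<rightarrow>\<^sub>M S" "D \<in> N \<rightarrow>\<^sub>M pairs_space n MP" "q \<in> N \<rightarrow>\<^sub>M MQ"
  shows "(\<lambda>w. r (s w) (D w) (q w)) \<in> borel_measurable N"
proof -
  have "(\<lambda>w. (s w, D w, q w)) \<in> N \<rightarrow>\<^sub>M S \<Otimes>\<^sub>M (pairs_space n MP \<Otimes>\<^sub>M MQ)"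
    using assms(2-4) by measurable
  from measurable_compose[OF this assms(1)[unfolded measurable_fitting_def]] show ?thesis by simp
qed

locale pcm_setting =
  fixes n d :: nat and MX :: "'x measure" and Q :: "step \<Rightarrow> 's measure" and A :: "('s, 'x) pcm_methods"
    and P :: "'x obs measure"
  assumes n: "1 \<le> n" and P_prob: "prob_space P" and P_sets: "sets P = sets (obs_space MX d)"
    and Q_prob: "\<And>k. prob_space (Q k)" and methods: "measurable_methods n Q MX d A"
begin

definition \<mu> :: "('s, 'x) outcome measure" where
  "\<mu> = outcome_measure n Q P"

abbreviation "MXZ \<equiv> MX \<Otimes>\<^sub>M vec_space d"

lemma obs_measurable [measurable]:
  "obsX \<in> P \<rightarrow>\<^sub>M MX" "obsY \<in> borel_measurable P" "obsZ \<in> P \<rightarrow>\<^sub>M vec_space d" "obsXZ \<in> P \<rightarrow>\<^sub>M MXZ"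
  unfolding measurable_cong_sets[OF P_sets refl] obsX_def[abs_def] obsY_def[abs_def] obsZ_def[abs_def]
    obsXZ_def[abs_def] obs_space_def by measurable

lemma coord_measurable [measurable]: "j < d \<Longrightarrow> (\<lambda>z. z j) \<in> borel_measurable (vec_space d)"
  unfolding vec_space_def by measurable

lemma ob_measurable: "i \<in> {1..2*n} \<Longrightarrow> (\<lambda>w. ob w i) \<in> \<mu> \<rightarrow>\<^sub>M P"
  unfolding ob_def \<mu>_def outcome_measure_def by measurable

lemma seed_measurable [measurable]: "(\<lambda>w. seed w k) \<in> \<mu> \<rightarrow>\<^sub>M Q k"
  unfolding seed_def \<mu>_def outcome_measure_def by measurable

lemma ob_component_measurable:
  assumes "i \<in> {1..2*n}"
  shows "(\<lambda>w. obsX (ob w i)) \<in> \<mu> \<rightarrow>\<^sub>M MX" "(\<lambda>w. obsY (ob w i)) \<in> borel_measurable \<mu>"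
    "(\<lambda>w. obsZ (ob w i)) \<in> \<mu> \<rightarrow>\<^sub>M vec_space d" "(\<lambda>w. obsXZ (ob w i)) \<in> \<mu> \<rightarrow>\<^sub>M MXZ"
  using measurable_compose[OF ob_measurable[OF assms]] by (auto intro: obs_measurable)

lemma pairs2_measurable:
  assumes "\<And>i. i \<in> {n+1..2*n} \<Longrightarrow> (\<lambda>w. R w (ob w i)) \<in> borel_measurable \<mu>"
    and "\<And>i. i \<in> {n+1..2*n} \<Longrightarrow> (\<lambda>w. p (ob w i)) \<in> \<mu> \<rightarrow>\<^sub>M MP"
  shows "(\<lambda>w. pairs2 n w (R w) p) \<in> \<mu> \<rightarrow>\<^sub>M pairs_space n MP"
  unfolding pairs2_def pairs_space_def
  by (intro measurable_restrict measurable_Pair assms) auto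

lemma pairs1_measurable:
  assumes "\<And>i. i \<in> {1..n} \<Longrightarrow> (\<lambda>w. R w (ob w i)) \<in> borel_measurable \<mu>"
    and "\<And>i. i \<in> {1..n} \<Longrightarrow> (\<lambda>w. p (ob w i)) \<in> \<mu> \<rightarrow>\<^sub>M MP"
  shows "(\<lambda>w. pairs1 n w (R w) p) \<in> \<mu> \<rightarrow>\<^sub>M pairs_space n MP"
  unfolding pairs1_def pairs_space_def
  by (intro measurable_restrict measurable_Pair assms) auto

lemma methods_measurable:
  "measurable_fitting n (Q Step_g) MXZ MXZ (reg_g A)" "measurable_fitting n (Q Step_g) MXZ (vec_space d) (reg_g_Z A)"
  "measurable_fitting n (Q Step_mtilde) (vec_space d) (vec_space d) (reg_mtilde A)"
  "measurable_fitting n (Q Step_v) MXZ MXZ (reg_v A)"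
  "measurable_fitting n (Q Step_mf) (vec_space d) (vec_space d) (reg_mf A)"
  "measurable_fitting n (Q Step_m) (vec_space d) (vec_space d) (reg_m A)"
  using methods by (simp_all add: measurable_methods_def)

lemma ghat_measurable:
  assumes "q \<in> \<mu> \<rightarrow>\<^sub>M MXZ"
  shows "(\<lambda>w. ghat A n w (q w)) \<in> borel_measurable \<mu>"
  unfolding ghat_def
  by (intro measurable_fitting_app[OF methods_measurable(1)] seed_measurable pairs2_measurable assms
    ob_component_measurable) auto

lemma gtilde_measurable:
  assumes "q \<in> \<mu> \<rightarrow>\<^sub>M MXZ"
  shows "(\<lambda>w. gtilde A n w (q w)) \<in> borel_measurable \<mu>"
  unfolding gtilde_def
  by (intro borel_measurable_diff ghat_measurable measurable_fitting_app[OF methods_measurable(2)]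
    seed_measurable pairs2_measurable assms ob_component_measurable measurable_compose[OF assms measurable_snd]) auto

lemma mtilde_measurable:
  assumes "q \<in> \<mu> \<rightarrow>\<^sub>M vec_space d"
  shows "(\<lambda>w. mtilde A n w (q w)) \<in> borel_measurable \<mu>"
  unfolding mtilde_def
  by (intro measurable_fitting_app[OF methods_measurable(3)] seed_measurable pairs2_measurable gtilde_measurable assms
    ob_component_measurable) auto

lemma htilde_measurable:
  assumes "q \<in> \<mu> \<rightarrow>\<^sub>M MXZ"
  shows "(\<lambda>w. htilde A n w (q w)) \<in> borel_measurable \<mu>"
  unfolding htilde_def
  by (intro borel_measurable_diff gtilde_measurable mtilde_measurable assms measurable_compose[OF assms measurable_snd])

lemma rhohat_measurable [measurable]: "rhohat A n \<in> borel_measurable \<mu>"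
  unfolding rhohat_def[abs_def]
  by (intro borel_measurable_divide borel_measurable_sum borel_measurable_times borel_measurable_diff borel_measurable_add
    ob_component_measurable ghat_measurable gtilde_measurable mtilde_measurable htilde_measurable) auto

lemma sqres_measurable:
  assumes "i \<in> {1..2*n}"
  shows "(\<lambda>w. sqres A n w (ob w i)) \<in> borel_measurable \<mu>"
  unfolding sqres_def
  by (intro borel_measurable_power borel_measurable_diff ob_component_measurable ghat_measurable assms)

lemma vtilde_measurable:
  assumes "q \<in> \<mu> \<rightarrow>\<^sub>M MXZ"
  shows "(\<lambda>w. vtilde A n w (q w)) \<in> borel_measurable \<mu>"
  unfolding vtilde_def
  by (intro measurable_fitting_app[OF methods_measurable(4)] seed_measurable pairs2_measurable sqres_measurable assms
    ob_component_measurable) auto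

lemma chat_measurable [measurable]: "chat A n \<in> borel_measurable \<mu>"
  unfolding borel_measurable_iff_le
proof
  fix r :: real
  show "{w \<in> space \<mu>. chat A n w \<le> r} \<in> sets \<mu>"
  proof (cases "0 \<le> r")
    case True
    have "(\<lambda>w. ennreal (sqres A n w (ob w i)) / ennreal (max (vtilde A n w (obsXZ (ob w i))) 0 + r)) \<in> borel_measurable \<mu>"
      if "i \<in> {n+1..2*n}" for i
    proof -
      have i: "i \<in> {1..2*n}" using that by auto
      note [measurable] = sqres_measurable[OF i] vtilde_measurable[OF ob_component_measurable(4)[OF i]]
      show ?thesis by measurable
    qed
    then have [measurable]: "(\<lambda>w. a_fun A n w r) \<in> borel_measurable \<mu>"
      unfolding a_fun_def by (intro borel_measurable_divide_ennreal[OF borel_measurable_sum]) auto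
    have "{w \<in> space \<mu>. a_fun A n w r \<le> 1} \<in> sets \<mu>" by measurable
    then show ?thesis by (simp add: chat_le_iff[OF n True])
  next
    case False
    then have "{w \<in> space \<mu>. chat A n w \<le> r} = {}" using chat_nonneg[OF n] order_trans by blast
    then show ?thesis by (simp only: sets.empty_sets)
  qed
qed

lemma fhat_measurable:
  assumes "q \<in> \<mu> \<rightarrow>\<^sub>M MXZ"
  shows "(\<lambda>w. fhat A n w (q w)) \<in> borel_measurable \<mu>"
proof -
  note [measurable] = htilde_measurable[OF assms] vtilde_measurable[OF assms]
  show ?thesis unfolding fhat_def hhat_def vhat_def by measurable
qed

lemma resid_f_measurable:
  assumes i: "i \<in> {1..n}"
  shows "(\<lambda>w. resid_f A n w i) \<in> borel_measurable \<mu>"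
proof -
  have i2: "i \<in> {1..2*n}" using i by auto
  show ?thesis unfolding resid_f_def mfhat_def pairs_mf_def
    by (intro borel_measurable_diff measurable_fitting_app[OF methods_measurable(5)] seed_measurable pairs1_measurable fhat_measurable
    ob_component_measurable i2) auto
qed

lemma pairs_m_measurable [measurable]: "pairs_m n \<in> \<mu> \<rightarrow>\<^sub>M pairs_space n (vec_space d)"
  unfolding pairs_m_def[abs_def] by (intro pairs1_measurable ob_component_measurable) auto

lemma mhat_measurable:
  assumes "q \<in> \<mu> \<rightarrow>\<^sub>M vec_space d"
  shows "(\<lambda>w. mhat A n w (q w)) \<in> borel_measurable \<mu>"
  unfolding mhat_def
  by (intro measurable_fitting_app[OF methods_measurable(6)] seed_measurable pairs_m_measurable assms)

text \<open>The events that do not depend on the \<open>k\<close>-th response.\<close>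

definition F :: "nat \<Rightarrow> ('s, 'x) outcome measure" where
  "F k = vimage_algebra (space \<mu>) (erase_Y k) \<mu>"

lemma erase_Y_measurable:
  assumes k: "k \<in> {1..n}"
  shows "erase_Y k \<in> \<mu> \<rightarrow>\<^sub>M \<mu>"
proof -
  have i: "k \<in> {1..2*n}" using k by auto
  have 1: "(\<lambda>w. (obsX (ob w k), 0, obsZ (ob w k))) \<in> \<mu> \<rightarrow>\<^sub>M P"
  proof -
    note [measurable] = ob_component_measurable[OF i]
    show ?thesis unfolding measurable_cong_sets[OF refl P_sets] obs_space_def by measurable
  qed
  have 2: "fst \<in> \<mu> \<rightarrow>\<^sub>M PiM {1..2*n} (\<lambda>_. P)" "snd \<in> \<mu> \<rightarrow>\<^sub>M PiM UNIV Q"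
    unfolding \<mu>_def outcome_measure_def by measurable
  have "(\<lambda>w. (fst w)(k := (obsX (ob w k), 0, obsZ (ob w k)))) \<in> \<mu> \<rightarrow>\<^sub>M PiM {1..2*n} (\<lambda>_. P)"
    by (rule measurable_fun_upd[OF _ 2(1) 1]) (use i in auto)
  from measurable_Pair[OF this 2(2)] show ?thesis
    unfolding erase_Y_def[abs_def] by (simp add: \<mu>_def outcome_measure_def)
qed

lemma space_F [simp]: "space (F k) = space \<mu>"
  by (simp add: F_def)

lemma subalgebra_F: "k \<in> {1..n} \<Longrightarrow> subalgebra \<mu> (F k)"
  unfolding subalgebra_def F_def
  using sets_image_in_sets[OF refl erase_Y_measurable] by auto

text \<open>Invariance means that \<open>f\<close> factors through \<open>erase_Y k\<close>, which
  is measurable from \<open>F k\<close> by construction.\<close>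

lemma F_measurableI:
  assumes k: "k \<in> {1..n}" and f: "f \<in> borel_measurable \<mu>" "\<And>w. w \<in> space \<mu> \<Longrightarrow> f (erase_Y k w) = f w"
  shows "f \<in> borel_measurable (F k)"
proof -
  have "erase_Y k \<in> F k \<rightarrow>\<^sub>M \<mu>" unfolding F_def
    using measurable_space[OF erase_Y_measurable[OF k]] by (intro measurable_vimage_algebra1) auto
  from measurable_compose[OF this f(1)] show ?thesis
    by (rule measurable_cong[THEN iffD1, rotated]) (simp add: f(2))
qed

end

text \<open>A converse to factorisation: the level set of \<open>f\<close> through \<open>x\<close>
  is a preimage under \<open>g\<close>, so it contains the whole fibre of \<open>x\<close>.\<close>

lemma vimage_algebra_measurable_eq:
  fixes f :: "'a \<Rightarrow> real"
  assumes f: "f \<in> borel_measurable (vimage_algebra X g M)" and g: "g \<in> X \<rightarrow> space M"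
    and xy: "x \<in> X" "y \<in> X" "g x = g y"
  shows "f x = f y"
proof -
  have "f -` {f x} \<inter> X \<in> sets (vimage_algebra X g M)"
    using measurable_sets[OF f, of "{f x}"] by simp
  then obtain B where B: "f -` {f x} \<inter> X = g -` B \<inter> X" unfolding sets_vimage_algebra2[OF g] by blast
  have "x \<in> f -` {f x} \<inter> X" using xy(1) by simp
  then have "y \<in> g -` B \<inter> X" using xy unfolding B by simp
  then show ?thesis unfolding B[symmetric] by simp
qed

lemma integrable_bounded_mult_real:
  fixes f g :: "'a \<Rightarrow> real"
  assumes "integrable M g" "f \<in> borel_measurable M" "\<And>x. x \<in> space M \<Longrightarrow> \<bar>f x\<bar> \<le> b"
  shows "integrable M (\<lambda>x. f x * g x)"
proof -
  have "integrable M (\<lambda>x. complex_of_real (f x) * of_real (g x))"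
    by (rule integrable_bounded_mult[OF assms(1)]) (use assms(2,3) in auto)
  then show ?thesis by (simp only: of_real_mult[symmetric] complex_of_real_integrable_eq)
qed

section \<open>Transfer of conditional expectation identities to the sample\<close>

context pcm_setting
begin

abbreviation "FXZ \<equiv> sigma_XZ MX d"

lemma space_P: "space P = space (obs_space MX d)"
  using P_sets by (rule sets_eq_imp_space_eq)

lemma space_FXZ [simp]: "space FXZ = space P"
  by (simp add: sigma_XZ_def space_P)

lemma subalgebra_FXZ: "subalgebra P FXZ"
  unfolding subalgebra_def sigma_XZ_def
  using sets_image_in_sets[OF space_P obs_measurable(4)] by (simp add: space_P)

lemma obsXZ_FXZ: "obsXZ \<in> FXZ \<rightarrow>\<^sub>M MXZ"
  unfolding sigma_XZ_def using measurable_space[OF obs_measurable(4)]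
  by (intro measurable_vimage_algebra1) (auto simp: space_P)

lemma FXZ_measurable_eq:
  fixes f :: "'x obs \<Rightarrow> real"
  assumes "f \<in> borel_measurable FXZ" "v \<in> space P" "v' \<in> space P" "obsXZ v = obsXZ v'"
  shows "f v = f v'"
  using assms measurable_space[OF obs_measurable(4)] unfolding sigma_XZ_def
  by (intro vimage_algebra_measurable_eq[OF assms(1)[unfolded sigma_XZ_def]]) (auto simp: space_P)

lemma F_measurable_eq:
  fixes f :: "('s, 'x) outcome \<Rightarrow> real"
  assumes "k \<in> {1..n}" "f \<in> borel_measurable (F k)" "w \<in> space \<mu>"
  shows "f (erase_Y k w) = f w"
  using measurable_space[OF erase_Y_measurable[OF assms(1)]] assms(3)
  by (intro vimage_algebra_measurable_eq[OF assms(2)[unfolded F_def]]) (auto simp: erase_Y_idem)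

abbreviation "PI \<equiv> PiM {1..2*n} (\<lambda>_. P)"
abbreviation "QQ \<equiv> PiM UNIV Q"

lemma \<mu>_eq: "\<mu> = PI \<Otimes>\<^sub>M QQ"
  by (simp add: \<mu>_def outcome_measure_def)

lemma prob_PI: "prob_space PI" and prob_QQ: "prob_space QQ"
  using P_prob Q_prob by (auto intro!: prob_space_PiM)

lemma prob_\<mu>: "prob_space \<mu>"
  unfolding \<mu>_eq by (rule prob_space_pair[OF prob_PI prob_QQ])

lemma distr_ob:
  assumes "k \<in> {1..2*n}"
  shows "distr \<mu> P (\<lambda>w. ob w k) = P"
proof -
  have "distr \<mu> P (\<lambda>w. ob w k) = distr (distr \<mu> PI fst) P (\<lambda>f. f k)"
    unfolding \<mu>_eq ob_def using assms by (subst distr_distr) (auto simp: comp_def)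
  also have "distr \<mu> PI fst = PI"
    unfolding \<mu>_eq using prob_space.distr_pair_fst[OF prob_QQ] .
  also have "distr PI P (\<lambda>f. f k) = P"
    using distr_PiM_component[of "{1..2*n}" "\<lambda>_. P" k] P_prob assms by simp
  finally show ?thesis .
qed

lemma integrable_ob:
  fixes g :: "'x obs \<Rightarrow> real"
  assumes "k \<in> {1..2*n}" "integrable P g"
  shows "integrable \<mu> (\<lambda>w. g (ob w k))"
  using assms integrable_distr_eq[OF ob_measurable[OF assms(1)], of g] by (auto simp: distr_ob)

text \<open>Fubini's theorem with the k-th observation innermost: the product measure is the image
  of \<open>P\<close> times the product over the remaining indices under insertion of the k-th
  coordinate.\<close>

lemma integral_resample:
  fixes g :: "'x obs \<Rightarrow> real" and H :: "('s, 'x) outcome \<Rightarrow> real"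
  assumes k: "k \<in> {1..2*n}" and g: "integrable P g"
    and H: "H \<in> borel_measurable \<mu>" "\<And>w. w \<in> space \<mu> \<Longrightarrow> \<bar>H w\<bar> \<le> b"
  shows "(\<integral>w. H w * g (ob w k) \<partial>\<mu>) =
    (\<integral>s. (\<integral>X. (\<integral>v. H (X(k := v), s) * g v \<partial>P) \<partial>PiM ({1..2*n} - {k}) (\<lambda>_. P)) \<partial>QQ)"
proof -
  let ?J = "{1..2*n} - {k}"
  let ?PJ = "PiM ?J (\<lambda>_. P)"
  interpret P: prob_space P by (rule P_prob)
  interpret PI: prob_space PI by (rule prob_PI)
  interpret QQ: prob_space QQ by (rule prob_QQ)
  interpret PJ: prob_space ?PJ using P_prob by (intro prob_space_PiM)
  interpret PIQ: pair_sigma_finite PI QQ ..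
  interpret PPJ: pair_sigma_finite P ?PJ ..
  have ins: "insert k ?J = {1..2*n}" using k by auto
  have int: "integrable \<mu> (\<lambda>w. H w * g (ob w k))"
    by (rule integrable_bounded_mult_real[OF integrable_ob[OF k g] H])
  have inner: "(\<integral>f. H (f, s) * g (f k) \<partial>PI) = (\<integral>X. (\<integral>v. H (X(k := v), s) * g v \<partial>P) \<partial>?PJ)"
    if s: "s \<in> space QQ" for s
  proof -
    have Hs: "(\<lambda>f. H (f, s)) \<in> borel_measurable PI"
      using H(1) s unfolding \<mu>_eq by measurable
    have Hb: "\<bar>H (f, s)\<bar> \<le> b" if "f \<in> space PI" for f
      using H(2)[of "(f, s)"] that s by (simp add: \<mu>_eq space_pair_measure)
    have "integrable PI (\<lambda>f. g (f k))"
      using g k P_prob integrable_distr_eq[of "\<lambda>f. f k" PI P g] distr_PiM_component[of "{1..2*n}" "\<lambda>_. P" k]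
      by auto
    then have i: "integrable PI (\<lambda>f. H (f, s) * g (f k))"
      by (rule integrable_bounded_mult_real[OF _ Hs Hb])
    have upd: "(\<lambda>(v, X). X(k := v)) \<in> P \<Otimes>\<^sub>M ?PJ \<rightarrow>\<^sub>M PI"
      unfolding case_prod_beta by (rule measurable_fun_upd[where J="?J"]) (use ins in auto)
    have d: "distr (P \<Otimes>\<^sub>M ?PJ) PI (\<lambda>(v, X). X(k := v)) = PI"
      using distr_pair_PiM_eq_PiM[of ?J "\<lambda>_. P" k] P_prob unfolding ins by simp
    have "(\<integral>f. H (f, s) * g (f k) \<partial>PI) = (\<integral>f. H (f, s) * g (f k) \<partial>distr (P \<Otimes>\<^sub>M ?PJ) PI (\<lambda>(v, X). X(k := v)))"
      by (simp only: d)
    also have "\<dots> = (\<integral>(v, X). H (X(k := v), s) * g v \<partial>(P \<Otimes>\<^sub>M ?PJ))"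
      by (subst integral_distr[OF upd borel_measurable_integrable[OF i]]) (simp add: case_prod_beta')
    also have "\<dots> = (\<integral>X. (\<integral>v. H (X(k := v), s) * g v \<partial>P) \<partial>?PJ)"
    proof (rule PPJ.integral_snd[symmetric])
      show "integrable (P \<Otimes>\<^sub>M ?PJ) (\<lambda>(v, X). H (X(k := v), s) * g v)"
        using i integrable_distr_eq[OF upd borel_measurable_integrable[OF i]] unfolding d
        by (simp add: case_prod_beta')
    qed
    finally show ?thesis .
  qed
  have "(\<integral>w. H w * g (ob w k) \<partial>\<mu>) = (\<integral>(f, s). H (f, s) * g (f k) \<partial>(PI \<Otimes>\<^sub>M QQ))"
    unfolding \<mu>_eq ob_def by (simp add: case_prod_beta')
  also have "\<dots> = (\<integral>s. (\<integral>f. H (f, s) * g (f k) \<partial>PI) \<partial>QQ)"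
    by (rule PIQ.integral_snd[symmetric]) (use int in \<open>simp add: \<mu>_eq ob_def case_prod_beta'\<close>)
  also have "\<dots> = (\<integral>s. (\<integral>X. (\<integral>v. H (X(k := v), s) * g v \<partial>P) \<partial>?PJ) \<partial>QQ)"
    by (intro Bochner_Integration.integral_cong refl inner)
  finally show ?thesis .
qed

text \<open>With seeds and other observations fixed, \<open>H\<close> is a bounded function of the
  k-th observation that is measurable with respect to \<sigma>(X,Z). An identity under
  \<open>P\<close> against such test functions thus holds in the innermost integral and survives the
  outer ones.\<close>

lemma integral_F_eq:
  fixes g g' :: "'x obs \<Rightarrow> real" and H :: "('s, 'x) outcome \<Rightarrow> real"
  assumes k: "k \<in> {1..n}" and g: "integrable P g" "integrable P g'"
    and eq: "\<And>h b. h \<in> borel_measurable FXZ \<Longrightarrow> (\<And>v. v \<in> space P \<Longrightarrow> \<bar>h v\<bar> \<le> b) \<Longrightarrow>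
      (\<integral>v. h v * g v \<partial>P) = (\<integral>v. h v * g' v \<partial>P)"
    and H: "H \<in> borel_measurable (F k)" "\<And>w. w \<in> space \<mu> \<Longrightarrow> \<bar>H w\<bar> \<le> b"
  shows "(\<integral>w. H w * g (ob w k) \<partial>\<mu>) = (\<integral>w. H w * g' (ob w k) \<partial>\<mu>)"
proof -
  let ?J = "{1..2*n} - {k}"
  let ?PJ = "PiM ?J (\<lambda>_. P)"
  have k2: "k \<in> {1..2*n}" using k by auto
  have J: "{1..2*n} = ?J \<union> {k}" using k2 by auto
  have HM: "H \<in> borel_measurable \<mu>" using measurable_from_subalg[OF subalgebra_F[OF k] H(1)] .
  have inner: "(\<integral>v. H (X(k := v), s) * g v \<partial>P) = (\<integral>v. H (X(k := v), s) * g' v \<partial>P)"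
    if s: "s \<in> space QQ" and X: "X \<in> space ?PJ" for s X
  proof (rule eq)
    have mem: "(X(k := v), s) \<in> space \<mu>" if "v \<in> space P" for v
      using that s X k2 by (auto simp: \<mu>_eq space_pair_measure space_PiM PiE_iff extensional_def)
    show "\<bar>H (X(k := v), s)\<bar> \<le> b" if "v \<in> space P" for v using H(2)[OF mem[OF that]] .
    have XP: "(\<lambda>_. X) \<in> MXZ \<rightarrow>\<^sub>M ?PJ" using X by simp
    \<comment> \<open>Inserting the response 0 gives a function of (X,Z) alone; invariance of
      \<open>H\<close> under \<open>erase_Y k\<close> identifies it with the value at the actual
      response.\<close>
    have "(\<lambda>q. (fst q, 0, snd q)) \<in> MXZ \<rightarrow>\<^sub>M P"
      unfolding measurable_cong_sets[OF refl P_sets] obs_space_def by measurable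
    then have "(\<lambda>q. X(k := (fst q, 0, snd q))) \<in> MXZ \<rightarrow>\<^sub>M PI"
      by (rule measurable_fun_upd[OF J XP])
    then have "(\<lambda>q. (X(k := (fst q, 0, snd q)), s)) \<in> MXZ \<rightarrow>\<^sub>M \<mu>"
      unfolding \<mu>_eq using s by measurable
    from measurable_compose[OF measurable_compose[OF obsXZ_FXZ this] HM]
    have meas: "(\<lambda>v. H (X(k := (obsX v, 0, obsZ v)), s)) \<in> borel_measurable FXZ" by (simp add: obsXZ_def)
    have eqH: "H (X(k := (obsX v, 0, obsZ v)), s) = H (X(k := v), s)" if "v \<in> space P" for v
      using F_measurable_eq[OF k H(1) mem[OF that]] by (simp add: erase_Y_def ob_def)
    show "(\<lambda>v. H (X(k := v), s)) \<in> borel_measurable FXZ"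
      by (rule measurable_cong[THEN iffD1, OF _ meas]) (simp add: eqH)
  qed
  have "(\<integral>s. (\<integral>X. (\<integral>v. H (X(k := v), s) * g v \<partial>P) \<partial>?PJ) \<partial>QQ) =
      (\<integral>s. (\<integral>X. (\<integral>v. H (X(k := v), s) * g' v \<partial>P) \<partial>?PJ) \<partial>QQ)"
    by (rule Bochner_Integration.integral_cong[OF refl], rule Bochner_Integration.integral_cong[OF refl], rule inner)
  then show ?thesis
    using integral_resample[OF k2 g(1) HM H(2)] integral_resample[OF k2 g(2) HM H(2)] by simp
qed

end

section \<open>Conditional moments of the noise and the resulting array\<close>

locale pcm_noise = pcm_setting n d MX Q A P
  for n d :: nat and MX :: "'x measure" and Q :: "step \<Rightarrow> 's measure" and A :: "('s, 'x) pcm_methods"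
    and P :: "'x obs measure" +
  fixes \<gamma> :: rvec and \<delta> c C :: real
  assumes \<epsilon>_int: "integrable P (noise d \<gamma>)"
    and \<epsilon>_mean: "AE v in P. real_cond_exp P FXZ (noise d \<gamma>) v = 0"
    and constants: "0 < \<delta>" "0 < c" "0 < C"
    and lower: "AE v in P. ennreal c \<le> nn_cond_exp P FXZ (\<lambda>v. ennreal ((noise d \<gamma> v)\<^sup>2)) v"
    and upper: "AE v in P. nn_cond_exp P FXZ (\<lambda>v. ennreal (\<bar>noise d \<gamma> v\<bar> powr (2 + \<delta>))) v \<le> ennreal C"
begin

abbreviation "\<epsilon> \<equiv> noise d \<gamma>"

text \<open>The Taylor bounds ask for an exponent at most 1; lowering \<delta> is paid for by
  replacing \<open>C\<close> with \<open>1 + C\<close>.\<close>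

definition \<delta>' :: real where "\<delta>' = min \<delta> 1"

text \<open>A version of the conditional variance clipped to [c, 1 + C]: the array asks for bounds
  at every point, the hypotheses give them almost surely. \<open>mom\<close> is clipped from above
  for the same reason.\<close>

definition var :: "'x obs \<Rightarrow> real" where
  "var v = max c (min (1 + C) (real_cond_exp P FXZ (\<lambda>v. (\<epsilon> v)\<^sup>2) v))"

definition mom :: "'x obs \<Rightarrow> real" where
  "mom v = min (1 + C) (real_cond_exp P FXZ (\<lambda>v. \<bar>\<epsilon> v\<bar> powr (2 + \<delta>')) v)"

lemma \<epsilon>_measurable [measurable]: "\<epsilon> \<in> borel_measurable P"
  using \<epsilon>_int by (rule borel_measurable_integrable)

sublocale P: prob_space P by (rule P_prob)

sublocale finite_measure_subalgebra P FXZ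
  by unfold_locales (rule subalgebra_FXZ)

text \<open>The conditional expectation of the dominating function is at most 1 + C by the moment
  hypothesis. Working with nonnegative conditional expectations lets integrability of
  \<open>f\<close> come out as a conclusion, by integrating that bound.\<close>

lemma cond_exp_bounded_by_moment:
  assumes f: "f \<in> borel_measurable P" "\<And>v. 0 \<le> f v" "\<And>v. f v \<le> 1 + \<bar>\<epsilon> v\<bar> powr (2 + \<delta>)"
  shows "AE v in P. nn_cond_exp P FXZ (\<lambda>v. ennreal (f v)) v \<le> ennreal (1 + C)"
    and "integrable P f"
    and "AE v in P. real_cond_exp P FXZ f v = enn2real (nn_cond_exp P FXZ (\<lambda>v. ennreal (f v)) v)"
proof -
  note [measurable] = f(1)
  let ?p = "\<lambda>v. ennreal (\<bar>\<epsilon> v\<bar> powr (2 + \<delta>))"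
  have "AE v in P. nn_cond_exp P FXZ (\<lambda>v. ennreal (f v)) v \<le> nn_cond_exp P FXZ (\<lambda>v. 1 + ?p v) v"
    using f(3)
    by (intro nn_cond_exp_mono AE_I2) (auto simp: ennreal_plus[symmetric] ennreal_1[symmetric] simp del: ennreal_plus ennreal_1 intro!: ennreal_leI)
  moreover have "AE v in P. nn_cond_exp P FXZ (\<lambda>_. 1) v + nn_cond_exp P FXZ ?p v = nn_cond_exp P FXZ (\<lambda>v. 1 + ?p v) v"
    by (intro nn_cond_exp_sum) auto
  moreover have "AE v in P. 1 = nn_cond_exp P FXZ (\<lambda>_. 1) v"
    by (intro nn_cond_exp_F_meas) auto
  ultimately show *: "AE v in P. nn_cond_exp P FXZ (\<lambda>v. ennreal (f v)) v \<le> ennreal (1 + C)"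
    using upper
  proof eventually_elim
    case (elim v)
    have "nn_cond_exp P FXZ (\<lambda>v. ennreal (f v)) v \<le> 1 + nn_cond_exp P FXZ ?p v"
      using elim(1) unfolding elim(2)[symmetric] elim(3)[symmetric] .
    also have "\<dots> \<le> 1 + ennreal C" using elim(4) by (intro add_left_mono)
    finally show ?case using constants by (simp add: ennreal_plus)
  qed
  have "(\<integral>\<^sup>+v. ennreal (f v) \<partial>P) = (\<integral>\<^sup>+v. 1 * nn_cond_exp P FXZ (\<lambda>v. ennreal (f v)) v \<partial>P)"
    by (subst nn_cond_exp_intg) auto
  also have "\<dots> \<le> (\<integral>\<^sup>+v. ennreal (1 + C) \<partial>P)"
    using * by (intro nn_integral_mono_AE) simp
  also have "\<dots> < \<infinity>" by (simp add: P.emeasure_space_1)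
  finally show "integrable P f"
    using f(2) by (intro integrableI_nonneg) auto
  \<comment> \<open>\<open>real_cond_exp\<close> is a difference of positive and negative parts; the
    negative part of \<open>f\<close> is 0, so its conditional expectation vanishes almost
    surely.\<close>
  have "AE v in P. 0 = nn_cond_exp P FXZ (\<lambda>_. 0) v"
    by (intro nn_cond_exp_F_meas) auto
  then show "AE v in P. real_cond_exp P FXZ f v = enn2real (nn_cond_exp P FXZ (\<lambda>v. ennreal (f v)) v)"
    by eventually_elim (simp add: real_cond_exp_def f(2) ennreal_neg)
qed

lemma \<delta>': "0 < \<delta>'" "\<delta>' \<le> 1"
  using constants by (auto simp: \<delta>'_def)

lemma dominated_powr: "\<bar>x\<bar> powr (2 + \<delta>') \<le> 1 + \<bar>x\<bar> powr (2 + \<delta>)" for x :: real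
proof (cases "\<bar>x\<bar> \<le> 1")
  case True
  then have "\<bar>x\<bar> powr (2 + \<delta>') \<le> 1" using \<delta>' by (intro powr_le1) auto
  then show ?thesis using powr_ge_zero[of "\<bar>x\<bar>" "2 + \<delta>"] by linarith
next
  case False
  then have "\<bar>x\<bar> powr (2 + \<delta>') \<le> \<bar>x\<bar> powr (2 + \<delta>)" by (intro powr_mono) (auto simp: \<delta>'_def)
  then show ?thesis by linarith
qed

lemma dominated_square: "x\<^sup>2 \<le> 1 + \<bar>x\<bar> powr (2 + \<delta>)" for x :: real
  using square_le_one_plus_powr[of \<delta> x] constants by simp

lemma sq_bounds:
  "AE v in P. nn_cond_exp P FXZ (\<lambda>v. ennreal ((\<epsilon> v)\<^sup>2)) v \<le> ennreal (1 + C)"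
  "integrable P (\<lambda>v. (\<epsilon> v)\<^sup>2)"
  "AE v in P. real_cond_exp P FXZ (\<lambda>v. (\<epsilon> v)\<^sup>2) v = enn2real (nn_cond_exp P FXZ (\<lambda>v. ennreal ((\<epsilon> v)\<^sup>2)) v)"
  by (intro cond_exp_bounded_by_moment dominated_square; simp)+

lemma powr_bounds:
  "AE v in P. nn_cond_exp P FXZ (\<lambda>v. ennreal (\<bar>\<epsilon> v\<bar> powr (2 + \<delta>'))) v \<le> ennreal (1 + C)"
  "integrable P (\<lambda>v. \<bar>\<epsilon> v\<bar> powr (2 + \<delta>'))"
  "AE v in P. real_cond_exp P FXZ (\<lambda>v. \<bar>\<epsilon> v\<bar> powr (2 + \<delta>')) v =
    enn2real (nn_cond_exp P FXZ (\<lambda>v. ennreal (\<bar>\<epsilon> v\<bar> powr (2 + \<delta>'))) v)"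
  by (intro cond_exp_bounded_by_moment dominated_powr; simp)+

lemma var_measurable: "var \<in> borel_measurable FXZ" "mom \<in> borel_measurable FXZ"
  unfolding var_def[abs_def] mom_def[abs_def] by measurable

text \<open>An almost sure inequality between constants holds outright on a probability space; it
  makes the clipping interval nonempty.\<close>

lemma c_le: "c \<le> 1 + C"
proof -
  have "AE v in P. ennreal c \<le> ennreal (1 + C)"
    using lower sq_bounds(1) by eventually_elim (rule order_trans)
  then have "ennreal c \<le> ennreal (1 + C)" by simp
  then show ?thesis using constants by (subst (asm) ennreal_le_iff) auto
qed

lemma var_bounds: "c \<le> var v" "var v \<le> 1 + C"
  using c_le by (auto simp: var_def)

lemma var_AE: "AE v in P. real_cond_exp P FXZ (\<lambda>v. (\<epsilon> v)\<^sup>2) v = var v"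
  using lower sq_bounds(1,3)
proof eventually_elim
  case (elim v)
  let ?y = "nn_cond_exp P FXZ (\<lambda>v. ennreal ((\<epsilon> v)\<^sup>2)) v"
  have "enn2real ?y \<le> 1 + C" using elim(2) constants by (intro enn2real_leI) auto
  moreover have "c \<le> enn2real ?y"
    using enn2real_mono[OF elim(1)] elim(2) constants by (auto simp: le_less_trans)
  ultimately show ?case by (simp add: var_def elim(3))
qed

lemma mom_AE: "AE v in P. real_cond_exp P FXZ (\<lambda>v. \<bar>\<epsilon> v\<bar> powr (2 + \<delta>')) v = mom v"
  using powr_bounds(1,3)
proof eventually_elim
  case (elim v)
  have "enn2real (nn_cond_exp P FXZ (\<lambda>v. ennreal (\<bar>\<epsilon> v\<bar> powr (2 + \<delta>'))) v) \<le> 1 + C"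
    using elim(1) constants by (intro enn2real_leI) auto
  then show ?case by (simp add: mom_def elim(2))
qed

lemma cond_exp_integral_eq:
  assumes g: "integrable P g" and g': "AE v in P. real_cond_exp P FXZ g v = g' v" "g' \<in> borel_measurable P"
    and h: "h \<in> borel_measurable FXZ" "\<And>v. v \<in> space P \<Longrightarrow> \<bar>h v\<bar> \<le> b"
  shows "(\<integral>v. h v * g v \<partial>P) = (\<integral>v. h v * g' v \<partial>P)"
proof -
  have hP: "h \<in> borel_measurable P" using measurable_from_subalg[OF subalgebra_FXZ h(1)] .
  have "(\<integral>v. h v * g v \<partial>P) = (\<integral>v. h v * real_cond_exp P FXZ g v \<partial>P)"
    using real_cond_exp_intg(2)[OF integrable_bounded_mult_real[OF g hP h(2)] h(1) borel_measurable_integrable[OF g]] by simp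
  also have "\<dots> = (\<integral>v. h v * g' v \<partial>P)"
    using g' hP by (intro integral_cong_AE) auto
  finally show ?thesis .
qed

lemma var_P: "var \<in> borel_measurable P" "mom \<in> borel_measurable P"
  using measurable_from_subalg[OF subalgebra_FXZ] var_measurable by auto

lemma integrable_var: "integrable P var"
proof (rule P.integrable_const_bound[where B="1 + C"])
  have "\<bar>var v\<bar> \<le> 1 + C" for v using var_bounds[of v] constants by linarith
  then show "AE v in P. norm (var v) \<le> 1 + C" by simp
qed (rule var_P)

lemma integrable_mom: "integrable P mom"
  using integrable_cong_AE[OF borel_measurable_cond_exp2 var_P(2) mom_AE] real_cond_exp_int(1)[OF powr_bounds(2)] by blast

lemma noise_array: "noise_array \<mu> n F (\<lambda>k w. \<epsilon> (ob w k)) (\<lambda>k w. var (ob w k)) \<delta>' c (1 + C)"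
proof -
  interpret M: prob_space \<mu> by (rule prob_\<mu>)
  have i2: "k \<in> {1..2*n}" if "k \<in> {1..n}" for k using that by auto
  have ob_space: "ob w k \<in> space P" if "k \<in> {1..n}" "w \<in> space \<mu>" for k w
    using measurable_space[OF ob_measurable[OF i2[OF that(1)]] that(2)] .
  show ?thesis
  proof
    show "subalgebra \<mu> (F k)" if "k \<in> {1..n}" for k using subalgebra_F[OF that] .
    show e: "(\<lambda>w. \<epsilon> (ob w k)) \<in> borel_measurable \<mu>" if "k \<in> {1..n}" for k
      using measurable_compose[OF ob_measurable[OF i2[OF that]] \<epsilon>_measurable] .
    show "(\<lambda>w. \<epsilon> (ob w j)) \<in> borel_measurable (F k)" if "j \<in> {1..n}" "k \<in> {1..n}" "j \<noteq> k" for j k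
      by (rule F_measurableI[OF that(2) e[OF that(1)]]) (simp add: ob_erase_Y_other[OF that(3)])
    show "(\<lambda>w. var (ob w j)) \<in> borel_measurable (F k)" if "j \<in> {1..n}" "k \<in> {1..n}" for j k
    proof -
      have "(\<lambda>w. var (ob w j)) \<in> borel_measurable \<mu>"
        using measurable_compose[OF ob_measurable[OF i2[OF that(1)]] var_P(1)] .
      \<comment> \<open>This covers j = k as well: \<open>var\<close> depends on an observation
        through (X,Z) only, which erasing the response leaves alone.\<close>
      moreover have "var (ob (erase_Y k w) j) = var (ob w j)" if w: "w \<in> space \<mu>" for w
        using ob_space[OF \<open>j \<in> {1..n}\<close> w]
          ob_space[OF \<open>j \<in> {1..n}\<close> measurable_space[OF erase_Y_measurable[OF \<open>k \<in> {1..n}\<close>] w]]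
        by (intro FXZ_measurable_eq[OF var_measurable(1)]) auto
      ultimately show ?thesis by (rule F_measurableI[OF that(2)])
    qed
    show "c \<le> var (ob w j)" "var (ob w j) \<le> 1 + C" for j w by (rule var_bounds)+
    show "0 < \<delta>'" "\<delta>' \<le> 1" "0 < c" using \<delta>' constants by auto
    show "integrable \<mu> (\<lambda>w. \<bar>\<epsilon> (ob w k)\<bar> powr (2 + \<delta>'))" if "k \<in> {1..n}" for k
      using integrable_ob[OF i2[OF that] powr_bounds(2)] .
    fix k and H :: "('s, 'x) outcome \<Rightarrow> real" and b
    assume k: "k \<in> {1..n}" and H: "H \<in> borel_measurable (F k)"
    {
      assume b: "\<And>w. w \<in> space \<mu> \<Longrightarrow> \<bar>H w\<bar> \<le> b"
      have "(\<integral>w. H w * \<epsilon> (ob w k) \<partial>\<mu>) = (\<integral>w. H w * 0 \<partial>\<mu>)"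
        by (rule integral_F_eq[OF k \<epsilon>_int _ cond_exp_integral_eq[OF \<epsilon>_int \<epsilon>_mean] H b]) simp_all
      then show "(\<integral>w. H w * \<epsilon> (ob w k) \<partial>\<mu>) = 0" by simp
      show "(\<integral>w. H w * (\<epsilon> (ob w k))\<^sup>2 \<partial>\<mu>) = (\<integral>w. H w * var (ob w k) \<partial>\<mu>)"
        by (rule integral_F_eq[OF k sq_bounds(2) integrable_var cond_exp_integral_eq[OF sq_bounds(2) var_AE var_P(1)] H b])
    }
    {
      assume b: "\<And>w. w \<in> space \<mu> \<Longrightarrow> 0 \<le> H w \<and> H w \<le> b"
      have b': "\<bar>H w\<bar> \<le> b" if "w \<in> space \<mu>" for w using b[OF that] by simp
      have HM: "H \<in> borel_measurable \<mu>" using measurable_from_subalg[OF subalgebra_F[OF k] H] .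
      have "(\<integral>w. H w * \<bar>\<epsilon> (ob w k)\<bar> powr (2 + \<delta>') \<partial>\<mu>) = (\<integral>w. H w * mom (ob w k) \<partial>\<mu>)"
        by (rule integral_F_eq[OF k powr_bounds(2) integrable_mom cond_exp_integral_eq[OF powr_bounds(2) mom_AE var_P(2)] H b'])
      also have "\<dots> \<le> (\<integral>w. (1 + C) * H w \<partial>\<mu>)"
      proof (rule integral_mono)
        show "integrable \<mu> (\<lambda>w. H w * mom (ob w k))"
          by (rule integrable_bounded_mult_real[OF integrable_ob[OF i2[OF k] integrable_mom] HM b'])
        show "integrable \<mu> (\<lambda>w. (1 + C) * H w)"
          using b' HM by (intro integrable_mult_right M.integrable_const_bound[where B=b]) auto
        show "H w * mom (ob w k) \<le> (1 + C) * H w" if "w \<in> space \<mu>" for w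
          using mult_left_mono[of "mom (ob w k)" "1 + C" "H w"] b[OF that] by (simp add: mom_def mult.commute)
      qed
      finally show "(\<integral>w. H w * \<bar>\<epsilon> (ob w k)\<bar> powr (2 + \<delta>') \<partial>\<mu>) \<le> (1 + C) * (\<integral>w. H w \<partial>\<mu>)" by simp
    }
  qed
qed

end

text \<open>The suprema along a subsequence dominate the probabilities for the chosen distributions.
  \<open>B\<close> need only lie inside the event for \<open>V\<close>, so each hypothesis can be
  used after a pointwise estimate.\<close>

lemma uniform_oP_tendsto:
  assumes V: "uniform_oP \<P> \<mu> V" and r: "strict_mono r" and P: "\<And>m. P m \<in> \<P> (r m)"
    and prob: "\<And>m. prob_space (\<mu> (r m) (P m))" and \<eta>: "0 < \<eta>"
    and meas: "\<And>m. V (r m) (P m) \<in> borel_measurable (\<mu> (r m) (P m))"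
    and B: "\<And>m w. w \<in> B m \<Longrightarrow> w \<in> space (\<mu> (r m) (P m)) \<and> \<eta> < \<bar>V (r m) (P m) w\<bar>"
  shows "(\<lambda>m. measure (\<mu> (r m) (P m)) (B m)) \<longlonglongrightarrow> 0"
proof -
  define D where "D m = {w \<in> space (\<mu> (r m) (P m)). \<eta> < \<bar>V (r m) (P m) w\<bar>}" for m
  let ?S = "\<lambda>n. SUP P\<in>\<P> n. emeasure (\<mu> n P) {w \<in> space (\<mu> n P). \<bar>V n P w\<bar> > \<eta>}"
  have "(\<lambda>m. ?S (r m)) \<longlonglongrightarrow> 0"
    using LIMSEQ_subseq_LIMSEQ[OF V[unfolded uniform_oP_def, rule_format, OF \<eta>] r] by (simp add: comp_def)
  then have "(\<lambda>m. ennreal (measure (\<mu> (r m) (P m)) (D m))) \<longlonglongrightarrow> 0"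
  proof (rule tendsto_sandwich[OF always_eventually always_eventually tendsto_const, rotated 2])
    show "\<forall>m. ennreal (measure (\<mu> (r m) (P m)) (D m)) \<le> ?S (r m)"
    proof
      fix m
      interpret prob_space "\<mu> (r m) (P m)" by (rule prob)
      show "ennreal (measure (\<mu> (r m) (P m)) (D m)) \<le> ?S (r m)"
        unfolding emeasure_eq_measure[symmetric] D_def by (rule SUP_upper[OF P])
    qed
  qed simp
  then have "(\<lambda>m. measure (\<mu> (r m) (P m)) (D m)) \<longlonglongrightarrow> 0" by (simp add: ennreal_tendsto_0_iff)
  then show ?thesis
  proof (rule tendsto_sandwich[OF always_eventually always_eventually tendsto_const, rotated 2])
    show "\<forall>m. measure (\<mu> (r m) (P m)) (B m) \<le> measure (\<mu> (r m) (P m)) (D m)"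
    proof
      fix m
      interpret prob_space "\<mu> (r m) (P m)" by (rule prob)
      note [measurable] = meas[of m]
      show "prob (B m) \<le> prob (D m)"
        using B by (intro finite_measure_mono) (auto simp: D_def)
    qed
  qed simp
qed

section \<open>Linear predictors, Hoelder's inequality and the error of the fitted mean\<close>

lemma dotp_diff: "dotp d b z - dotp d b' z = dotp d (\<lambda>j. b j - b' j) z"
  by (simp add: dotp_def sum_subtractf left_diff_distrib)

lemma dotp_sum_right: "(\<Sum>i\<in>I. a i * dotp d b (z i)) = dotp d b (\<lambda>j. \<Sum>i\<in>I. z i j * a i)"
  unfolding dotp_def sum_distrib_left by (subst sum.swap) (simp add: mult_ac)

lemma abs_dotp_le: "\<bar>dotp d b z\<bar> \<le> norm_l1 d b * norm_linf d z"
proof -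
  have "\<bar>dotp d b z\<bar> \<le> (\<Sum>j<d. \<bar>b j\<bar> * norm_linf d z)"
    unfolding dotp_def
  proof (rule order_trans[OF sum_abs sum_mono])
    fix j assume "j \<in> {..<d}"
    then have "\<bar>z j\<bar> \<le> norm_linf d z" unfolding norm_linf_def by (intro Max_ge) auto
    then show "\<bar>b j * z j\<bar> \<le> \<bar>b j\<bar> * norm_linf d z" by (simp add: abs_mult mult_left_mono)
  qed
  then show ?thesis by (simp add: norm_l1_def sum_distrib_right)
qed

lemma norm_l1_nonneg: "0 \<le> norm_l1 d b"
  by (simp add: norm_l1_def sum_nonneg)

text \<open>Valid also when all residuals vanish, since both sides are then 0; this allows passing
  between the two kinds of weights without a case distinction.\<close>

lemma resid_f_eq_upsilon:
  assumes "i \<in> {1..n}"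
  shows "resid_f A n w i = upsilon A n w i * sqrt (\<Sum>j\<in>{1..n}. (resid_f A n w j)\<^sup>2)"
proof (cases "(\<Sum>j\<in>{1..n}. (resid_f A n w j)\<^sup>2) = 0")
  case True
  then have "\<forall>j\<in>{1..n}. (resid_f A n w j)\<^sup>2 = 0" by (subst (asm) sum_nonneg_eq_0_iff) auto
  then show ?thesis using assms True by simp
next
  case False
  then show ?thesis by (simp add: upsilon_def)
qed

text \<open>The response minus its fitted mean is the noise minus the fitting error, which is the
  form \<open>e - b\<close> of the abstract arrays.\<close>

lemma pcm_stat_eq_studentized:
  "pcm_stat A n w = studentized n (\<lambda>i. (noise d \<gamma> (ob w i) - (mhat A n w (obsZ (ob w i)) - dotp d \<gamma> (obsZ (ob w i)))) * resid_f A n w i)"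
  by (simp add: pcm_stat_def studentized_def L_term_def noise_def)

context pcm_setting
begin

lemma Z_coord_measurable:
  assumes "i \<in> {1..n}" "j < d"
  shows "(\<lambda>w. obsZ (ob w i) j) \<in> borel_measurable \<mu>"
  using measurable_compose[OF ob_component_measurable(3) coord_measurable[OF assms(2)]] assms(1) by simp

lemma upsilon_measurable:
  assumes "i \<in> {1..n}"
  shows "(\<lambda>w. upsilon A n w i) \<in> borel_measurable \<mu>"
  unfolding upsilon_def
  by (intro borel_measurable_divide resid_f_measurable assms measurable_compose[OF _ borel_measurable_sqrt]
    borel_measurable_sum borel_measurable_power) auto

context
  fixes coef :: "'s \<Rightarrow> rvec pairs \<Rightarrow> rvec"
  assumes lasso: "lasso_regression n d (Q Step_m) (reg_m A) coef"
begin

lemma reg_m_eq_dotp: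
  assumes "w \<in> space \<mu>" "z \<in> space (vec_space d)"
  shows "reg_m A (seed w Step_m) (pairs_m n w) z = dotp d (coef (seed w Step_m) (pairs_m n w)) z"
  using lasso assms measurable_space[OF seed_measurable assms(1)] measurable_space[OF pairs_m_measurable assms(1)]
  unfolding lasso_regression_def by blast

text \<open>The \<open>j\<close>-th coefficient is the fitted value at the \<open>j\<close>-th unit vector.\<close>

lemma coef_measurable:
  assumes j: "j < d"
  shows "(\<lambda>w. coef (seed w Step_m) (pairs_m n w) j) \<in> borel_measurable \<mu>"
proof -
  define z :: rvec where "z = (\<lambda>i\<in>{..<d}. if i = j then 1 else 0)"
  have z: "z \<in> space (vec_space d)" by (auto simp: z_def vec_space_def space_PiM)
  have "(\<lambda>w. reg_m A (seed w Step_m) (pairs_m n w) z) \<in> borel_measurable \<mu>"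
    by (intro measurable_fitting_app[OF methods_measurable(6)] seed_measurable pairs_m_measurable measurable_const z)
  moreover have "dotp d b z = b j" for b
  proof -
    have "dotp d b z = (\<Sum>i<d. if i = j then b i else 0)" unfolding dotp_def z_def by (intro sum.cong) auto
    then show ?thesis using j by simp
  qed
  ultimately show ?thesis
    using reg_m_eq_dotp[OF _ z] by (simp cong: measurable_cong)
qed

lemma coef_error_measurable:
  "(\<lambda>w. norm_l1 d (\<lambda>j. coef (seed w Step_m) (pairs_m n w) j - \<gamma> j)) \<in> borel_measurable \<mu>"
  unfolding norm_l1_def
  by (intro borel_measurable_sum borel_measurable_abs borel_measurable_diff coef_measurable) auto

lemma mhat_error:
  assumes "w \<in> space \<mu>" "i \<in> {1..n}"
  shows "mhat A n w (obsZ (ob w i)) - dotp d \<gamma> (obsZ (ob w i)) =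
    dotp d (\<lambda>j. coef (seed w Step_m) (pairs_m n w) j - \<gamma> j) (obsZ (ob w i))"
proof -
  have "obsZ (ob w i) \<in> space (vec_space d)"
    using measurable_space[OF ob_component_measurable(3) assms(1)] assms(2) by simp
  then show ?thesis unfolding mhat_def reg_m_eq_dotp[OF assms(1) \<open>obsZ (ob w i) \<in> _\<close>] by (rule_tac dotp_diff)
qed

end

lemma norm_linf_measurable:
  assumes "\<And>j. j < d \<Longrightarrow> (\<lambda>w. z w j) \<in> borel_measurable \<mu>"
  shows "(\<lambda>w. norm_linf d (z w)) \<in> borel_measurable \<mu>"
  unfolding norm_linf_def
  by (intro borel_measurable_Max borel_measurable_abs assms) auto

end

section \<open>Uniformity over the family, by contradiction along a sequence\<close>

theorem proposition3:
  fixes d :: "nat \<Rightarrow> nat"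
    and MX :: "nat \<Rightarrow> 'x measure"
    and \<P>\<^sub>0 :: "nat \<Rightarrow> 'x obs measure set"
    and \<gamma> :: "nat \<Rightarrow> 'x obs measure \<Rightarrow> rvec"
    and Q :: "nat \<Rightarrow> step \<Rightarrow> 's measure"
    and A :: "nat \<Rightarrow> ('s, 'x) pcm_methods"
    and coef_mf coef_m :: "nat \<Rightarrow> 's \<Rightarrow> rvec pairs \<Rightarrow> rvec"
    and \<delta> c C :: real
  defines "\<mu> \<equiv> \<lambda>n P. outcome_measure n (Q n) P"
    and "\<upsilon> \<equiv> \<lambda>n w i. upsilon (A n) n w i"
    and "\<Delta> \<equiv> \<lambda>n P w. norm_l1 (d n) (\<lambda>j. coef_m n (seed w Step_m) (pairs_m n w) j - \<gamma> n P j)"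
  assumes dim: "\<And>n. 1 \<le> d n"
    and prob: "\<And>n P. P \<in> \<P>\<^sub>0 n \<Longrightarrow> prob_space P \<and> sets P = sets (obs_space (MX n) (d n))"
    and seeds: "\<And>n k. prob_space (Q n k)"
    and methods: "\<And>n. measurable_methods n (Q n) (MX n) (d n) (A n)"
    and lasso_mf: "\<And>n. lasso_regression n (d n) (Q n Step_mf) (reg_mf (A n)) (coef_mf n)"
    and lasso_m: "\<And>n. lasso_regression n (d n) (Q n Step_m) (reg_m (A n)) (coef_m n)"
    and mean: "\<And>n P. P \<in> \<P>\<^sub>0 n \<Longrightarrow> integrable P (noise (d n) (\<gamma> n P)) \<and>
      (AE v in P. real_cond_exp P (sigma_XZ (MX n) (d n)) (noise (d n) (\<gamma> n P)) v = 0)"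
    and constants: "0 < \<delta>" "\<delta> \<le> 2" "0 < c" "0 < C"
    and a_lower: "\<And>n P. P \<in> \<P>\<^sub>0 n \<Longrightarrow> AE v in P.
      ennreal c \<le> nn_cond_exp P (sigma_XZ (MX n) (d n))
        (\<lambda>v. ennreal ((noise (d n) (\<gamma> n P) v)\<^sup>2)) v"
    and a_upper: "\<And>n P. P \<in> \<P>\<^sub>0 n \<Longrightarrow> AE v in P.
      nn_cond_exp P (sigma_XZ (MX n) (d n))
        (\<lambda>v. ennreal (\<bar>noise (d n) (\<gamma> n P) v\<bar> powr (2 + \<delta>))) v \<le> ennreal C"
    and b_max: "uniform_oP \<P>\<^sub>0 \<mu> (\<lambda>n P w. Max ((\<lambda>i. \<bar>\<upsilon> n w i\<bar>) ` {1..n}))"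
    and b_sum: "uniform_oP \<P>\<^sub>0 \<mu> (\<lambda>n P w. (\<Sum>i\<in>{1..n}. (\<upsilon> n w i)\<^sup>2) - 1)"
    and cond_c: "uniform_oP \<P>\<^sub>0 \<mu> (\<lambda>n P w.
      Max ((\<lambda>i. norm_linf (d n) (obsZ (ob w i))) ` {1..n}) * \<Delta> n P w)"
    and cond_d: "uniform_oP \<P>\<^sub>0 \<mu> (\<lambda>n P w.
      \<Delta> n P w * norm_linf (d n) (\<lambda>j. \<Sum>i\<in>{1..n}. obsZ (ob w i) j * \<upsilon> n w i))"
  shows "(\<lambda>n. SUP P\<in>\<P>\<^sub>0 n. SUP t.
      ennreal \<bar>measure (\<mu> n P) {w \<in> space (\<mu> n P). pcm_stat (A n) n w \<le> t}
        - cdf std_normal_distribution t\<bar>) \<longlonglongrightarrow> 0"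
proof -
  define dist_sup where "dist_sup n = (SUP P\<in>\<P>\<^sub>0 n. SUP t.
      ennreal \<bar>measure (\<mu> n P) {w \<in> space (\<mu> n P). pcm_stat (A n) n w \<le> t}
        - cdf std_normal_distribution t\<bar>)" for n
  have small: "\<forall>\<^sub>F n in sequentially. dist_sup n \<le> ennreal b" if b: "0 < b" for b :: real
  proof (rule ccontr)
    assume "\<not> ?thesis"
    from not_eventually_sequentiallyD[OF this]
    obtain r0 :: "nat \<Rightarrow> nat" where r0: "strict_mono r0" "\<And>n. \<not> dist_sup (r0 n) \<le> ennreal b"
      by blast
    \<comment> \<open>Dropping the first index ensures sample sizes of at least 1, as a strictly
      increasing sequence has r0 (m + 1) \<ge> m + 1.\<close>
    define r where "r m = r0 (Suc m)" for m
    have r: "strict_mono r" using r0(1) by (auto simp: r_def strict_mono_def)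
    have r_pos: "1 \<le> r m" for m
      using strict_mono_imp_increasing[OF r0(1), of "Suc m"] by (simp add: r_def)
    define far where "far m P t \<longleftrightarrow> ennreal b < ennreal \<bar>measure (\<mu> (r m) P) {w \<in> space (\<mu> (r m) P).
        pcm_stat (A (r m)) (r m) w \<le> t} - cdf std_normal_distribution t\<bar>" for m P t
    have "\<exists>P\<in>\<P>\<^sub>0 (r m). \<exists>t. far m P t" for m
      using r0(2)[of "Suc m"] unfolding dist_sup_def r_def[symmetric] not_le less_SUP_iff far_def by simp
    then obtain P where P: "\<And>m. P m \<in> \<P>\<^sub>0 (r m)" and "\<And>m. \<exists>t. far m (P m) t"
      by metis
    then obtain t where large: "\<And>m. far m (P m) (t m)"
      by metis
    define N where "N m = \<mu> (r m) (P m)" for m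
    define g where "g m = \<gamma> (r m) (P m)" for m
    interpret pcm: pcm_noise "r m" "d (r m)" "MX (r m)" "Q (r m)" "A (r m)" "P m" "g m" \<delta> c C for m
      unfolding g_def
    proof (intro pcm_noise.intro pcm_setting.intro pcm_noise_axioms.intro)
      show "prob_space (P m)" "sets (P m) = sets (obs_space (MX (r m)) (d (r m)))"
        using prob[OF P[of m]] by (rule conjunct1, rule conjunct2)
      show "integrable (P m) (noise (d (r m)) (\<gamma> (r m) (P m)))"
        using mean[OF P[of m]] by (rule conjunct1)
      show "AE v in P m. real_cond_exp (P m) (sigma_XZ (MX (r m)) (d (r m))) (noise (d (r m)) (\<gamma> (r m) (P m))) v = 0"
        using mean[OF P[of m]] by (rule conjunct2)
    qed (rule r_pos seeds methods constants a_lower[OF P[of m]] a_upper[OF P[of m]])+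
    have N_eq: "pcm.\<mu> m = N m" for m unfolding N_def \<mu>_def pcm.\<mu>_def ..
    have prob_N: "prob_space (N m)" for m using pcm.prob_\<mu>[of m] by (simp only: N_eq)
    define u where "u m j w = resid_f (A (r m)) (r m) w j" for m j w
    define h where "h m j w = mhat (A (r m)) (r m) w (obsZ (ob w j)) - dotp (d (r m)) (g m) (obsZ (ob w j))" for m j w
    define s where "s m w = (\<Sum>j\<in>{1..r m}. (u m j w)\<^sup>2)" for m w
    have \<upsilon>_meas: "(\<lambda>w. \<upsilon> (r m) w i) \<in> borel_measurable (N m)" if "i \<in> {1..r m}" for m i
      unfolding \<upsilon>_def N_eq[symmetric] by (rule pcm.upsilon_measurable[OF that])
    have \<Delta>_meas: "\<Delta> (r m) (P m) \<in> borel_measurable (N m)" for m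
      unfolding \<Delta>_def N_eq[symmetric] by (rule pcm.coef_error_measurable[OF lasso_m])
    have u_eq: "u m j w = \<upsilon> (r m) w j * sqrt (s m w)" if "j \<in> {1..r m}" for m j w
      unfolding u_def s_def \<upsilon>_def by (rule resid_f_eq_upsilon[OF that])
    have h_eq: "h m j w = dotp (d (r m)) (\<lambda>j. coef_m (r m) (seed w Step_m) (pairs_m (r m) w) j - g m j) (obsZ (ob w j))"
      if "j \<in> {1..r m}" "w \<in> space (N m)" for m j w
      unfolding h_def by (rule pcm.mhat_error[OF lasso_m _ that(1)]) (use that(2) in \<open>simp only: N_eq\<close>)
    have s_nonneg: "0 \<le> s m w" for m w unfolding s_def by (intro sum_nonneg) simp
    \<comment> \<open>The exponent \<open>min \<delta> 1\<close> and the constant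
      \<open>1 + C\<close> are the same for all members of the sequence, so the error bounds are
      uniform along it.\<close>
    interpret seq: noise_array_sequence N r "\<lambda>m. pcm.F m" "\<lambda>m k w. noise (d (r m)) (g m) (ob w k)"
      "\<lambda>m k w. pcm.var m (ob w k)" u h "min \<delta> 1" c "1 + C"
    proof (rule noise_array_sequence.intro)
      show "noise_array (N m) (r m) (pcm.F m) (\<lambda>k w. noise (d (r m)) (g m) (ob w k))
          (\<lambda>k w. pcm.var m (ob w k)) (min \<delta> 1) c (1 + C)" for m
        using pcm.noise_array[of m] unfolding N_eq pcm.\<delta>'_def .
      show "1 \<le> r m" for m by (rule r_pos)
      show "filterlim r at_top sequentially" by (rule filterlim_subseq[OF r])
      show "u m j \<in> borel_measurable (pcm.F m k)" if "j \<in> {1..r m}" "k \<in> {1..r m}" for m j k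
        unfolding u_def[abs_def]
        by (rule pcm.F_measurableI[OF that(2) pcm.resid_f_measurable[OF that(1)] resid_f_erase_Y[OF that(2)]])
      show "h m j \<in> borel_measurable (N m)" if "j \<in> {1..r m}" for m j
      proof -
        have Z: "(\<lambda>w. obsZ (ob w j)) \<in> pcm.\<mu> m \<rightarrow>\<^sub>M vec_space (d (r m))"
          using that by (intro pcm.ob_component_measurable) auto
        have "(\<lambda>w. dotp (d (r m)) (g m) (obsZ (ob w j))) \<in> borel_measurable (pcm.\<mu> m)"
          unfolding dotp_def
          by (intro borel_measurable_sum borel_measurable_times borel_measurable_const pcm.Z_coord_measurable that) auto
        with pcm.mhat_measurable[OF Z] show ?thesis
          unfolding h_def[abs_def] N_eq[symmetric] by (rule borel_measurable_diff)
      qed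
      show "(\<lambda>m. measure (N m) {w \<in> space (N m). (\<Sum>i\<in>{1..r m}. (u m i w)\<^sup>2) = 0}) \<longlonglongrightarrow> 0"
        unfolding N_def
      \<comment> \<open>Where all residuals vanish, every \<open>\<upsilon>\<close> is 0 by the
        division convention and the sum in (b) misses 1 by 1 > 1/2; so (b) makes this event
        negligible.\<close>
      proof (rule uniform_oP_tendsto[OF b_sum r P prob_N[unfolded N_def], of "1 / 2"])
        show "(\<lambda>w. (\<Sum>i\<in>{1..r m}. (\<upsilon> (r m) w i)\<^sup>2) - 1) \<in> borel_measurable (\<mu> (r m) (P m))" for m
          using \<upsilon>_meas[of _ m] unfolding N_def
          by (intro borel_measurable_diff borel_measurable_sum borel_measurable_power borel_measurable_const)
        fix m w assume w: "w \<in> {w \<in> space (\<mu> (r m) (P m)). (\<Sum>i\<in>{1..r m}. (u m i w)\<^sup>2) = 0}"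
        then have "sqrt (\<Sum>i\<in>{1..r m}. (u m i w)\<^sup>2) = 0" by simp
        then have "\<upsilon> (r m) w i = 0" for i by (simp add: \<upsilon>_def upsilon_def u_def)
        with w show "w \<in> space (\<mu> (r m) (P m)) \<and> 1 / 2 < \<bar>(\<Sum>i\<in>{1..r m}. (\<upsilon> (r m) w i)\<^sup>2) - 1\<bar>" by simp
      qed simp
      fix \<eta> :: real assume \<eta>: "0 < \<eta>"
      show "(\<lambda>m. measure (N m) {w \<in> space (N m). \<not> (\<forall>j\<in>{1..r m}. \<bar>u m j w\<bar> \<le>
          \<eta> * sqrt (\<Sum>i\<in>{1..r m}. (u m i w)\<^sup>2))}) \<longlonglongrightarrow> 0"
        unfolding N_def
      proof (rule uniform_oP_tendsto[OF b_max r P prob_N[unfolded N_def] \<eta>])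
        show "(\<lambda>w. Max ((\<lambda>i. \<bar>\<upsilon> (r m) w i\<bar>) ` {1..r m})) \<in> borel_measurable (\<mu> (r m) (P m))" for m
          using \<upsilon>_meas[of _ m] unfolding N_def by (intro borel_measurable_Max borel_measurable_abs) auto
        fix m w assume w: "w \<in> {w \<in> space (\<mu> (r m) (P m)). \<not> (\<forall>j\<in>{1..r m}. \<bar>u m j w\<bar> \<le>
          \<eta> * sqrt (\<Sum>i\<in>{1..r m}. (u m i w)\<^sup>2))}"
        then obtain j where j: "j \<in> {1..r m}" "\<eta> * sqrt (s m w) < \<bar>u m j w\<bar>" by (auto simp: s_def not_le)
        have "\<eta> * sqrt (s m w) < \<bar>\<upsilon> (r m) w j\<bar> * sqrt (s m w)"
          using j s_nonneg[of m w] by (simp add: u_eq[OF j(1)] abs_mult)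
        then have "\<eta> < \<bar>\<upsilon> (r m) w j\<bar>"
          using s_nonneg[of m w] by (meson mult_right_less_imp_less real_sqrt_ge_zero)
        also have "\<dots> \<le> Max ((\<lambda>i. \<bar>\<upsilon> (r m) w i\<bar>) ` {1..r m})" using j(1) by (intro Max_ge) auto
        finally show "w \<in> space (\<mu> (r m) (P m)) \<and> \<eta> < \<bar>Max ((\<lambda>i. \<bar>\<upsilon> (r m) w i\<bar>) ` {1..r m})\<bar>"
          using w by auto
      qed
      show "(\<lambda>m. measure (N m) {w \<in> space (N m). \<not> (\<forall>j\<in>{1..r m}. \<bar>h m j w\<bar> \<le> \<eta>)}) \<longlonglongrightarrow> 0"
        unfolding N_def
      proof (rule uniform_oP_tendsto[OF cond_c r P prob_N[unfolded N_def] \<eta>])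
        have "(\<lambda>w. norm_linf (d (r m)) (obsZ (ob w i))) \<in> borel_measurable (N m)" if "i \<in> {1..r m}" for i m
          unfolding N_eq[symmetric] by (intro pcm.norm_linf_measurable pcm.Z_coord_measurable that)
        then show "(\<lambda>w. Max ((\<lambda>i. norm_linf (d (r m)) (obsZ (ob w i))) ` {1..r m}) * \<Delta> (r m) (P m) w)
            \<in> borel_measurable (\<mu> (r m) (P m))" for m
          using \<Delta>_meas[of m] unfolding N_def by (intro borel_measurable_times borel_measurable_Max) auto
        fix m w assume w: "w \<in> {w \<in> space (\<mu> (r m) (P m)). \<not> (\<forall>j\<in>{1..r m}. \<bar>h m j w\<bar> \<le> \<eta>)}"
        then obtain j where j: "j \<in> {1..r m}" "\<eta> < \<bar>h m j w\<bar>" by (auto simp: not_le)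
        have "\<bar>h m j w\<bar> \<le> \<Delta> (r m) (P m) w * norm_linf (d (r m)) (obsZ (ob w j))"
          using h_eq[OF j(1), of w] w abs_dotp_le by (simp add: N_def \<Delta>_def g_def)
        also have "\<dots> \<le> \<Delta> (r m) (P m) w * Max ((\<lambda>i. norm_linf (d (r m)) (obsZ (ob w i))) ` {1..r m})"
          using j(1) by (intro mult_left_mono Max_ge) (auto simp: \<Delta>_def norm_l1_nonneg)
        finally show "w \<in> space (\<mu> (r m) (P m)) \<and>
            \<eta> < \<bar>Max ((\<lambda>i. norm_linf (d (r m)) (obsZ (ob w i))) ` {1..r m}) * \<Delta> (r m) (P m) w\<bar>"
          using w j(2) by (simp add: mult.commute)
      qed
      show "(\<lambda>m. measure (N m) {w \<in> space (N m). \<not> \<bar>\<Sum>j\<in>{1..r m}. u m j w * h m j w\<bar> \<le>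
          \<eta> * sqrt (\<Sum>i\<in>{1..r m}. (u m i w)\<^sup>2)}) \<longlonglongrightarrow> 0"
        unfolding N_def
      proof (rule uniform_oP_tendsto[OF cond_d r P prob_N[unfolded N_def] \<eta>])
        have "(\<lambda>w. norm_linf (d (r m)) (\<lambda>j. \<Sum>i\<in>{1..r m}. obsZ (ob w i) j * \<upsilon> (r m) w i)) \<in> borel_measurable (N m)" for m
          using \<upsilon>_meas[of _ m] unfolding N_eq[symmetric]
          by (intro pcm.norm_linf_measurable borel_measurable_sum borel_measurable_times pcm.Z_coord_measurable)
        then show "(\<lambda>w. \<Delta> (r m) (P m) w * norm_linf (d (r m)) (\<lambda>j. \<Sum>i\<in>{1..r m}. obsZ (ob w i) j * \<upsilon> (r m) w i))
            \<in> borel_measurable (\<mu> (r m) (P m))" for m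
          using \<Delta>_meas[of m] unfolding N_def by (intro borel_measurable_times)
        fix m w assume w: "w \<in> {w \<in> space (\<mu> (r m) (P m)). \<not> \<bar>\<Sum>j\<in>{1..r m}. u m j w * h m j w\<bar> \<le>
          \<eta> * sqrt (\<Sum>i\<in>{1..r m}. (u m i w)\<^sup>2)}"
        then have wN: "w \<in> space (N m)" by (simp add: N_def)
        let ?b = "\<lambda>j. coef_m (r m) (seed w Step_m) (pairs_m (r m) w) j - g m j"
        let ?z = "\<lambda>j. \<Sum>i\<in>{1..r m}. obsZ (ob w i) j * \<upsilon> (r m) w i"
        \<comment> \<open>By linearity the sum over the sample moves inside the scalar product,
          before absolute values are taken; Hoelder's inequality then gives exactly the quantity in
          (d).\<close>
        have "(\<Sum>j\<in>{1..r m}. u m j w * h m j w) =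
            (\<Sum>j\<in>{1..r m}. sqrt (s m w) * (\<upsilon> (r m) w j * dotp (d (r m)) ?b (obsZ (ob w j))))"
          using h_eq[OF _ wN] u_eq by (intro sum.cong) auto
        also have "\<dots> = sqrt (s m w) * dotp (d (r m)) ?b ?z"
          by (simp only: sum_distrib_left[symmetric] dotp_sum_right)
        finally have eq: "(\<Sum>j\<in>{1..r m}. u m j w * h m j w) = sqrt (s m w) * dotp (d (r m)) ?b ?z" .
        have "\<eta> * sqrt (s m w) < \<bar>\<Sum>j\<in>{1..r m}. u m j w * h m j w\<bar>"
          using w unfolding s_def not_le by blast
        then have "\<eta> * sqrt (s m w) < \<bar>dotp (d (r m)) ?b ?z\<bar> * sqrt (s m w)"
          unfolding eq abs_mult using s_nonneg[of m w] by (simp add: mult.commute)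
        then have "\<eta> < \<bar>dotp (d (r m)) ?b ?z\<bar>"
          using s_nonneg[of m w] by (meson mult_right_less_imp_less real_sqrt_ge_zero)
        also have "\<dots> \<le> \<Delta> (r m) (P m) w * norm_linf (d (r m)) ?z"
          using abs_dotp_le[of "d (r m)" ?b ?z] by (simp add: \<Delta>_def g_def)
        finally show "w \<in> space (\<mu> (r m) (P m)) \<and> \<eta> < \<bar>\<Delta> (r m) (P m) w * norm_linf (d (r m)) ?z\<bar>"
          using w by auto
      qed
    qed
    have "seq.T m w = pcm_stat (A (r m)) (r m) w" for m w
      unfolding seq.T_def u_def h_def pcm_stat_eq_studentized[of "A (r m)" "r m" w "d (r m)" "g m"] ..
    then have "(\<lambda>m. measure (\<mu> (r m) (P m)) {w \<in> space (\<mu> (r m) (P m)). pcm_stat (A (r m)) (r m) w \<le> t m}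
        - cdf std_normal_distribution (t m)) \<longlonglongrightarrow> 0"
      using seq.T_cdf_uniform_lim[of t] by (simp add: N_def)
    then have "\<forall>\<^sub>F m in sequentially. \<bar>measure (\<mu> (r m) (P m)) {w \<in> space (\<mu> (r m) (P m)). pcm_stat (A (r m)) (r m) w \<le> t m}
        - cdf std_normal_distribution (t m)\<bar> < b"
      using tendstoD[OF _ b] by (force simp: dist_real_def)
    then obtain m where "\<bar>measure (\<mu> (r m) (P m)) {w \<in> space (\<mu> (r m) (P m)). pcm_stat (A (r m)) (r m) w \<le> t m}
        - cdf std_normal_distribution (t m)\<bar> < b"
      unfolding eventually_sequentially by blast
    then show False using large[of m] b by (simp add: far_def ennreal_less_iff)
  qed
  have "dist_sup \<longlonglongrightarrow> 0"
  proof (rule order_tendstoI)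
    fix a :: ennreal assume "0 < a"
    \<comment> \<open>An intermediate value is finite because it lies below \<open>a\<close>, even
      when \<open>a\<close> is infinite, so the bound for real levels applies and leaves strict
      room.\<close>
    then obtain b' where b': "0 < b'" "b' < a" using dense by blast
    then obtain b where b: "b' = ennreal b" "0 \<le> b" by (cases b' rule: ennreal_cases) auto
    then have "0 < b" using b'(1) by simp
    from small[OF this] show "\<forall>\<^sub>F n in sequentially. dist_sup n < a"
      by eventually_elim (use b' b in \<open>auto intro: le_less_trans\<close>)
  qed simp
  then show ?thesis unfolding dist_sup_def .
qed

end
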